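(* Let $\{u_h^j\}_{j=1}^n$ be solutions of the discrete Navier-Stokes scheme: $u_h^{j}\in V_h^{div}$ and $$\Big\langle\frac{u_h^{j+1}-u_h^j}{\tau},v_h\Big\rangle+a(u_h^{j+1},v_h)+b(u_h^{j+1},u_h^{j+1},v_h)=\langle f^{j+1},v_h\rangle\quad\forall v_h\in V_h^{div},\ j=0,\dots,n-1,\qquad u_h^0=u_{0,h},$$ with given initial condition $u_{0,h}\in L^2(\Omega)$, and let $\{\vec u_h^j\}_{j=1}^n$ be the vector representations of $\{u_h^j\}_{j=1}^n$. Consider the POD operator $$U=\begin{bmatrix}\tau^{1/2}\vec u_h^1&\tau^{1/2}\vec u_h^2&\cdots&\tau^{1/2}\vec u_h^n\end{bmatrix}:\mathbb{R}^n\to\mathbb{R}^m_M,$$ where the weight matrix $M$ is induced by the $H^1(\Omega)$ norm. Let $$\widetilde U=\begin{bmatrix}\tau^{1/2}\vec u_{h,r}^1&\tau^{1/2}\vec u_{h,r}^2&\cdots&\tau^{1/2}\vec u_{h,r}^n\end{bmatrix}$$ be the approximated data matrix of $U$ obtained by applying the iPOD, and let $\epsilon$ be an error satisfying $\|U-\widetilde U\|_{\mathrm{HS}}\le\epsilon$. If the time step $\tau$ is small enough, then the gradient error $\xi$ introduced via the iPOD is bounded by $$\|\xi\|_{L^2(\Omega)}\le\sqrt{C_4e^{C_3T}}\;\epsilon,\qquad T=n\tau,$$ where $C_3$ and $C_4$ are constants depending on $\Omega$, $\{u_h^{*j}\}_{j=1}^n$ and $\{u_{h,r}^{*j}\}_{j=1}^n$;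 here $\{u_h^{*j}\}$ is the solution of the backward adjoint scheme and $\{u_{h,r}^{*j}\}$ is the solution of the backward adjoint scheme with $\{u_h^{j+1}\}_{j=0}^{n-1}$ replaced by $\{u_{h,r}^{j+1}\}_{j=0}^{n-1}$.
   Context: $\Omega\subset\mathbb{R}^2$ is a bounded domain, $\nu>0$ is the viscosity, $\tau>0$ the time step. $V_h\subset H_0^1(\Omega)^2$ and $Q_h\subset\{q\in L^2(\Omega):\int_\Omega q\,dx=0\}$ are finite element spaces forming an inf-sup stable pair, and $V_h^{div}=\{v\in V_h:(q,\nabla\cdot v)=0\ \forall q\in Q_h\}$. $\mathbb{D}(u)=\frac12(\nabla u+\nabla^Tu)$, $$a(u,v)=\int_\Omega\nu\,\mathbb{D}(u):\mathbb{D}(v),\qquad b(u,w,v)=\int_\Omega (u\cdot\nabla)w\cdot v .$$ $\langle\cdot,\cdot\rangle$ is the duality pairing extending the $L^2$ inner product; $f^j$ are given source terms in $H^{-1}(\Omega)$. $L^2(\Omega)$, $H^1(\Omega)$ norms of vector fields are the usual componentwise ones. Optimization problem: given observations $\hat u^j\in L^2(\Omega)$ and $\gamma$, minimize $J(u_{0,h})=\frac{\tau}{2}\sum_{j=1}^n\|\hat u^j-u_h^j\|_{L^2(\Omega)}^2+\frac{\gamma}{2}\|u_{0,h}\|_{L^2(\Omega)}^2$ subject to the discrete Navier-Stokes scheme. Backward adjoint scheme: for $j=n-1,\dots,0$ find $(u_h^{*j},p_h^{*j})\in V_h\times Q_h$ with $$\Big\langle-\frac{u_h^{*j+1}-u_h^{*j}}{\tau},v_h\Big\rangle+a(u_h^{*j},v_h)+b(v_h,u_h^{j+1},u_h^{*j})+b(u_h^{j+1},v_h,u_h^{*j})+(p_h^{*j},\nabla\cdot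 v_h)=\langle\hat u^{j+1}-u_h^{j+1},v_h\rangle\quad\forall v_h\in V_h,$$ $$(\nabla\cdot u_h^{*j},q_h)=0\quad\forall q_h\in Q_h,\qquad u_h^{*n}=0.$$ The gradient is $\nabla J(u_{0,h})=-u_h^{*0}+\gamma u_{0,h}$. With $u_{h,r}^j\in V_h$ the function with coefficient vector $\vec u_{h,r}^j$, the sequence $\{u_{h,r}^{*j}\}$ solves the same backward scheme (with $u_{h,r}^{*n}=0$) with every $u_h^{j+1}$ replaced by $u_{h,r}^{j+1}$. The computed gradient is $-u_{h,r}^{*0}+\gamma u_{0,h}$, and the gradient error $\xi$ is the computed gradient minus the exact one, $\xi=u_h^{*0}-u_{h,r}^{*0}$. $m$ is the dimension of $V_h$ and vector representations are coefficient vectors in a fixed finite element basis of $V_h$; $\mathbb{R}^m_M$ is $\mathbb{R}^m$ with inner product $\vec y^TM\vec x$, where $M$ is the Gram matrix of the basis in the $H^1(\Omega)$ inner product, so $\|\vec v_h\|_{\mathbb{R}^m_M}=\|v_h\|_{H^1(\Omega)}$. $\|\cdot\|_{\mathrm{HS}}$ is the Hilbert-Schmidt norm of operators from $\mathbb{R}^n$ (standard inner product) to $\mathbb{R}^m_M$. iPOD (incremental proper orthogonal decomposition, here with weight matrix $M$): the columns $\vec c^1,\dots,\vec c^n$ of the data matrix are processed one by one, starting with $\widetilde U^1=\vec c^1\ne 0$. Given $\widetilde U^j=V\Sigma W^T$ with $V^TMV=I$, $W^TW=I$, $\Sigma$ diagonal with positive decreasing entries, and thresholds $\mathtt{tol}_p,\mathtt{tol}_{sv}>0$,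 let $p=\|\vec c^{j+1}-VV^TM\vec c^{j+1}\|_{\mathbb{R}^m_M}$. If $p<\mathtt{tol}_p$ set $\widetilde U^{j+1}=\begin{bmatrix}\widetilde U^j&VV^TM\vec c^{j+1}\end{bmatrix}$; if $p\ge\mathtt{tol}_p$ and the smallest positive singular value of $\begin{bmatrix}\widetilde U^j&\vec c^{j+1}\end{bmatrix}:\mathbb{R}^{j+1}\to\mathbb{R}^m_M$ is $<\mathtt{tol}_{sv}$, let $\widetilde U^{j+1}$ be that matrix with this singular value and its singular vectors removed from its SVD; otherwise $\widetilde U^{j+1}=\begin{bmatrix}\widetilde U^j&\vec c^{j+1}\end{bmatrix}$. The output is $\widetilde U=\widetilde U^n$. *)

theory Defs
  imports "HOL-Analysis.Analysis" "Jordan_Normal_Form.Matrix"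
begin

text \<open>
  Points and values of vector fields live in the type \<open>real ^ 2\<close>. Data matrices, whose size varies,
  are matrices of \<open>Jordan_Normal_Form\<close>. The infix dot and the postfix dollar are used by both
  libraries, so the inner product of HOL-Analysis is written \<open>inner\<close> and the operations on
  size-carrying vectors are written \<open>scalar_prod\<close> and \<open>vec_index\<close>.
\<close>

type_synonym point = "real ^ 2"
type_synonym scalar_field = "point \<Rightarrow> real"
type_synonym vector_field = "point \<Rightarrow> real ^ 2"

definition bounded_domain :: "point set \<Rightarrow> bool" where
  "bounded_domain \<Omega> \<longleftrightarrow> open \<Omega> \<and> connected \<Omega> \<and> \<Omega> \<noteq> {} \<and> bounded \<Omega>"

section \<open>Function spaces\<close>

text \<open>
  Elements of the function spaces are represented by functions; only their values almost
  everywhere on \<open>\<Omega>\<close> matter.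
\<close>

definition L2 :: "point set \<Rightarrow> (point \<Rightarrow> 'a :: euclidean_space) set" where
  "L2 \<Omega> = {u. u \<in> borel_measurable (lebesgue_on \<Omega>) \<and>
               integrable (lebesgue_on \<Omega>) (\<lambda>x. (norm (u x))\<^sup>2)}"

definition l2_inner :: "point set \<Rightarrow> (point \<Rightarrow> 'a :: euclidean_space) \<Rightarrow> (point \<Rightarrow> 'a) \<Rightarrow> real" where
  "l2_inner \<Omega> u v = (LINT x|lebesgue_on \<Omega>. inner (u x) (v x))"

definition l2_norm :: "point set \<Rightarrow> (point \<Rightarrow> 'a :: euclidean_space) \<Rightarrow> real" where
  "l2_norm \<Omega> u = sqrt (l2_inner \<Omega> u u)"

text \<open>Mean-free square-integrable functions, the ambient space of the pressures.\<close>

definition L2_0 :: "point set \<Rightarrow> scalar_field set" where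
  "L2_0 \<Omega> = {q \<in> L2 \<Omega>. (LINT x|lebesgue_on \<Omega>. q x) = 0}"

definition partial_deriv :: "2 \<Rightarrow> scalar_field \<Rightarrow> scalar_field" where
  "partial_deriv i \<phi> = (\<lambda>x. frechet_derivative \<phi> (at x) (axis i 1))"

fun k_times_cont_diff :: "nat \<Rightarrow> scalar_field \<Rightarrow> bool" where
  "k_times_cont_diff 0 \<phi> \<longleftrightarrow> continuous_on UNIV \<phi>"
| "k_times_cont_diff (Suc k) \<phi> \<longleftrightarrow>
     (\<forall>x. \<phi> differentiable (at x)) \<and> (\<forall>i. k_times_cont_diff k (partial_deriv i \<phi>))"

text \<open>Smooth functions whose support is a compact subset of \<open>\<Omega>\<close>.\<close>

definition test_functions :: "point set \<Rightarrow> scalar_field set" where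
  "test_functions \<Omega> = {\<phi>. (\<forall>k. k_times_cont_diff k \<phi>) \<and>
     compact (closure {x. \<phi> x \<noteq> 0}) \<and> closure {x. \<phi> x \<noteq> 0} \<subseteq> \<Omega>}"

definition is_weak_partial_deriv :: "point set \<Rightarrow> 2 \<Rightarrow> scalar_field \<Rightarrow> scalar_field \<Rightarrow> bool" where
  "is_weak_partial_deriv \<Omega> i u g \<longleftrightarrow>
     (\<forall>\<phi>\<in>test_functions \<Omega>. (LINT x|lebesgue_on \<Omega>. u x * partial_deriv i \<phi> x)
                           = - (LINT x|lebesgue_on \<Omega>. g x * \<phi> x))"

text \<open>A representative of the weak derivative (which is unique almost everywhere).\<close>

definition weak_partial_deriv :: "point set \<Rightarrow> 2 \<Rightarrow> scalar_field \<Rightarrow> scalar_field" where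
  "weak_partial_deriv \<Omega> i u = (SOME g. g \<in> L2 \<Omega> \<and> is_weak_partial_deriv \<Omega> i u g)"

text \<open>Row \<open>k\<close>, column \<open>i\<close> of the weak gradient is the \<open>i\<close>-th derivative of the \<open>k\<close>-th component.\<close>

definition weak_grad :: "point set \<Rightarrow> vector_field \<Rightarrow> point \<Rightarrow> real ^ 2 ^ 2" where
  "weak_grad \<Omega> u x = (\<chi> k i. weak_partial_deriv \<Omega> i (\<lambda>y. vec_nth (u y) k) x)"

definition weak_div :: "point set \<Rightarrow> vector_field \<Rightarrow> scalar_field" where
  "weak_div \<Omega> u x = (\<Sum>i\<in>UNIV. vec_nth (vec_nth (weak_grad \<Omega> u x) i) i)"

definition H1 :: "point set \<Rightarrow> vector_field set" where
  "H1 \<Omega> = {u \<in> L2 \<Omega>. \<forall>k i. \<exists>g\<in>L2 \<Omega>. is_weak_partial_deriv \<Omega> i (\<lambda>x. vec_nth (u x) k) g}"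

text \<open>The inner product of \<open>real ^ 2 ^ 2\<close> is the Frobenius product.\<close>

definition h1_inner :: "point set \<Rightarrow> vector_field \<Rightarrow> vector_field \<Rightarrow> real" where
  "h1_inner \<Omega> u v = l2_inner \<Omega> u v +
     (LINT x|lebesgue_on \<Omega>. inner (weak_grad \<Omega> u x) (weak_grad \<Omega> v x))"

definition h1_norm :: "point set \<Rightarrow> vector_field \<Rightarrow> real" where
  "h1_norm \<Omega> u = sqrt (h1_inner \<Omega> u u)"

text \<open>The closure in the \<open>H1\<close> norm of the smooth compactly supported vector fields.\<close>

definition H10 :: "point set \<Rightarrow> vector_field set" where
  "H10 \<Omega> = {u \<in> H1 \<Omega>. \<forall>e>0. \<exists>\<phi>. (\<forall>k. (\<lambda>x. vec_nth (\<phi> x) k) \<in> test_functions \<Omega>) \<and>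
                                  h1_norm \<Omega> (\<lambda>x. u x - \<phi> x) < e}"

text \<open>Bounded linear functionals on \<open>H10\<close>; the duality pairing is application.\<close>

definition Hminus1 :: "point set \<Rightarrow> (vector_field \<Rightarrow> real) set" where
  "Hminus1 \<Omega> = {F.
     (\<forall>v\<in>H10 \<Omega>. \<forall>w\<in>H10 \<Omega>. \<forall>a b. F (\<lambda>x. a *\<^sub>R v x + b *\<^sub>R w x) = a * F v + b * F w) \<and>
     (\<exists>C. \<forall>v\<in>H10 \<Omega>. \<bar>F v\<bar> \<le> C * h1_norm \<Omega> v)}"

definition sym_grad :: "point set \<Rightarrow> vector_field \<Rightarrow> point \<Rightarrow> real ^ 2 ^ 2" where
  "sym_grad \<Omega> u x = (1 / 2) *\<^sub>R (weak_grad \<Omega> u x + transpose (weak_grad \<Omega> u x))"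

definition a_form :: "point set \<Rightarrow> real \<Rightarrow> vector_field \<Rightarrow> vector_field \<Rightarrow> real" where
  "a_form \<Omega> \<nu> u v = (LINT x|lebesgue_on \<Omega>. \<nu> * inner (sym_grad \<Omega> u x) (sym_grad \<Omega> v x))"

definition b_form :: "point set \<Rightarrow> vector_field \<Rightarrow> vector_field \<Rightarrow> vector_field \<Rightarrow> real" where
  "b_form \<Omega> u w v = (LINT x|lebesgue_on \<Omega>. inner (weak_grad \<Omega> w x *v u x) (v x))"

section \<open>Finite element spaces\<close>

definition fe_function :: "(nat \<Rightarrow> point \<Rightarrow> 'a :: real_vector) \<Rightarrow> real vec \<Rightarrow> point \<Rightarrow> 'a" where
  "fe_function \<phi> c x = (\<Sum>k<dim_vec c. vec_index c k *\<^sub>R \<phi> k x)"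

definition fe_space :: "nat \<Rightarrow> (nat \<Rightarrow> point \<Rightarrow> 'a :: real_vector) \<Rightarrow> (point \<Rightarrow> 'a) set" where
  "fe_space m \<phi> = fe_function \<phi> ` carrier_vec m"

text \<open>Linear independence is understood modulo equality almost everywhere.\<close>

definition fe_basis :: "point set \<Rightarrow> nat \<Rightarrow> (nat \<Rightarrow> point \<Rightarrow> 'a :: euclidean_space) \<Rightarrow> bool" where
  "fe_basis \<Omega> m \<phi> \<longleftrightarrow>
     (\<forall>c\<in>carrier_vec m. (AE x in lebesgue_on \<Omega>. fe_function \<phi> c x = 0) \<longrightarrow> c = 0\<^sub>v m)"

definition inf_sup_stable :: "point set \<Rightarrow> vector_field set \<Rightarrow> scalar_field set \<Rightarrow> bool" where
  "inf_sup_stable \<Omega> V Q \<longleftrightarrow>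
     (\<exists>\<beta>>0. \<forall>q\<in>Q. \<beta> * l2_norm \<Omega> q
        \<le> (SUP v\<in>{v \<in> V. h1_norm \<Omega> v \<le> 1}. l2_inner \<Omega> q (weak_div \<Omega> v)))"

definition discretely_div_free :: "point set \<Rightarrow> vector_field set \<Rightarrow> scalar_field set \<Rightarrow> vector_field set" where
  "discretely_div_free \<Omega> V Q = {v \<in> V. \<forall>q\<in>Q. l2_inner \<Omega> q (weak_div \<Omega> v) = 0}"

section \<open>The discrete Navier-Stokes scheme, its adjoint, and the gradient\<close>

definition nse_scheme ::
  "point set \<Rightarrow> real \<Rightarrow> real \<Rightarrow> nat \<Rightarrow> vector_field set \<Rightarrow> scalar_field set \<Rightarrow>
   (nat \<Rightarrow> vector_field \<Rightarrow> real) \<Rightarrow> vector_field \<Rightarrow> (nat \<Rightarrow> vector_field) \<Rightarrow> bool" where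
  "nse_scheme \<Omega> \<nu> \<tau> n V Q f u0 u \<longleftrightarrow>
     u 0 = u0 \<and>
     (\<forall>j\<in>{1..n}. u j \<in> discretely_div_free \<Omega> V Q) \<and>
     (\<forall>j<n. \<forall>v\<in>discretely_div_free \<Omega> V Q.
        l2_inner \<Omega> (\<lambda>x. (u (Suc j) x - u j x) /\<^sub>R \<tau>) v
        + a_form \<Omega> \<nu> (u (Suc j)) v + b_form \<Omega> (u (Suc j)) (u (Suc j)) v = f (Suc j) v)"

definition adjoint_scheme ::
  "point set \<Rightarrow> real \<Rightarrow> real \<Rightarrow> nat \<Rightarrow> vector_field set \<Rightarrow> scalar_field set \<Rightarrow>
   (nat \<Rightarrow> vector_field) \<Rightarrow> (nat \<Rightarrow> vector_field) \<Rightarrow>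
   (nat \<Rightarrow> vector_field) \<Rightarrow> (nat \<Rightarrow> scalar_field) \<Rightarrow> bool" where
  "adjoint_scheme \<Omega> \<nu> \<tau> n V Q uhat u us ps \<longleftrightarrow>
     us n = (\<lambda>x. 0) \<and>
     (\<forall>j<n. us j \<in> V \<and> ps j \<in> Q \<and>
        (\<forall>v\<in>V. l2_inner \<Omega> (\<lambda>x. - ((us (Suc j) x - us j x) /\<^sub>R \<tau>)) v
           + a_form \<Omega> \<nu> (us j) v
           + b_form \<Omega> v (u (Suc j)) (us j) + b_form \<Omega> (u (Suc j)) v (us j)
           + l2_inner \<Omega> (ps j) (weak_div \<Omega> v)
           = l2_inner \<Omega> (\<lambda>x. uhat (Suc j) x - u (Suc j) x) v) \<and>
        (\<forall>q\<in>Q. l2_inner \<Omega> (weak_div \<Omega> (us j)) q = 0))"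

text \<open>
  The gradient at \<open>u0\<close> of
  \<open>\<tau> / 2 * (\<Sum>j = 1..n. (l2_norm (uhat j - u j))^2) + \<gamma> / 2 * (l2_norm u0)^2\<close>
  in terms of the solution \<open>us\<close> of the adjoint scheme.
\<close>

definition adjoint_gradient ::
  "real \<Rightarrow> vector_field \<Rightarrow> (nat \<Rightarrow> vector_field) \<Rightarrow> vector_field" where
  "adjoint_gradient \<gamma> u0 us = (\<lambda>x. - us 0 x + \<gamma> *\<^sub>R u0 x)"

definition gradient_error ::
  "real \<Rightarrow> vector_field \<Rightarrow> (nat \<Rightarrow> vector_field) \<Rightarrow> (nat \<Rightarrow> vector_field) \<Rightarrow> vector_field" where
  "gradient_error \<gamma> u0 us usr =
     (\<lambda>x. adjoint_gradient \<gamma> u0 usr x - adjoint_gradient \<gamma> u0 us x)"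

section \<open>Weighted matrices and incremental POD\<close>

definition h1_gram :: "point set \<Rightarrow> nat \<Rightarrow> (nat \<Rightarrow> vector_field) \<Rightarrow> real mat" where
  "h1_gram \<Omega> m \<phi> = Matrix.mat m m (\<lambda>(k, l). h1_inner \<Omega> (\<phi> k) (\<phi> l))"

definition weighted_norm :: "real mat \<Rightarrow> real vec \<Rightarrow> real" where
  "weighted_norm M x = sqrt (scalar_prod x (M *\<^sub>v x))"

text \<open>Domain with the standard inner product, codomain with the inner product given by \<open>M\<close>.\<close>

definition hs_norm :: "real mat \<Rightarrow> real mat \<Rightarrow> real" where
  "hs_norm M A = sqrt (\<Sum>j<dim_col A. (weighted_norm M (A *\<^sub>v unit_vec (dim_col A) j))\<^sup>2)"

text \<open>
  The data matrix with columns \<open>sqrt \<tau> * c 1, \<dots>, sqrt \<tau> * c n\<close>.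
\<close>

definition data_matrix :: "nat \<Rightarrow> real \<Rightarrow> nat \<Rightarrow> (nat \<Rightarrow> real vec) \<Rightarrow> real mat" where
  "data_matrix m \<tau> n c = mat_of_cols m (map (\<lambda>j. sqrt \<tau> \<cdot>\<^sub>v c j) [1..<Suc n])"

text \<open>
  Reduced singular value decomposition: \<open>s\<close> lists the positive singular values in decreasing order,
  with multiplicities; it is not unique, so everything below is a relation.
\<close>

definition weighted_svd ::
  "real mat \<Rightarrow> real mat \<Rightarrow> real mat \<Rightarrow> real list \<Rightarrow> real mat \<Rightarrow> bool" where
  "weighted_svd M A V s W \<longleftrightarrow>
     V \<in> carrier_mat (dim_row A) (length s) \<and> W \<in> carrier_mat (dim_col A) (length s) \<and>
     transpose_mat V * M * V = 1\<^sub>m (length s) \<and> transpose_mat W * W = 1\<^sub>m (length s) \<and>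
     sorted_wrt (\<ge>) s \<and> (\<forall>\<sigma>\<in>set s. 0 < \<sigma>) \<and>
     A = V * mat_diag (length s) (\<lambda>i. s ! i) * transpose_mat W"

definition append_col :: "real mat \<Rightarrow> real vec \<Rightarrow> real mat" where
  "append_col A c = mat_of_cols (dim_row A) (cols A @ [c])"

definition drop_last_col :: "real mat \<Rightarrow> real mat" where
  "drop_last_col A = mat_of_cols (dim_row A) (butlast (cols A))"

definition weighted_proj :: "real mat \<Rightarrow> real mat \<Rightarrow> real vec \<Rightarrow> real vec" where
  "weighted_proj M V c = V *\<^sub>v (transpose_mat V *\<^sub>v (M *\<^sub>v c))"

inductive ipod_step :: "real mat \<Rightarrow> real \<Rightarrow> real \<Rightarrow> real mat \<Rightarrow> real vec \<Rightarrow> real mat \<Rightarrow> bool"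
  for M :: "real mat" and tol_p tol_sv :: real and A :: "real mat" and c :: "real vec" where
  project:
    "weighted_svd M A V s W \<Longrightarrow> weighted_norm M (c - weighted_proj M V c) < tol_p \<Longrightarrow>
     ipod_step M tol_p tol_sv A c (append_col A (weighted_proj M V c))"
| truncate:
    "weighted_svd M A V s W \<Longrightarrow> weighted_norm M (c - weighted_proj M V c) \<ge> tol_p \<Longrightarrow>
     weighted_svd M (append_col A c) V' s' W' \<Longrightarrow> s' \<noteq> [] \<Longrightarrow> last s' < tol_sv \<Longrightarrow>
     ipod_step M tol_p tol_sv A c
       (drop_last_col V' * mat_diag (length s' - 1) (\<lambda>i. s' ! i) * transpose_mat (drop_last_col W'))"
| extend:
    "weighted_svd M A V s W \<Longrightarrow> weighted_norm M (c - weighted_proj M V c) \<ge> tol_p \<Longrightarrow>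
     weighted_svd M (append_col A c) V' s' W' \<Longrightarrow> s' \<noteq> [] \<Longrightarrow> last s' \<ge> tol_sv \<Longrightarrow>
     ipod_step M tol_p tol_sv A c (append_col A c)"

inductive ipod_cols :: "real mat \<Rightarrow> real \<Rightarrow> real \<Rightarrow> real vec list \<Rightarrow> real mat \<Rightarrow> bool"
  for M :: "real mat" and tol_p tol_sv :: real where
  first:
    "c \<noteq> 0\<^sub>v (dim_vec c) \<Longrightarrow> ipod_cols M tol_p tol_sv [c] (mat_of_cols (dim_vec c) [c])"
| next_col:
    "ipod_cols M tol_p tol_sv cs A \<Longrightarrow> ipod_step M tol_p tol_sv A c A' \<Longrightarrow>
     ipod_cols M tol_p tol_sv (cs @ [c]) A'"

definition ipod :: "real mat \<Rightarrow> real \<Rightarrow> real \<Rightarrow> real mat \<Rightarrow> real mat \<Rightarrow> bool" where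
  "ipod M tol_p tol_sv U Ut \<longleftrightarrow> ipod_cols M tol_p tol_sv (cols U) Ut"

end

theory Submission
  imports Defs "HOL-Computational_Algebra.Polynomial"
begin

text \<open>
  Let \<open>e\<^sup>j = u\<^sup>*\<^sup>j - u\<^sub>r\<^sup>*\<^sup>j\<close> be the error of the adjoint variable and \<open>\<eta>\<^sup>j = u\<^sup>j - u\<^sub>r\<^sup>j\<close> the data error, so
  that the gradient error is \<open>e\<^sup>0\<close>. Since the weight matrix is the Gram matrix of the \<open>H\<^sup>1\<close> inner
  product, the squared Hilbert-Schmidt norm of \<open>U - U\<^sub>r\<close> is \<open>\<tau> * (\<Sum>j = 1..n. \<parallel>\<eta>\<^sup>j\<parallel>\<^sup>2)\<close> with the \<open>H\<^sup>1\<close> norm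
  (\<open>hs_norm_data_matrix_diff\<close>).

  Subtracting the two adjoint equations and testing with \<open>e\<^sup>j\<close> removes the pressures and leaves
  trilinear terms of two kinds: two contain \<open>e\<^sup>j\<close> twice and the velocity \<open>u\<^sup>j\<^sup>+\<^sup>1\<close>, and two contain
  \<open>e\<^sup>j\<close>, \<open>\<eta>\<^sup>j\<^sup>+\<^sup>1\<close> and \<open>u\<^sub>r\<^sup>*\<^sup>j\<close> once each (\<open>adjoint_error_identity\<close>). In the plane Ladyzhenskaya's
  inequality \<open>\<parallel>v\<parallel>\<^sup>2 \<le> 2 * \<parallel>v\<parallel> * \<parallel>\<nabla>v\<parallel>\<close>, with the \<open>L\<^sup>4\<close> norm on the left and \<open>L\<^sup>2\<close> norms on the right, bounds
  the former with an order below two in \<open>\<parallel>\<nabla>e\<^sup>j\<parallel>\<close>. Young's inequality then splits all terms into a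
  part absorbed by the viscous dissipation, which controls \<open>\<parallel>\<nabla>e\<^sup>j\<parallel>\<close> by Korn's inequality, a multiple
  of \<open>\<parallel>e\<^sup>j\<parallel>\<^sup>2\<close> that depends only on the bound \<open>K\<close> of the velocities, and a multiple of
  \<open>\<parallel>\<eta>\<^sup>j\<^sup>+\<^sup>1\<parallel>\<^sup>2\<close> that depends only on the bound \<open>R\<close> of the adjoint variables (\<open>adjoint_error_step\<close>). For small
  \<open>\<tau>\<close> the backward recursion from \<open>e\<^sup>n = 0\<close> is summed by a discrete Gronwall inequality
  (\<open>backward_gronwall\<close>), which gives the bound with \<open>c3\<close> and \<open>c4\<close>.

  The constants \<open>C3\<close> and \<open>C4\<close> may depend on the two adjoint sequences but not on \<open>K\<close>, so the
  Gronwall factor must be avoided. Let \<open>e\<^sup>0 \<noteq> 0\<close> and let \<open>j\<close> be the least index with \<open>e\<^sup>j\<^sup>+\<^sup>1 = 0\<close>. It depends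
  only on the sequences, and the single step from \<open>j + 1\<close> to \<open>j\<close> already bounds \<open>\<parallel>e\<^sup>j\<parallel>\<^sup>2\<close> by a multiple of
  \<open>\<epsilon>\<^sup>2\<close> without \<open>K\<close>, because \<open>\<tau>\<close> times the growth rate is at most \<open>1 / 4\<close>. As \<open>e\<^sup>j \<noteq> 0\<close>, multiplying by
  \<open>\<parallel>e\<^sup>0\<parallel>\<^sup>2 / \<parallel>e\<^sup>j\<parallel>\<^sup>2\<close>, a number determined by the sequences, gives a bound for \<open>\<parallel>e\<^sup>0\<parallel>\<^sup>2\<close>.

  The inequalities of Ladyzhenskaya and Korn are first proved for smooth compactly supported fields,
  the former by integrating along coordinate lines and the latter by integrating by parts twice, and
  then extended to the closure of these fields in \<open>H\<^sup>1\<close>. The weak gradient is a choice of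
  representatives, and it is linear almost everywhere because weak derivatives are unique; this
  rests on the fundamental lemma of the calculus of variations, which needs smooth bump functions.
\<close>

section \<open>The Hilbert space of square-integrable functions\<close>

lemma L2_measurable [measurable_dest]: "u \<in> L2 \<Omega> \<Longrightarrow> u \<in> borel_measurable (lebesgue_on \<Omega>)"
  by (simp add: L2_def)

lemma L2_dominated:
  fixes u :: "point \<Rightarrow> 'a :: euclidean_space" and v :: "point \<Rightarrow> 'b :: euclidean_space"
  assumes [measurable]: "u \<in> borel_measurable (lebesgue_on \<Omega>)"
    and "AE x in lebesgue_on \<Omega>. norm (u x) \<le> norm (v x)" and "v \<in> L2 \<Omega>"
  shows "u \<in> L2 \<Omega>" "l2_norm \<Omega> u \<le> l2_norm \<Omega> v"
proof -
  have v: "integrable (lebesgue_on \<Omega>) (\<lambda>x. (norm (v x))\<^sup>2)"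
    using assms(3) by (simp add: L2_def)
  have "integrable (lebesgue_on \<Omega>) (\<lambda>x. (norm (u x))\<^sup>2)"
    by (rule Bochner_Integration.integrable_bound[OF v])
       (use assms(2) in \<open>auto elim!: eventually_mono simp: power_mono\<close>)
  then show "u \<in> L2 \<Omega>" by (simp add: L2_def)
  show "l2_norm \<Omega> u \<le> l2_norm \<Omega> v"
    unfolding l2_norm_def l2_inner_def power2_norm_eq_inner[symmetric]
    by (intro real_sqrt_le_mono integral_mono_AE v \<open>integrable _ (\<lambda>x. (norm (u x))\<^sup>2)\<close>)
       (use assms(2) in \<open>auto elim!: eventually_mono simp: power_mono\<close>)
qed

lemma L2_integrable_inner:
  fixes u v :: "point \<Rightarrow> 'a :: euclidean_space"
  assumes u: "u \<in> L2 \<Omega>" and v: "v \<in> L2 \<Omega>"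
  shows "integrable (lebesgue_on \<Omega>) (\<lambda>x. inner (u x) (v x))"
proof (rule Bochner_Integration.integrable_bound)
  show "integrable (lebesgue_on \<Omega>) (\<lambda>x. (norm (u x))\<^sup>2 + (norm (v x))\<^sup>2)"
    using u v by (auto simp: L2_def)
  show "(\<lambda>x. inner (u x) (v x)) \<in> borel_measurable (lebesgue_on \<Omega>)"
    using u v by measurable
  show "AE x in lebesgue_on \<Omega>. norm (inner (u x) (v x)) \<le> norm ((norm (u x))\<^sup>2 + (norm (v x))\<^sup>2)"
  proof (rule AE_I2)
    fix x
    have "\<bar>inner (u x) (v x)\<bar> \<le> norm (u x) * norm (v x)" by (rule Cauchy_Schwarz_ineq2)
    moreover have "2 * (norm (u x) * norm (v x)) \<le> (norm (u x))\<^sup>2 + (norm (v x))\<^sup>2"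
      using sum_squares_bound[of "norm (u x)" "norm (v x)"] by simp
    ultimately show "norm (inner (u x) (v x)) \<le> norm ((norm (u x))\<^sup>2 + (norm (v x))\<^sup>2)"
      by (smt (verit) real_norm_def norm_ge_zero zero_le_power2)
  qed
qed

lemma L2_zero [simp]: "(\<lambda>x. 0) \<in> L2 \<Omega>"
  by (simp add: L2_def)

lemma L2_scale:
  assumes "u \<in> L2 \<Omega>"
  shows "(\<lambda>x. c *\<^sub>R u x) \<in> L2 \<Omega>"
  using assms by (auto simp: L2_def power_mult_distrib)

lemma L2_add:
  assumes u: "u \<in> L2 \<Omega>" and v: "v \<in> L2 \<Omega>"
  shows "(\<lambda>x. u x + v x) \<in> L2 \<Omega>"
proof -
  have [measurable]: "u \<in> borel_measurable (lebesgue_on \<Omega>)" "v \<in> borel_measurable (lebesgue_on \<Omega>)"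
    using u v by (auto simp: L2_def)
  have "(norm (u x + v x))\<^sup>2 = (norm (u x))\<^sup>2 + 2 * inner (u x) (v x) + (norm (v x))\<^sup>2" for x
    by (simp add: power2_norm_eq_inner inner_add inner_commute)
  moreover have "integrable (lebesgue_on \<Omega>) (\<lambda>x. (norm (u x))\<^sup>2 + 2 * inner (u x) (v x) + (norm (v x))\<^sup>2)"
    using u v L2_integrable_inner[OF u v] by (auto simp: L2_def)
  ultimately show ?thesis by (simp add: L2_def)
qed

lemma L2_diff: "u \<in> L2 \<Omega> \<Longrightarrow> v \<in> L2 \<Omega> \<Longrightarrow> (\<lambda>x. u x - v x) \<in> L2 \<Omega>"
  using L2_add[of u \<Omega> "\<lambda>x. (-1) *\<^sub>R v x"] L2_scale[of v \<Omega> "-1"] by simp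

lemma L2_comp: "u \<in> L2 \<Omega> \<Longrightarrow> (\<lambda>x. vec_nth (u x) k) \<in> L2 \<Omega>"
  for u :: "point \<Rightarrow> 'a::euclidean_space ^ 'n"
proof (rule L2_dominated(1)[where v = u])
  assume u: "u \<in> L2 \<Omega>"
  have "(\<lambda>y :: 'a ^ 'n. vec_nth y k) \<in> borel_measurable borel"
    by (intro borel_measurable_continuous_onI continuous_intros)
  then show "(\<lambda>x. vec_nth (u x) k) \<in> borel_measurable (lebesgue_on \<Omega>)"
    using u by (auto simp: L2_def intro: measurable_compose)
qed (auto simp: Finite_Cartesian_Product.norm_nth_le)

lemma L2_vec:
  fixes u :: "point \<Rightarrow> 'a::euclidean_space ^ 'n"
  assumes "\<And>k. (\<lambda>x. vec_nth (u x) k) \<in> L2 \<Omega>"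
  shows "u \<in> L2 \<Omega>"
proof -
  have "(norm (u x))\<^sup>2 = (\<Sum>k\<in>UNIV. (norm (vec_nth (u x) k))\<^sup>2)" for x
    by (simp add: power2_norm_eq_inner inner_vec_def)
  moreover have "u \<in> borel_measurable (lebesgue_on \<Omega>)"
  proof (subst borel_measurable_euclidean_space, intro ballI)
    fix b :: "'a ^ 'n" assume "b \<in> Basis"
    have "(\<lambda>x. \<Sum>k\<in>UNIV. inner (vec_nth (u x) k) (vec_nth b k)) \<in> borel_measurable (lebesgue_on \<Omega>)"
      using assms by (auto simp: L2_def intro!: borel_measurable_sum borel_measurable_inner)
    then show "(\<lambda>x. inner (u x) b) \<in> borel_measurable (lebesgue_on \<Omega>)"
      by (simp add: inner_vec_def)
  qed
  ultimately show ?thesis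
    using assms by (auto simp: L2_def)
qed

lemma l2_inner_commute: "l2_inner \<Omega> u v = l2_inner \<Omega> v u"
  by (simp add: l2_inner_def inner_commute)

lemma l2_inner_cong_AE:
  assumes "u \<in> L2 \<Omega>" "u' \<in> L2 \<Omega>" "v \<in> L2 \<Omega>" "v' \<in> L2 \<Omega>"
    "AE x in lebesgue_on \<Omega>. u x = u' x" "AE x in lebesgue_on \<Omega>. v x = v' x"
  shows "l2_inner \<Omega> u v = l2_inner \<Omega> u' v'"
  unfolding l2_inner_def
  by (rule integral_cong_AE)
     (use assms in \<open>auto simp: L2_def intro!: borel_measurable_inner\<close>)

lemma l2_norm_cong_AE:
  assumes "u \<in> L2 \<Omega>" "u' \<in> L2 \<Omega>" "AE x in lebesgue_on \<Omega>. u x = u' x"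
  shows "l2_norm \<Omega> u = l2_norm \<Omega> u'"
  unfolding l2_norm_def using l2_inner_cong_AE[OF assms(1,2,1,2,3,3)] by simp

lemma l2_inner_add_left:
  assumes "u \<in> L2 \<Omega>" "v \<in> L2 \<Omega>" "w \<in> L2 \<Omega>"
  shows "l2_inner \<Omega> (\<lambda>x. u x + v x) w = l2_inner \<Omega> u w + l2_inner \<Omega> v w"
  unfolding l2_inner_def inner_add_left
  by (rule Bochner_Integration.integral_add) (auto intro!: L2_integrable_inner assms)

lemma l2_inner_scale_left: "l2_inner \<Omega> (\<lambda>x. c *\<^sub>R u x) w = c * l2_inner \<Omega> u w"
  unfolding l2_inner_def inner_scaleR_left by simp

lemma l2_inner_diff_left:
  assumes "u \<in> L2 \<Omega>" "v \<in> L2 \<Omega>" "w \<in> L2 \<Omega>"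
  shows "l2_inner \<Omega> (\<lambda>x. u x - v x) w = l2_inner \<Omega> u w - l2_inner \<Omega> v w"
  unfolding l2_inner_def inner_diff_left
  by (rule Bochner_Integration.integral_diff) (auto intro!: L2_integrable_inner assms)

lemma l2_inner_add_right:
  assumes "u \<in> L2 \<Omega>" "v \<in> L2 \<Omega>" "w \<in> L2 \<Omega>"
  shows "l2_inner \<Omega> w (\<lambda>x. u x + v x) = l2_inner \<Omega> w u + l2_inner \<Omega> w v"
  using l2_inner_add_left[OF assms] by (simp add: l2_inner_commute)

lemma l2_inner_scale_right: "l2_inner \<Omega> w (\<lambda>x. c *\<^sub>R u x) = c * l2_inner \<Omega> w u"
  using l2_inner_scale_left by (simp add: l2_inner_commute[of _ w])

lemma l2_inner_diff_right:
  assumes "u \<in> L2 \<Omega>" "v \<in> L2 \<Omega>" "w \<in> L2 \<Omega>"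
  shows "l2_inner \<Omega> w (\<lambda>x. u x - v x) = l2_inner \<Omega> w u - l2_inner \<Omega> w v"
  using l2_inner_diff_left[OF assms] by (simp add: l2_inner_commute)

lemma l2_inner_self_nonneg: "0 \<le> l2_inner \<Omega> u u"
  by (simp add: l2_inner_def)

lemma l2_norm_nonneg [simp]: "0 \<le> l2_norm \<Omega> u"
  by (simp add: l2_norm_def l2_inner_self_nonneg)

lemma l2_norm_sq: "(l2_norm \<Omega> u)\<^sup>2 = l2_inner \<Omega> u u"
  by (simp add: l2_norm_def l2_inner_self_nonneg)

lemma l2_norm_scale: "l2_norm \<Omega> (\<lambda>x. c *\<^sub>R u x) = \<bar>c\<bar> * l2_norm \<Omega> u"
  by (simp add: l2_norm_def l2_inner_scale_left l2_inner_scale_right real_sqrt_mult mult.assoc[symmetric])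

lemma l2_norm_diff_sq:
  assumes "u \<in> L2 \<Omega>" "v \<in> L2 \<Omega>"
  shows "(l2_norm \<Omega> (\<lambda>x. u x - v x))\<^sup>2
       = (l2_norm \<Omega> u)\<^sup>2 - 2 * l2_inner \<Omega> u v + (l2_norm \<Omega> v)\<^sup>2"
  using assms by (simp add: l2_norm_sq l2_inner_diff_left l2_inner_diff_right L2_diff
      l2_inner_commute[of \<Omega> v u])

text \<open>The discriminant of the nonnegative polynomial \<open>t \<mapsto> \<parallel>u - t v\<parallel>\<^sup>2\<close> is not positive.\<close>

lemma l2_cauchy_schwarz:
  assumes u: "u \<in> L2 \<Omega>" and v: "v \<in> L2 \<Omega>"
  shows "\<bar>l2_inner \<Omega> u v\<bar> \<le> l2_norm \<Omega> u * l2_norm \<Omega> v"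
proof -
  let ?a = "l2_inner \<Omega> v v" and ?b = "l2_inner \<Omega> u v" and ?c = "l2_inner \<Omega> u u"
  have quadratic: "0 \<le> ?c - 2 * t * ?b + t\<^sup>2 * ?a" for t
  proof -
    have "0 \<le> (l2_norm \<Omega> (\<lambda>x. u x - t *\<^sub>R v x))\<^sup>2" by simp
    then show ?thesis
      using l2_norm_diff_sq[OF u L2_scale[OF v, of t]]
      by (simp add: l2_norm_scale l2_inner_scale_right l2_norm_sq power_mult_distrib)
  qed
  have "?b\<^sup>2 \<le> ?c * ?a"
  proof (cases "?a = 0")
    case True
    have "?b = 0"
    proof (rule ccontr)
      assume "?b \<noteq> 0"
      then show False
        using quadratic[of "(?c + 1) / (2 * ?b)"] True by simp
    qed
    then show ?thesis using True by simp
  next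
    case False
    then have "0 < ?a" using l2_inner_self_nonneg[of \<Omega> v] by linarith
    then show ?thesis
      using quadratic[of "?b / ?a"] by (simp add: field_simps power2_eq_square)
  qed
  then have "?b\<^sup>2 \<le> (l2_norm \<Omega> u * l2_norm \<Omega> v)\<^sup>2"
    by (simp add: power_mult_distrib l2_norm_sq)
  then show ?thesis
    by (metis l2_norm_nonneg mult_nonneg_nonneg abs_le_square_iff abs_of_nonneg)
qed

lemma l2_norm_triangle:
  assumes u: "u \<in> L2 \<Omega>" and v: "v \<in> L2 \<Omega>"
  shows "l2_norm \<Omega> (\<lambda>x. u x + v x) \<le> l2_norm \<Omega> u + l2_norm \<Omega> v"
proof (rule power2_le_imp_le)
  have "(l2_norm \<Omega> (\<lambda>x. u x + v x))\<^sup>2 = (l2_norm \<Omega> u)\<^sup>2 + 2 * l2_inner \<Omega> u v + (l2_norm \<Omega> v)\<^sup>2"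
    using assms by (simp add: l2_norm_sq l2_inner_add_left l2_inner_add_right L2_add
        l2_inner_commute[of \<Omega> v u])
  also have "\<dots> \<le> (l2_norm \<Omega> u + l2_norm \<Omega> v)\<^sup>2"
    using l2_cauchy_schwarz[OF u v] by (simp add: power2_sum)
  finally show "(l2_norm \<Omega> (\<lambda>x. u x + v x))\<^sup>2 \<le> (l2_norm \<Omega> u + l2_norm \<Omega> v)\<^sup>2" .
qed simp

lemma l2_norm_minus_commute: "l2_norm \<Omega> (\<lambda>x. u x - v x) = l2_norm \<Omega> (\<lambda>x. v x - u x)"
  unfolding l2_norm_def l2_inner_def power2_norm_eq_inner[symmetric] by (simp add: norm_minus_commute)

lemma l2_norm_triangle_diff:
  assumes u: "u \<in> L2 \<Omega>" and v: "v \<in> L2 \<Omega>"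
  shows "l2_norm \<Omega> u \<le> l2_norm \<Omega> v + l2_norm \<Omega> (\<lambda>x. u x - v x)"
  using l2_norm_triangle[OF v L2_diff[OF u v]] by simp

lemma l2_inner_vec:
  fixes u v :: "point \<Rightarrow> 'a::euclidean_space ^ 'n"
  assumes "u \<in> L2 \<Omega>" "v \<in> L2 \<Omega>"
  shows "l2_inner \<Omega> u v = (\<Sum>k\<in>UNIV. l2_inner \<Omega> (\<lambda>x. vec_nth (u x) k) (\<lambda>x. vec_nth (v x) k))"
  unfolding l2_inner_def inner_vec_def
  by (rule Bochner_Integration.integral_sum) (intro L2_integrable_inner L2_comp assms)

lemma l2_norm_norm: "l2_norm \<Omega> (\<lambda>x. norm (u x)) = l2_norm \<Omega> u"
  by (simp add: l2_norm_def l2_inner_def power2_norm_eq_inner[symmetric] power2_eq_square[symmetric])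

lemma L2_norm: "u \<in> L2 \<Omega> \<Longrightarrow> (\<lambda>x. norm (u x)) \<in> L2 \<Omega>"
  by (auto simp: L2_def)

lemma L2_linear_image:
  assumes "linear f" and "u \<in> L2 \<Omega>"
  shows "(\<lambda>x. f (u x)) \<in> L2 \<Omega>"
proof -
  interpret bounded_linear f using assms(1) by (simp add: linear_conv_bounded_linear)
  obtain K where K: "norm (f y) \<le> norm y * K" "0 < K" for y using pos_bounded by blast
  have "continuous_on UNIV f" by (intro continuous_on continuous_on_id)
  then have "f \<in> borel_measurable borel" by (rule borel_measurable_continuous_onI)
  then have "(\<lambda>x. f (u x)) \<in> borel_measurable (lebesgue_on \<Omega>)"
    using assms(2) by (auto simp: L2_def intro: measurable_compose)
  then show ?thesis
    by (rule L2_dominated(1)[where v = "\<lambda>x. K *\<^sub>R u x"])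
       (use K L2_scale[OF assms(2)] in \<open>auto simp: mult.commute\<close>)
qed

section \<open>Smooth functions with compact support\<close>

lemma partial_deriv_eq:
  assumes "(\<phi> has_derivative D) (at x)"
  shows "partial_deriv i \<phi> x = D (axis i 1)"
  using frechet_derivative_at[OF assms] by (simp add: partial_deriv_def)

lemma k_times_cont_diff_const: "k_times_cont_diff k (\<lambda>x. c)"
proof (induction k arbitrary: c)
  case (Suc k)
  have "partial_deriv i (\<lambda>x. c) = (\<lambda>x. 0)" for i
    by (rule ext, subst partial_deriv_eq[where D = "\<lambda>h. 0"]) auto
  then show ?case using Suc.IH[of 0] by simp
qed simp

lemma k_times_cont_diff_Suc_D: "k_times_cont_diff (Suc k) f \<Longrightarrow> k_times_cont_diff k f"
proof (induction k arbitrary: f)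
  case 0
  then show ?case
    by (auto simp: continuous_on_eq_continuous_at differentiable_imp_continuous_within)
next
  case (Suc k)
  then show ?case by (metis k_times_cont_diff.simps(2))
qed

lemma partial_deriv_add:
  assumes "f differentiable (at x)" "g differentiable (at x)"
  shows "partial_deriv i (\<lambda>x. f x + g x) x = partial_deriv i f x + partial_deriv i g x"
  using assms unfolding differentiable_def
  by (auto simp: partial_deriv_eq[OF has_derivative_add] partial_deriv_eq)

lemma partial_deriv_mult:
  assumes "f differentiable (at x)" "g differentiable (at x)"
  shows "partial_deriv i (\<lambda>x. f x * g x) x = f x * partial_deriv i g x + partial_deriv i f x * g x"
  using assms unfolding differentiable_def
  by (auto simp: partial_deriv_eq[OF has_derivative_mult] partial_deriv_eq)

lemma k_times_cont_diff_add:
  "k_times_cont_diff k f \<Longrightarrow> k_times_cont_diff k g \<Longrightarrow> k_times_cont_diff k (\<lambda>x. f x + g x)"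
proof (induction k arbitrary: f g)
  case (Suc k)
  have "partial_deriv i (\<lambda>x. f x + g x) = (\<lambda>x. partial_deriv i f x + partial_deriv i g x)" for i
    using Suc.prems by (intro ext partial_deriv_add) auto
  then show ?case using Suc by (auto intro: differentiable_add)
qed (auto intro: continuous_intros)

lemma k_times_cont_diff_mult:
  "k_times_cont_diff k f \<Longrightarrow> k_times_cont_diff k g \<Longrightarrow> k_times_cont_diff k (\<lambda>x. f x * g x)"
proof (induction k arbitrary: f g)
  case (Suc k)
  have "partial_deriv i (\<lambda>x. f x * g x)
      = (\<lambda>x. f x * partial_deriv i g x + partial_deriv i f x * g x)" for i
    using Suc.prems by (intro ext partial_deriv_mult) auto
  moreover have "k_times_cont_diff k (\<lambda>x. f x * partial_deriv i g x + partial_deriv i f x * g x)" for i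
    using Suc.prems k_times_cont_diff_Suc_D[OF Suc.prems(1)] k_times_cont_diff_Suc_D[OF Suc.prems(2)]
    by (auto intro!: k_times_cont_diff_add Suc.IH)
  ultimately show ?case using Suc.prems by (auto intro: differentiable_mult)
qed (auto intro: continuous_intros)

text \<open>
  Induction on the order of differentiability needs a statement about all derivatives at once, hence
  a family of functions of one variable that is closed under differentiation.
\<close>

lemma k_times_cont_diff_coordinate:
  fixes F :: "(real \<Rightarrow> real) set"
  assumes closed: "\<And>h. h \<in> F \<Longrightarrow> \<exists>h'\<in>F. \<forall>t. (h has_real_derivative h' t) (at t)"
  shows "h \<in> F \<Longrightarrow> k_times_cont_diff k (\<lambda>x. h (vec_nth x j))"
proof (induction k arbitrary: h)
  case 0
  from closed[OF 0] have "continuous_on UNIV h"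
    by (meson DERIV_continuous_on has_field_derivative_at_within)
  then show ?case
    by (auto intro!: continuous_on_compose2[of UNIV h] continuous_intros)
next
  case (Suc k)
  obtain h' where h': "h' \<in> F" and D: "\<And>t. (h has_real_derivative h' t) (at t)"
    using closed[OF Suc.prems] by blast
  have D': "((\<lambda>x. h (vec_nth x j)) has_derivative (\<lambda>v. h' (vec_nth x j) * vec_nth v j)) (at x)"
    for x :: point
  proof -
    have "((\<lambda>x :: point. vec_nth x j) has_derivative (\<lambda>v. vec_nth v j)) (at x)"
      by (intro bounded_linear_imp_has_derivative bounded_linear_vec_nth)
    from has_derivative_compose[OF this D[unfolded has_field_derivative_def]] show ?thesis .
  qed
  have "partial_deriv i (\<lambda>x. h (vec_nth x j)) = (\<lambda>x. vec_nth (axis i 1 :: point) j * h' (vec_nth x j))" for i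
    by (rule ext, subst partial_deriv_eq[OF D']) simp
  moreover have "k_times_cont_diff k (\<lambda>x. c * h' (vec_nth x j))" for c
    using Suc.IH[OF h'] k_times_cont_diff_const k_times_cont_diff_mult by blast
  ultimately show ?case using D' by (auto simp: differentiable_def)
qed

text \<open>
  The derivatives of the flat function \<open>t \<mapsto> exp (- c / t)\<close> (continued by zero to the left of the
  origin) are obtained by multiplying it with polynomials in \<open>1 / t\<close>.
\<close>

definition flat :: "real poly \<Rightarrow> real \<Rightarrow> real \<Rightarrow> real" where
  "flat p c t = (if 0 < t then poly p (1 / t) * exp (- c / t) else 0)"

lemma poly_times_exp_tendsto_0:
  fixes p :: "real poly"
  assumes "0 < c"
  shows "((\<lambda>x. poly p x * exp (- c * x)) \<longlongrightarrow> 0) at_top"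
proof -
  have mono: "((\<lambda>x. x ^ k * exp (- c * x)) \<longlongrightarrow> 0) at_top" for k
  proof -
    have "filterlim (\<lambda>x. c * x) at_top at_top"
      using assms by (intro filterlim_tendsto_pos_mult_at_top[OF tendsto_const _ filterlim_ident])
    from filterlim_compose[OF tendsto_power_div_exp_0[of k] this]
    have "((\<lambda>x. (1 / c ^ k) * ((c * x) ^ k / exp (c * x))) \<longlongrightarrow> (1 / c ^ k) * 0) at_top"
      by (intro tendsto_mult tendsto_const)
    then show ?thesis using assms by (simp add: power_mult_distrib exp_minus field_simps)
  qed
  have "((\<lambda>x. \<Sum>k\<le>degree p. coeff p k * (x ^ k * exp (- c * x))) \<longlongrightarrow> (\<Sum>k\<le>degree p. coeff p k * 0)) at_top"
    by (intro tendsto_sum tendsto_mult tendsto_const mono)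
  then show ?thesis by (simp add: poly_altdef sum_distrib_right mult.assoc)
qed

lemma flat_has_derivative:
  assumes c: "0 < c"
  shows "(flat p c has_real_derivative flat ([:0, 0, 1:] * (Polynomial.smult c p - pderiv p)) c t) (at t)"
proof -
  consider "t < 0" | "t = 0" | "0 < t" by linarith
  then show ?thesis
  proof cases
    case 1
    then have "eventually (\<lambda>s. flat p c s = 0) (nhds t)"
      using eventually_nhds_in_open[of "{..<0}" t] by (auto simp: flat_def elim!: eventually_mono)
    then show ?thesis
      using 1 DERIV_cong_ev[OF refl, of "flat p c" "\<lambda>s. 0"] by (simp add: flat_def)
  next
    case 2
    have "((\<lambda>h. flat p c h / h) \<longlongrightarrow> 0) (at_right 0)"
    proof -
      have "((\<lambda>x. poly (pCons 0 p) x * exp (- c * x)) \<longlongrightarrow> 0) at_top"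
        by (rule poly_times_exp_tendsto_0[OF c])
      from filterlim_compose[OF this filterlim_inverse_at_top_right]
      have "((\<lambda>h. poly (pCons 0 p) (inverse h) * exp (- c * inverse h)) \<longlongrightarrow> 0) (at_right 0)" .
      moreover have "eventually (\<lambda>h. poly (pCons 0 p) (inverse h) * exp (- c * inverse h)
          = flat p c h / h) (at_right 0)"
        unfolding eventually_at_filter
        by (rule always_eventually) (simp add: flat_def divide_inverse)
      ultimately show ?thesis by (rule Lim_transform_eventually)
    qed
    moreover have "((\<lambda>h. flat p c h / h) \<longlongrightarrow> 0) (at_left 0)"
      by (rule Lim_transform_eventually[OF tendsto_const])
         (auto simp: flat_def eventually_at_filter)
    ultimately have "((\<lambda>h. flat p c h / h) \<longlongrightarrow> 0) (at 0)"
      by (simp add: filterlim_split_at)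
    then show ?thesis using 2 by (simp add: DERIV_def flat_def)
  next
    case 3
    have inv: "((\<lambda>s. a / s) has_real_derivative - a / t\<^sup>2) (at t)" for a
      using 3 by (auto intro!: derivative_eq_intros simp: power2_eq_square)
    have "((\<lambda>s. poly p (1 / s) * exp (- c / s)) has_real_derivative
        poly p (1 / t) * (exp (- c / t) * (- (- c) / t\<^sup>2))
        + poly (pderiv p) (1 / t) * (- 1 / t\<^sup>2) * exp (- c / t)) (at t)"
      by (intro DERIV_mult' DERIV_chain2[OF poly_DERIV inv] DERIV_chain2[OF DERIV_exp inv])
    also have "poly p (1 / t) * (exp (- c / t) * (- (- c) / t\<^sup>2))
        + poly (pderiv p) (1 / t) * (- 1 / t\<^sup>2) * exp (- c / t)
        = (1 / t)\<^sup>2 * (c * poly p (1 / t) - poly (pderiv p) (1 / t)) * exp (- c / t)"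
      by (simp add: algebra_simps power_divide)
    also have "\<dots> = flat ([:0, 0, 1:] * (Polynomial.smult c p - pderiv p)) c t"
      using 3 by (simp add: flat_def power2_eq_square)
    finally have "((\<lambda>s. poly p (1 / s) * exp (- c / s)) has_real_derivative
        flat ([:0, 0, 1:] * (Polynomial.smult c p - pderiv p)) c t) (at t)" .
    moreover have ev: "eventually (\<lambda>s. poly p (1 / s) * exp (- c / s) = flat p c s) (nhds t)"
      using 3 eventually_nhds_in_open[of "{0<..}" t] by (auto simp: flat_def elim!: eventually_mono)
    ultimately show ?thesis
      by (subst DERIV_cong_ev[OF refl ev refl, symmetric])
  qed
qed

lemma k_times_cont_diff_flat:
  assumes c: "0 < c"
  shows "k_times_cont_diff k (\<lambda>x. flat p c (s * vec_nth x j + a))"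
proof (rule k_times_cont_diff_coordinate[where F = "range (\<lambda>p t. flat p c (s * t + a))"])
  fix h assume "h \<in> range (\<lambda>p t. flat p c (s * t + a))"
  then obtain p where h: "h = (\<lambda>t. flat p c (s * t + a))" by blast
  let ?q = "Polynomial.smult s ([:0, 0, 1:] * (Polynomial.smult c p - pderiv p))"
  have "(h has_real_derivative flat ?q c (s * t + a)) (at t)" for t
  proof -
    have "((\<lambda>t. flat p c (s * t + a)) has_real_derivative
        flat ([:0, 0, 1:] * (Polynomial.smult c p - pderiv p)) c (s * t + a) * s) (at t)"
      by (rule DERIV_chain2[OF flat_has_derivative[OF c]]) (auto intro!: derivative_eq_intros)
    moreover have "flat (Polynomial.smult s q) c r = flat q c r * s" for q r
      by (simp add: flat_def)
    ultimately show ?thesis by (simp only: h)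
  qed
  then show "\<exists>h'\<in>range (\<lambda>p t. flat p c (s * t + a)). \<forall>t. (h has_real_derivative h' t) (at t)"
    by (intro bexI[of _ "\<lambda>t. flat ?q c (s * t + a)"]) auto
qed auto

text \<open>
  The parameter \<open>c\<close> sharpens the bump: it is positive exactly on the open box with corners \<open>l\<close> and
  \<open>u\<close>, and it tends to \<open>1\<close> there as \<open>c\<close> decreases to zero.
\<close>

definition box_bump :: "real \<Rightarrow> point \<Rightarrow> point \<Rightarrow> scalar_field" where
  "box_bump c l u x =
     flat 1 c (vec_nth x 1 - vec_nth l 1) * flat 1 c (vec_nth u 1 - vec_nth x 1)
   * (flat 1 c (vec_nth x 2 - vec_nth l 2) * flat 1 c (vec_nth u 2 - vec_nth x 2))"

lemma mem_box_plane:
  "x \<in> box l u \<longleftrightarrow> vec_nth l 1 < vec_nth x 1 \<and> vec_nth x 1 < vec_nth u 1 \<and>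
     vec_nth l 2 < vec_nth x 2 \<and> vec_nth x 2 < vec_nth u (2::2)"
  for x :: point
  by (auto simp: mem_box_cart forall_2)

lemma k_times_cont_diff_box_bump:
  assumes "0 < c"
  shows "k_times_cont_diff k (box_bump c l u)"
proof -
  have "k_times_cont_diff k (\<lambda>x. flat 1 c (vec_nth x j - a))" for j a
    using k_times_cont_diff_flat[OF assms, of k 1 1 j "- a"] by simp
  moreover have "k_times_cont_diff k (\<lambda>x. flat 1 c (b - vec_nth x j))" for j b
    using k_times_cont_diff_flat[OF assms, of k 1 "- 1" j b] by simp
  ultimately show ?thesis
    unfolding box_bump_def[abs_def] by (intro k_times_cont_diff_mult)
qed

lemma flat_one_bounds: "0 < c \<Longrightarrow> 0 \<le> flat 1 c t" "0 < c \<Longrightarrow> flat 1 c t \<le> 1"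
  by (auto simp: flat_def)

lemma box_bump_bounds:
  assumes "0 < c"
  shows "0 \<le> box_bump c l u x" "box_bump c l u x \<le> 1"
  using assms flat_one_bounds by (auto simp: box_bump_def intro!: mult_nonneg_nonneg mult_le_one)

lemma box_bump_eq_0: "x \<notin> box l u \<Longrightarrow> box_bump c l u x = 0"
  by (auto simp: box_bump_def flat_def mem_box_plane)

lemma box_bump_tendsto_1:
  assumes x: "x \<in> box l u"
  shows "(\<lambda>n. box_bump (1 / real (Suc n)) l u x) \<longlonglongrightarrow> 1"
proof -
  have lim: "(\<lambda>n. flat 1 (1 / real (Suc n)) t) \<longlonglongrightarrow> 1" if "0 < t" for t
  proof -
    have "(\<lambda>n. exp (- (1 / real (Suc n)) / t)) \<longlonglongrightarrow> exp (- 0 / t)"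
      using that by (intro tendsto_intros LIMSEQ_Suc[OF lim_1_over_n]) auto
    then show ?thesis using that by (simp add: flat_def)
  qed
  have "(\<lambda>n. box_bump (1 / real (Suc n)) l u x) \<longlonglongrightarrow> 1 * 1 * (1 * 1)"
    unfolding box_bump_def using x by (intro tendsto_mult lim) (auto simp: mem_box_plane)
  then show ?thesis by simp
qed

section \<open>The fundamental lemma of the calculus of variations\<close>

lemma test_functions_iff:
  "\<phi> \<in> test_functions \<Omega> \<longleftrightarrow>
     (\<forall>k. k_times_cont_diff k \<phi>) \<and> (\<exists>K. compact K \<and> K \<subseteq> \<Omega> \<and> (\<forall>x. x \<notin> K \<longrightarrow> \<phi> x = 0))"
proof -
  have "compact (closure {x. \<phi> x \<noteq> 0}) \<and> closure {x. \<phi> x \<noteq> 0} \<subseteq> K"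
    if "compact K" "\<forall>x. x \<notin> K \<longrightarrow> \<phi> x = 0" for K
  proof -
    have "closure {x. \<phi> x \<noteq> 0} \<subseteq> K"
      using that by (intro closure_minimal compact_imp_closed) auto
    then show ?thesis
      using compact_Int_closed[OF that(1) closed_closure, of "{x. \<phi> x \<noteq> 0}"]
      by (simp add: Int_absorb1)
  qed
  moreover have "\<forall>x. x \<notin> closure {x. \<phi> x \<noteq> 0} \<longrightarrow> \<phi> x = 0"
    using closure_subset[of "{x. \<phi> x \<noteq> 0}"] by blast
  ultimately show ?thesis unfolding test_functions_def by blast
qed

lemma test_functions_linear:
  assumes "\<phi> \<in> test_functions \<Omega>" "\<psi> \<in> test_functions \<Omega>"
  shows "(\<lambda>x. a * \<phi> x + b * \<psi> x) \<in> test_functions \<Omega>"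
proof -
  obtain K L where "compact K" "K \<subseteq> \<Omega>" "\<forall>x. x \<notin> K \<longrightarrow> \<phi> x = 0"
    "compact L" "L \<subseteq> \<Omega>" "\<forall>x. x \<notin> L \<longrightarrow> \<psi> x = 0"
    using assms by (auto simp: test_functions_iff)
  then have "compact (K \<union> L) \<and> K \<union> L \<subseteq> \<Omega> \<and> (\<forall>x. x \<notin> K \<union> L \<longrightarrow> a * \<phi> x + b * \<psi> x = 0)"
    by (auto intro: compact_Un)
  moreover have "k_times_cont_diff k (\<lambda>x. a * \<phi> x + b * \<psi> x)" for k
    using assms
    by (intro k_times_cont_diff_add k_times_cont_diff_mult k_times_cont_diff_const)
       (auto simp: test_functions_iff)
  ultimately show ?thesis unfolding test_functions_iff by blast
qed

lemma test_functions_continuous: "\<phi> \<in> test_functions \<Omega> \<Longrightarrow> continuous_on UNIV \<phi>"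
  unfolding test_functions_iff by (metis k_times_cont_diff.simps(1))

text \<open>
  An open set is a countable union of open boxes whose closures it contains. With \<open>b\<^sub>i\<close> the bump of
  the \<open>i\<close>-th box, the functions \<open>1 - (\<Prod>i<n. 1 - b\<^sub>i)\<close> are smooth, and they tend to the
  indicator of the open set when the bumps are sharpened with \<open>n\<close>.
\<close>

lemma test_functions_tendsto_indicator_open:
  assumes "open S" and "S \<subseteq> \<Omega>"
  obtains \<phi> :: "nat \<Rightarrow> scalar_field" where
    "\<And>n. \<phi> n \<in> test_functions \<Omega>" "\<And>n x. \<bar>\<phi> n x\<bar> \<le> 1"
    "\<And>x. (\<lambda>n. \<phi> n x) \<longlonglongrightarrow> indicator S x"
proof -
  let ?F = "{box l u | l u. cbox l u \<subseteq> S}"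
  have cover: "\<Union>?F = S"
  proof (intro subset_antisym subsetI)
    fix x assume "x \<in> \<Union>?F"
    then obtain l u where "x \<in> box l u" "cbox l u \<subseteq> S" by blast
    then show "x \<in> S" using box_subset_cbox[of l u] by blast
  next
    fix x assume "x \<in> S"
    then obtain l u where "cbox l u \<subseteq> S" "x \<in> box l u"
      by (rule open_contains_cbox[OF \<open>open S\<close>])
    then show "x \<in> \<Union>?F" by blast
  qed
  obtain F where F: "F \<subseteq> ?F" "countable F" "\<Union>F = \<Union>?F"
    by (rule Lindelof[of ?F]) (auto simp only: mem_Collect_eq open_box)
  \<comment> \<open>The empty box makes the family nonempty, so that it can be enumerated even if \<open>S\<close> is empty.\<close>
  define G where "G = insert {} F"
  have "cbox (1 :: point) 0 = {}" "box (1 :: point) 0 = {}"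
    by (auto simp: set_eq_iff mem_box_cart forall_2)
  then have "{} \<in> ?F" by fastforce
  then have G: "G \<subseteq> ?F" "countable G" "\<Union>G = S" "G \<noteq> {}"
    using F cover by (auto simp: G_def)
  have "\<exists>l u. from_nat_into G i = box l u \<and> cbox l u \<subseteq> S" for i
    using from_nat_into[OF G(4), of i] G(1) by blast
  then obtain l u where lu: "\<And>i. from_nat_into G i = box (l i) (u i)" "\<And>i. cbox (l i) (u i) \<subseteq> S"
    by metis
  have S_eq: "S = (\<Union>i. box (l i) (u i))"
    using range_from_nat_into[OF G(4,2)] G(3) lu(1) by auto
  define b where "b n i = box_bump (1 / real (Suc n)) (l i) (u i)" for n i
  define \<phi> where "\<phi> n x = 1 - (\<Prod>i<n. 1 - b n i x)" for n x
  have b_bounds: "0 \<le> b n i x" "b n i x \<le> 1" for n i x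
    by (auto simp: b_def box_bump_bounds)
  have prod_bounds: "0 \<le> (\<Prod>i<n. 1 - b n i x)" "(\<Prod>i<n. 1 - b n i x) \<le> 1" for n x
    using b_bounds by (auto intro!: prod_nonneg prod_le_1)
  have "\<phi> n \<in> test_functions \<Omega>" for n
  proof -
    have "k_times_cont_diff k (\<phi> n)" for k
    proof -
      have bump: "k_times_cont_diff k (\<lambda>x. 1 + (-1) * b n i x)" for i
        unfolding b_def by (intro k_times_cont_diff_add k_times_cont_diff_mult k_times_cont_diff_const
            k_times_cont_diff_box_bump) simp
      have "k_times_cont_diff k (\<lambda>x. \<Prod>i<j. 1 - b n i x)" for j
      proof (induction j)
        case (Suc j)
        then show ?case using k_times_cont_diff_mult[OF Suc bump[of j]] by simp
      qed (simp add: k_times_cont_diff_const)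
      then have "k_times_cont_diff k (\<lambda>x. 1 + (-1) * (\<Prod>i<n. 1 - b n i x))"
        by (intro k_times_cont_diff_add k_times_cont_diff_mult k_times_cont_diff_const)
      then show ?thesis by (simp add: \<phi>_def[abs_def])
    qed
    moreover have "compact (\<Union>i<n. cbox (l i) (u i))" "(\<Union>i<n. cbox (l i) (u i)) \<subseteq> \<Omega>"
      using lu(2) assms(2) by (auto intro!: compact_UN)
    moreover have "\<phi> n x = 0" if "x \<notin> (\<Union>i<n. cbox (l i) (u i))" for x
    proof -
      have "b n i x = 0" if "i < n" for i
        using \<open>x \<notin> _\<close> that box_subset_cbox[of "l i" "u i"] box_bump_eq_0[of x "l i" "u i"]
        unfolding b_def by blast
      then show ?thesis by (simp add: \<phi>_def)
    qed
    ultimately show ?thesis unfolding test_functions_iff by blast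
  qed
  moreover have "\<bar>\<phi> n x\<bar> \<le> 1" for n x
    using prod_bounds[of n x] by (simp add: \<phi>_def)
  moreover have "(\<lambda>n. \<phi> n x) \<longlonglongrightarrow> indicator S x" for x
  proof (cases "x \<in> S")
    case True
    then obtain i where i: "x \<in> box (l i) (u i)" using S_eq by blast
    have "(\<lambda>n. 1 - b n i x) \<longlonglongrightarrow> 1 - 1"
      unfolding b_def by (intro tendsto_diff tendsto_const box_bump_tendsto_1 i)
    then have lim: "(\<lambda>n. 1 - b n i x) \<longlonglongrightarrow> 0" by simp
    have "(\<lambda>n. \<Prod>i<n. 1 - b n i x) \<longlonglongrightarrow> 0"
    proof (rule tendsto_sandwich[OF _ _ tendsto_const lim])
      show "eventually (\<lambda>n. (\<Prod>i<n. 1 - b n i x) \<le> 1 - b n i x) sequentially"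
      proof (rule eventually_sequentiallyI)
        fix n assume "Suc i \<le> n"
        then have "(\<Prod>j<n. 1 - b n j x) = (1 - b n i x) * (\<Prod>j\<in>{..<n} - {i}. 1 - b n j x)"
          by (intro prod.remove) auto
        also have "\<dots> \<le> (1 - b n i x) * 1"
          using b_bounds by (intro mult_left_mono prod_le_1) auto
        finally show "(\<Prod>i<n. 1 - b n i x) \<le> 1 - b n i x" by simp
      qed
    qed (use prod_bounds in \<open>auto intro!: always_eventually\<close>)
    then have "(\<lambda>n. \<phi> n x) \<longlonglongrightarrow> 1 - 0"
      unfolding \<phi>_def by (intro tendsto_diff tendsto_const)
    then show ?thesis using True by simp
  next
    case False
    then have "b n i x = 0" for n i
      using S_eq by (auto simp: b_def intro!: box_bump_eq_0)
    then show ?thesis using False by (simp add: \<phi>_def)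
  qed
  ultimately show ?thesis by (rule that)
qed

text \<open>
  By dominated convergence the integrals over all open subsets vanish; the sets over which the
  integral vanishes form a Dynkin system, so all Borel and then all Lebesgue sets are reached.
\<close>

theorem fundamental_lemma_calculus_of_variations:
  fixes g :: scalar_field
  assumes "open \<Omega>" and "bounded \<Omega>" and g: "integrable (lebesgue_on \<Omega>) g"
    and test: "\<And>\<phi>. \<phi> \<in> test_functions \<Omega> \<Longrightarrow> (LINT x|lebesgue_on \<Omega>. g x * \<phi> x) = 0"
  shows "AE x in lebesgue_on \<Omega>. g x = 0"
proof (rule sigma_finite_measure.density_zero[OF _ g])
  let ?I = "\<lambda>A. LINT x|lebesgue_on \<Omega>. indicator A x * g x"
  show "sigma_finite_measure (lebesgue_on \<Omega>)"
    using finite_measure_lebesgue_on[OF bounded_set_imp_lmeasurable, of \<Omega>] assms(1,2)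
    by (auto simp: finite_measure_def)
  have meas: "integrable (lebesgue_on \<Omega>) (\<lambda>x. indicator A x * g x)" if "A \<in> sets (lebesgue_on \<Omega>)" for A
    using integrable_mult_indicator[OF that g] by (simp only: real_scaleR_def)
  have borel_sets: "A \<inter> \<Omega> \<in> sets (lebesgue_on \<Omega>)" if "A \<in> sets borel" for A
  proof -
    have "A \<inter> \<Omega> \<in> sets borel" using that borel_open[OF \<open>open \<Omega>\<close>] by (rule sets.Int)
    then have "A \<inter> \<Omega> \<in> sets lebesgue" by (intro sets_completionI_sets) simp
    then show ?thesis using lebesgue_openin[of UNIV \<Omega>] \<open>open \<Omega>\<close> by (simp add: sets_restrict_space_iff)
  qed
  have I_restrict: "?I A = ?I (A \<inter> \<Omega>)" for A
    by (rule Bochner_Integration.integral_cong) (auto simp: indicator_def)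
  have int: "integrable (lebesgue_on \<Omega>) (\<lambda>x. indicator A x * g x)" if "A \<in> sets borel" for A
    using meas[OF borel_sets[OF that]]
    by (rule Bochner_Integration.integrable_cong[THEN iffD1, rotated 2]) (auto simp: indicator_def)
  have open_zero: "?I S = 0" if "open S" for S
  proof -
    have "open (S \<inter> \<Omega>)" "S \<inter> \<Omega> \<subseteq> \<Omega>" using that \<open>open \<Omega>\<close> by auto
    from test_functions_tendsto_indicator_open[OF this]
    obtain \<phi> :: "nat \<Rightarrow> scalar_field" where \<phi>: "\<And>n. \<phi> n \<in> test_functions \<Omega>" "\<And>n x. \<bar>\<phi> n x\<bar> \<le> 1"
      "\<And>x. (\<lambda>n. \<phi> n x) \<longlonglongrightarrow> indicator (S \<inter> \<Omega>) x"
      by metis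
    have \<phi>_meas: "\<phi> n \<in> borel_measurable (lebesgue_on \<Omega>)" for n
      using test_functions_continuous[OF \<phi>(1)[of n]] \<open>open \<Omega>\<close>
      by (intro continuous_imp_measurable_on_sets_lebesgue) (auto intro: continuous_on_subset)
    have "(\<lambda>n. LINT x|lebesgue_on \<Omega>. g x * \<phi> n x) \<longlonglongrightarrow> (LINT x|lebesgue_on \<Omega>. g x * indicator (S \<inter> \<Omega>) x)"
    proof (rule integral_dominated_convergence[where w = "\<lambda>x. norm (g x)"])
      show "AE x in lebesgue_on \<Omega>. (\<lambda>n. g x * \<phi> n x) \<longlonglongrightarrow> g x * indicator (S \<inter> \<Omega>) x"
        by (intro AE_I2 tendsto_mult tendsto_const \<phi>(3))
      show "AE x in lebesgue_on \<Omega>. norm (g x * \<phi> n x) \<le> norm (g x)" for n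
        using \<phi>(2) by (intro AE_I2) (simp add: abs_mult mult_left_le)
      show "(\<lambda>x. g x * \<phi> n x) \<in> borel_measurable (lebesgue_on \<Omega>)" for n
        using g \<phi>_meas by (intro borel_measurable_times) auto
      show "(\<lambda>x. g x * indicator (S \<inter> \<Omega>) x) \<in> borel_measurable (lebesgue_on \<Omega>)"
        using meas[OF borel_sets[of S]] that by (simp add: mult.commute borel_measurable_integrable)
    qed (use g in auto)
    then have "(LINT x|lebesgue_on \<Omega>. g x * indicator (S \<inter> \<Omega>) x) = 0"
      using LIMSEQ_unique[OF _ tendsto_const] by (simp add: test[OF \<phi>(1)] LIMSEQ_const_iff)
    then show ?thesis using I_restrict[of S] by (simp add: mult.commute)
  qed
  have borel_zero: "?I A = 0" if "A \<in> sigma_sets UNIV {S. open S}" for A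
  proof (rule sigma_sets_induct_disjoint[OF _ _ that, where P = "\<lambda>A. ?I A = 0"])
    show "Int_stable {S :: point set. open S}" by (auto simp: Int_stable_def)
    show "{S :: point set. open S} \<subseteq> Pow UNIV" by simp
    show "?I A = 0" if "A \<in> {S. open S}" for A using that open_zero by simp
    show "?I {} = 0" by simp
    show "?I (UNIV - A) = 0" if "A \<in> sigma_sets UNIV {S. open S}" "?I A = 0" for A
    proof -
      have A: "A \<in> sets borel" using that(1) by (simp add: borel_def)
      have "?I (UNIV - A) = (LINT x|lebesgue_on \<Omega>. indicator UNIV x * g x - indicator A x * g x)"
        by (rule Bochner_Integration.integral_cong) (auto simp: indicator_def)
      also have "\<dots> = ?I UNIV - ?I A" by (rule Bochner_Integration.integral_diff[OF int int]) (use A in auto)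
      finally show ?thesis using that open_zero[of UNIV] by simp
    qed
    show "?I (\<Union>i. A i) = 0"
      if "disjoint_family A" "range A \<subseteq> sigma_sets UNIV {S. open S}" "\<And>i::nat. ?I (A i) = 0" for A
    proof -
      have A: "A i \<in> sets borel" for i using that(2) by (auto simp: borel_def)
      have "(LINT x:(\<Union>i. A i \<inter> \<Omega>)|lebesgue_on \<Omega>. g x) = (\<Sum>i. (LINT x:A i \<inter> \<Omega>|lebesgue_on \<Omega>. g x))"
      proof (rule lebesgue_integral_countable_add)
        show "A i \<inter> \<Omega> \<in> sets (lebesgue_on \<Omega>)" for i using borel_sets[OF A] .
        show "i \<noteq> j \<Longrightarrow> (A i \<inter> \<Omega>) \<inter> (A j \<inter> \<Omega>) = {}" for i j
          using that(1) by (auto simp: disjoint_family_on_def)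
        have "(\<Union>i. A i \<inter> \<Omega>) \<in> sets (lebesgue_on \<Omega>)" using borel_sets[OF A] by blast
        from meas[OF this] show "set_integrable (lebesgue_on \<Omega>) (\<Union>i. A i \<inter> \<Omega>) g"
          by (simp add: set_integrable_def)
      qed
      then show ?thesis
        using that(3) I_restrict[of "\<Union>i. A i"] I_restrict[of "A _"]
        by (simp add: set_lebesgue_integral_def Int_UN_distrib2)
    qed
  qed
  fix A assume A: "A \<in> sets (lebesgue_on \<Omega>)"
  then have "A \<in> sets lebesgue" using \<open>open \<Omega>\<close> by (auto simp: sets_restrict_space)
  then obtain B N N' where BN: "A = B \<union> N" "N \<subseteq> N'" "N' \<in> null_sets lborel" "B \<in> sets lborel"
    by (auto elim: sets_completionE)
  have "AE x in lborel. x \<notin> N'" using BN(3) by (rule AE_not_in)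
  then have "AE x in lebesgue. x \<notin> N" using BN(2) by (intro AE_completion) (auto elim: eventually_mono)
  then have ae: "AE x in lebesgue_on \<Omega>. x \<notin> N"
    using \<open>open \<Omega>\<close> by (subst AE_restrict_space_iff) (auto elim: eventually_mono)
  have "B \<in> sets borel" using BN(4) by simp
  have "?I A = ?I B"
    by (rule integral_cong_AE)
       (use ae meas[OF A] int[OF \<open>B \<in> sets borel\<close>] BN(1) in \<open>auto elim!: eventually_mono simp: indicator_def
          intro: borel_measurable_integrable\<close>)
  then show "(LINT x:A|lebesgue_on \<Omega>. g x) = 0"
    using borel_zero[of B] \<open>B \<in> sets borel\<close> by (simp add: set_lebesgue_integral_def borel_def)
qed

section \<open>Calculus in the plane\<close>

definition plane_point :: "real \<Rightarrow> real \<Rightarrow> point" where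
  "plane_point x y = (\<chi> i. if i = 1 then x else y)"

lemma plane_point_nth [simp]:
  "vec_nth (plane_point x y) 1 = x" "vec_nth (plane_point x y) 2 = y"
  by (simp_all add: plane_point_def)

lemma plane_point_cases: obtains x y where "p = plane_point x y"
  using that[of "vec_nth p 1" "vec_nth p 2"] by (simp add: Finite_Cartesian_Product.vec_eq_iff forall_2)

lemma plane_point_eq: "plane_point x y = x *\<^sub>R axis 1 1 + y *\<^sub>R axis 2 1"
  by (simp add: Finite_Cartesian_Product.vec_eq_iff forall_2 axis_def)

lemma prod_Basis_plane: "(\<Prod>b\<in>(Basis :: point set). inner v b) = vec_nth v 1 * vec_nth v 2"
proof -
  have B: "(Basis :: point set) = {axis 1 1, axis 2 1}"
    by (auto simp: Basis_vec_def UNIV_2)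
  have "axis 1 1 \<noteq> (axis 2 1 :: point)" by (simp add: axis_eq_axis)
  then show ?thesis unfolding B by (simp add: inner_axis)
qed

lemma continuous_plane_point: "continuous_on UNIV (\<lambda>(x, y). plane_point x y)"
  unfolding plane_point_eq case_prod_beta by (intro continuous_intros)

lemma borel_measurable_plane_point [measurable]:
  "(\<lambda>(x, y). plane_point x y) \<in> borel_measurable (lborel \<Otimes>\<^sub>M lborel)"
  using borel_measurable_continuous_onI[OF continuous_plane_point]
  by (simp add: borel_prod[symmetric] cong: measurable_cong_sets)

text \<open>Points of the plane are vectors rather than pairs, so Fubini's theorem has to be transported.\<close>

lemma lborel_plane: "(lborel :: point measure) = distr (lborel \<Otimes>\<^sub>M lborel) borel (\<lambda>(x, y). plane_point x y)"
proof (rule lborel_eqI)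
  fix l u :: point
  assume le: "\<And>b. b \<in> Basis \<Longrightarrow> inner l b \<le> inner u b"
  have le': "vec_nth l i \<le> vec_nth u i" for i
    using le[OF axis_in_Basis_iff[THEN iffD2], of 1 i] by (simp add: inner_axis)
  have "(\<lambda>(x, y). plane_point x y) -` box l u
      = {vec_nth l 1<..<vec_nth u 1} \<times> {vec_nth l 2<..<vec_nth u 2}"
    by (auto simp: mem_box_plane)
  then show "emeasure (distr (lborel \<Otimes>\<^sub>M lborel) borel (\<lambda>(x, y). plane_point x y)) (box l u)
      = ennreal (\<Prod>b\<in>Basis. inner (u - l) b)"
    using le' by (simp add: emeasure_distr space_pair_measure lborel.emeasure_pair_measure_Times
        prod_Basis_plane ennreal_mult)
qed simp

lemma nn_integral_plane:
  assumes [measurable]: "f \<in> borel_measurable borel"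
  shows "(\<integral>\<^sup>+p. f p \<partial>(lborel :: point measure)) = (\<integral>\<^sup>+x. \<integral>\<^sup>+y. f (plane_point x y) \<partial>lborel \<partial>lborel)"
    and "(\<integral>\<^sup>+p. f p \<partial>(lborel :: point measure)) = (\<integral>\<^sup>+y. \<integral>\<^sup>+x. f (plane_point x y) \<partial>lborel \<partial>lborel)"
proof -
  have meas: "(\<lambda>(x, y). f (plane_point x y)) \<in> borel_measurable (lborel \<Otimes>\<^sub>M lborel)"
    using measurable_compose[OF borel_measurable_plane_point assms] by (simp add: case_prod_beta')
  have "(\<integral>\<^sup>+p. f p \<partial>(lborel :: point measure)) = (\<integral>\<^sup>+z. (\<lambda>(x, y). f (plane_point x y)) z \<partial>(lborel \<Otimes>\<^sub>M lborel))"
    by (subst lborel_plane, subst nn_integral_distr) (auto simp: case_prod_beta')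
  then show "(\<integral>\<^sup>+p. f p \<partial>(lborel :: point measure)) = (\<integral>\<^sup>+x. \<integral>\<^sup>+y. f (plane_point x y) \<partial>lborel \<partial>lborel)"
    "(\<integral>\<^sup>+p. f p \<partial>(lborel :: point measure)) = (\<integral>\<^sup>+y. \<integral>\<^sup>+x. f (plane_point x y) \<partial>lborel \<partial>lborel)"
    using lborel.nn_integral_fst[OF meas] lborel_pair.nn_integral_snd[OF meas] by simp_all
qed

lemma integral_plane:
  fixes f :: "point \<Rightarrow> real"
  assumes "integrable lborel f"
  shows "(\<integral>p. f p \<partial>lborel) = (\<integral>x. \<integral>y. f (plane_point x y) \<partial>lborel \<partial>lborel)"
    and "(\<integral>p. f p \<partial>lborel) = (\<integral>y. \<integral>x. f (plane_point x y) \<partial>lborel \<partial>lborel)"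
proof -
  have [measurable]: "f \<in> borel_measurable borel"
    using borel_measurable_integrable[OF assms] by simp
  have int: "integrable (lborel \<Otimes>\<^sub>M lborel) (\<lambda>(x, y). f (plane_point x y))"
    using assms by (subst (asm) lborel_plane, subst (asm) integrable_distr_eq) (auto simp: case_prod_beta')
  have "(\<integral>p. f p \<partial>lborel) = (\<integral>z. (\<lambda>(x, y). f (plane_point x y)) z \<partial>(lborel \<Otimes>\<^sub>M lborel))"
    by (subst lborel_plane, subst integral_distr) (auto simp: case_prod_beta')
  then show "(\<integral>p. f p \<partial>lborel) = (\<integral>x. \<integral>y. f (plane_point x y) \<partial>lborel \<partial>lborel)"
    "(\<integral>p. f p \<partial>lborel) = (\<integral>y. \<integral>x. f (plane_point x y) \<partial>lborel \<partial>lborel)"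
    using lborel_pair.integral_fst[OF int] lborel_pair.integral_snd[OF int] by simp_all
qed

lemma partial_deriv_on_lines:
  assumes "\<phi> differentiable (at (plane_point x y))"
  shows "((\<lambda>s. \<phi> (plane_point s y)) has_real_derivative partial_deriv 1 \<phi> (plane_point x y)) (at x)"
    and "((\<lambda>t. \<phi> (plane_point x t)) has_real_derivative partial_deriv 2 \<phi> (plane_point x y)) (at y)"
proof -
  obtain D where D: "(\<phi> has_derivative D) (at (plane_point x y))"
    using assms by (auto simp: differentiable_def)
  have scale: "D (h *\<^sub>R v) = D v * h" for h v
    using linear_scale[OF has_derivative_linear[OF D]] by simp
  have "((\<lambda>s. plane_point s y) has_derivative (\<lambda>h. h *\<^sub>R axis 1 1)) (at x)"
    "((\<lambda>t. plane_point x t) has_derivative (\<lambda>h. h *\<^sub>R axis 2 1)) (at y)"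
    unfolding plane_point_eq by (auto intro!: derivative_eq_intros)
  from has_derivative_compose[OF this(1) D] has_derivative_compose[OF this(2) D]
  show "((\<lambda>s. \<phi> (plane_point s y)) has_real_derivative partial_deriv 1 \<phi> (plane_point x y)) (at x)"
    "((\<lambda>t. \<phi> (plane_point x t)) has_real_derivative partial_deriv 2 \<phi> (plane_point x y)) (at y)"
    by (simp_all add: has_field_derivative_def scale partial_deriv_eq[OF D] mult_commute_abs)
qed

lemma test_functions_partial_deriv:
  assumes "\<phi> \<in> test_functions \<Omega>"
  shows "partial_deriv i \<phi> \<in> test_functions \<Omega>"
proof -
  obtain K where K: "compact K" "K \<subseteq> \<Omega>" "\<forall>x. x \<notin> K \<longrightarrow> \<phi> x = 0"
    using assms by (auto simp: test_functions_iff)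
  have "partial_deriv i \<phi> x = 0" if "x \<notin> K" for x
  proof -
    have "eventually (\<lambda>y. y \<in> - K) (nhds x)"
      using that K(1) by (intro eventually_nhds_in_open) (auto simp: compact_imp_closed open_Compl)
    then have "eventually (\<lambda>y. \<phi> y = 0) (nhds x)"
      by eventually_elim (use K(3) in auto)
    then have "(\<phi> has_derivative (\<lambda>h. 0)) (at x)"
      by (intro has_derivative_transform_eventually[OF has_derivative_const])
         (use that K(3) in \<open>auto simp: eventually_at_filter elim: eventually_mono\<close>)
    then show ?thesis by (simp add: partial_deriv_eq)
  qed
  moreover have "k_times_cont_diff k (partial_deriv i \<phi>)" for k
    using assms unfolding test_functions_iff by (metis k_times_cont_diff.simps(2))
  ultimately show ?thesis using K unfolding test_functions_iff by blast
qed

lemma test_functions_mult: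
  assumes "\<phi> \<in> test_functions \<Omega>" "\<psi> \<in> test_functions \<Omega>"
  shows "(\<lambda>x. \<phi> x * \<psi> x) \<in> test_functions \<Omega>"
  using assms unfolding test_functions_iff
  by (metis k_times_cont_diff_mult mult_zero_left)

lemma test_functions_differentiable: "\<phi> \<in> test_functions \<Omega> \<Longrightarrow> \<phi> differentiable (at x)"
  unfolding test_functions_iff by (metis k_times_cont_diff.simps(2))

lemma test_functions_integrable:
  assumes "\<phi> \<in> test_functions \<Omega>"
  shows "integrable lborel \<phi>"
proof -
  obtain K where K: "compact K" "\<forall>x. x \<notin> K \<longrightarrow> \<phi> x = 0"
    using assms by (auto simp: test_functions_iff)
  have "integrable lborel (\<lambda>x. indicator K x *\<^sub>R \<phi> x)"
    using K(1) test_functions_continuous[OF assms]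
    by (intro borel_integrable_compact) (auto intro: continuous_on_subset)
  moreover have "(\<lambda>x. indicator K x *\<^sub>R \<phi> x) = \<phi>"
    using K(2) by (intro ext) (auto simp: indicator_def)
  ultimately show ?thesis by (simp only:)
qed

lemma test_functions_bounded_support:
  assumes "\<phi> \<in> test_functions \<Omega>"
  obtains B where "0 \<le> B" "\<And>x y. B \<le> \<bar>x\<bar> \<Longrightarrow> \<phi> (plane_point x y) = 0"
    "\<And>x y. B \<le> \<bar>y\<bar> \<Longrightarrow> \<phi> (plane_point x y) = 0"
proof -
  obtain K where K: "compact K" "\<forall>x. x \<notin> K \<longrightarrow> \<phi> x = 0"
    using assms by (auto simp: test_functions_iff)
  obtain B where B: "0 < B" "\<And>x. x \<in> K \<Longrightarrow> norm x \<le> B"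
    using compact_imp_bounded[OF K(1)] by (auto simp: bounded_pos)
  have outside: "plane_point x y \<notin> K" if "B + 1 \<le> \<bar>x\<bar> \<or> B + 1 \<le> \<bar>y\<bar>" for x y
    using B(2)[of "plane_point x y"] component_le_norm_cart[of "plane_point x y" 1]
      component_le_norm_cart[of "plane_point x y" 2] that by auto
  show ?thesis
    by (rule that[of "B + 1"]) (use B(1) K(2) outside in auto)
qed

text \<open>
  Both claims are the fundamental theorem of calculus started outside the support. The second one
  gives, applied along a line, a bound that is constant on that line.
\<close>

lemma derivative_of_compact_support:
  fixes G g :: "real \<Rightarrow> real"
  assumes G: "\<And>t. (G has_real_derivative g t) (at t)" and cont: "continuous_on UNIV g"
    and zero: "\<And>t. B \<le> \<bar>t\<bar> \<Longrightarrow> G t = 0" "\<And>t. B \<le> \<bar>t\<bar> \<Longrightarrow> g t = 0" and "0 \<le> B"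
  shows "(\<integral>t. g t \<partial>lborel) = 0" and "ennreal \<bar>G t\<bar> \<le> (\<integral>\<^sup>+t. ennreal \<bar>g t\<bar> \<partial>lborel)"
proof -
  have FTC: "(\<integral>t. indicator {a..b} t *\<^sub>R g t \<partial>lborel) = G b - G a" if "a \<le> b" for a b
    using that G cont
    by (intro integral_FTC_atLeastAtMost)
       (auto simp: has_real_derivative_iff_has_vector_derivative[symmetric]
          intro: has_field_derivative_at_within continuous_on_subset)
  have "indicator {- B..B} t *\<^sub>R g t = g t" for t
    using zero(2)[of t] by (cases "B \<le> \<bar>t\<bar>") (auto simp: indicator_def)
  then have "(\<integral>t. g t \<partial>lborel) = G B - G (- B)"
    using FTC[of "- B" B] \<open>0 \<le> B\<close> by (simp only:)
  then show "(\<integral>t. g t \<partial>lborel) = 0"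
    using zero(1)[of B] zero(1)[of "- B"] by simp
  define a where "a = - max B \<bar>t\<bar>"
  have "a \<le> t" "G a = 0" using zero(1)[of a] \<open>0 \<le> B\<close> by (auto simp: a_def)
  then have "ennreal \<bar>G t\<bar> = ennreal (norm (\<integral>s. indicator {a..t} s *\<^sub>R g s \<partial>lborel))"
    using FTC[of a t] by simp
  also have "\<dots> \<le> (\<integral>\<^sup>+s. norm (indicator {a..t} s *\<^sub>R g s) \<partial>lborel)"
    by (intro integral_norm_bound_ennreal borel_integrable_compact continuous_on_subset[OF cont]) auto
  also have "\<dots> \<le> (\<integral>\<^sup>+s. ennreal \<bar>g s\<bar> \<partial>lborel)"
    by (intro nn_integral_mono ennreal_leI) (auto simp: indicator_def)
  finally show "ennreal \<bar>G t\<bar> \<le> (\<integral>\<^sup>+t. ennreal \<bar>g t\<bar> \<partial>lborel)" .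
qed

lemma continuous_on_plane_lines:
  assumes "continuous_on UNIV \<phi>"
  shows "continuous_on UNIV (\<lambda>s. \<phi> (plane_point s y))" "continuous_on UNIV (\<lambda>t. \<phi> (plane_point x t))"
  unfolding plane_point_eq
  by (auto intro!: continuous_on_compose2[OF assms] continuous_intros)

lemma test_functions_on_lines:
  assumes "\<phi> \<in> test_functions \<Omega>"
  shows "(\<integral>s. partial_deriv 1 \<phi> (plane_point s y) \<partial>lborel) = 0"
    and "(\<integral>t. partial_deriv 2 \<phi> (plane_point x t) \<partial>lborel) = 0"
    and "ennreal \<bar>\<phi> (plane_point x y)\<bar> \<le> (\<integral>\<^sup>+s. ennreal \<bar>partial_deriv 1 \<phi> (plane_point s y)\<bar> \<partial>lborel)"
    and "ennreal \<bar>\<phi> (plane_point x y)\<bar> \<le> (\<integral>\<^sup>+t. ennreal \<bar>partial_deriv 2 \<phi> (plane_point x t)\<bar> \<partial>lborel)"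
proof -
  note D = partial_deriv_on_lines[OF test_functions_differentiable[OF assms]]
  note C = continuous_on_plane_lines[OF test_functions_continuous[OF test_functions_partial_deriv[OF assms]]]
  obtain B0 where B0: "\<And>x y. B0 \<le> \<bar>x\<bar> \<Longrightarrow> \<phi> (plane_point x y) = 0"
    "\<And>x y. B0 \<le> \<bar>y\<bar> \<Longrightarrow> \<phi> (plane_point x y) = 0" "0 \<le> B0"
    by (rule test_functions_bounded_support[OF assms]) blast
  obtain B1 where B1: "\<And>x y. B1 \<le> \<bar>x\<bar> \<Longrightarrow> partial_deriv 1 \<phi> (plane_point x y) = 0"
    by (rule test_functions_bounded_support[OF test_functions_partial_deriv[OF assms]]) blast
  obtain B2 where B2: "\<And>x y. B2 \<le> \<bar>y\<bar> \<Longrightarrow> partial_deriv 2 \<phi> (plane_point x y) = 0"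
    by (rule test_functions_bounded_support[OF test_functions_partial_deriv[OF assms]]) blast
  note one = derivative_of_compact_support[OF D(1) C(1), of "max B0 B1"]
  note two = derivative_of_compact_support[OF D(2) C(2), of "max B0 B2"]
  show "(\<integral>s. partial_deriv 1 \<phi> (plane_point s y) \<partial>lborel) = 0"
    "ennreal \<bar>\<phi> (plane_point x y)\<bar> \<le> (\<integral>\<^sup>+s. ennreal \<bar>partial_deriv 1 \<phi> (plane_point s y)\<bar> \<partial>lborel)"
    using B0 B1 by (auto intro!: one)
  show "(\<integral>t. partial_deriv 2 \<phi> (plane_point x t) \<partial>lborel) = 0"
    "ennreal \<bar>\<phi> (plane_point x y)\<bar> \<le> (\<integral>\<^sup>+t. ennreal \<bar>partial_deriv 2 \<phi> (plane_point x t)\<bar> \<partial>lborel)"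
    using B0 B2 by (auto intro!: two)
qed

lemma integral_partial_deriv_eq_0:
  assumes "\<phi> \<in> test_functions \<Omega>"
  shows "(\<integral>x. partial_deriv i \<phi> x \<partial>lborel) = 0"
proof -
  note int = integral_plane[OF test_functions_integrable[OF test_functions_partial_deriv[OF assms]]]
  show ?thesis
    using exhaust_2[of i] int(1)[of 2] int(2)[of 1] test_functions_on_lines(1,2)[OF assms] by auto
qed

text \<open>
  The Gagliardo-Nirenberg inequality: along every horizontal line \<open>\<bar>\<phi>\<bar>\<close> is at most the integral of
  \<open>\<bar>\<partial>\<^sub>1\<phi>\<bar>\<close>, which no longer depends on the first coordinate, and similarly along vertical lines.
  Hence the double integral of the product of these two bounds factorises.
\<close>

lemma gagliardo_nirenberg_plane:
  assumes "\<phi> \<in> test_functions \<Omega>"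
  shows "(\<integral>\<^sup>+p. ennreal ((\<phi> p)\<^sup>2) \<partial>lborel)
    \<le> (\<integral>\<^sup>+p. ennreal \<bar>partial_deriv 1 \<phi> p\<bar> \<partial>lborel) * (\<integral>\<^sup>+p. ennreal \<bar>partial_deriv 2 \<phi> p\<bar> \<partial>lborel)"
proof -
  let ?P = "\<lambda>y. \<integral>\<^sup>+s. ennreal \<bar>partial_deriv 1 \<phi> (plane_point s y)\<bar> \<partial>lborel"
  let ?Q = "\<lambda>x. \<integral>\<^sup>+t. ennreal \<bar>partial_deriv 2 \<phi> (plane_point x t)\<bar> \<partial>lborel"
  have [measurable]: "\<phi> \<in> borel_measurable borel" "partial_deriv i \<phi> \<in> borel_measurable borel" for i
    using assms test_functions_partial_deriv
    by (blast intro: borel_measurable_continuous_onI test_functions_continuous)+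
  have pair: "(\<lambda>z. ennreal \<bar>partial_deriv i \<phi> ((\<lambda>(x, y). plane_point x y) z)\<bar>)
      \<in> borel_measurable (lborel \<Otimes>\<^sub>M lborel)" for i
    by measurable
  have P: "?P \<in> borel_measurable lborel"
    using lborel.borel_measurable_nn_integral_fst[OF measurable_compose[OF measurable_pair_swap' pair[of 1]]]
    by (simp add: case_prod_beta')
  have Q: "?Q \<in> borel_measurable lborel"
    using lborel.borel_measurable_nn_integral_fst[OF pair[of 2]] by simp
  have "(\<integral>\<^sup>+p. ennreal ((\<phi> p)\<^sup>2) \<partial>lborel)
      = (\<integral>\<^sup>+x. \<integral>\<^sup>+y. ennreal ((\<phi> (plane_point x y))\<^sup>2) \<partial>lborel \<partial>lborel)"
    by (rule nn_integral_plane) measurable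
  also have "\<dots> \<le> (\<integral>\<^sup>+x. \<integral>\<^sup>+y. ?Q x * ?P y \<partial>lborel \<partial>lborel)"
  proof (intro nn_integral_mono)
    fix x y
    have "ennreal ((\<phi> (plane_point x y))\<^sup>2) = ennreal \<bar>\<phi> (plane_point x y)\<bar> * ennreal \<bar>\<phi> (plane_point x y)\<bar>"
      by (simp add: ennreal_mult[symmetric] power2_eq_square)
    also have "\<dots> \<le> ?Q x * ?P y"
      by (intro mult_mono test_functions_on_lines[OF assms]) auto
    finally show "ennreal ((\<phi> (plane_point x y))\<^sup>2) \<le> ?Q x * ?P y" .
  qed
  also have "\<dots> = (\<integral>\<^sup>+x. ?Q x \<partial>lborel) * (\<integral>\<^sup>+y. ?P y \<partial>lborel)"
    using P Q by (simp add: nn_integral_cmult nn_integral_multc)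
  also have "(\<integral>\<^sup>+x. ?Q x \<partial>lborel) = (\<integral>\<^sup>+p. ennreal \<bar>partial_deriv 2 \<phi> p\<bar> \<partial>lborel)"
    by (rule nn_integral_plane(1)[symmetric]) measurable
  also have "(\<integral>\<^sup>+y. ?P y \<partial>lborel) = (\<integral>\<^sup>+p. ennreal \<bar>partial_deriv 1 \<phi> p\<bar> \<partial>lborel)"
    by (rule nn_integral_plane(2)[symmetric]) measurable
  finally show ?thesis by (simp add: mult.commute)
qed

text \<open>
  Both mixed derivatives are limits of the second difference quotient over small squares, by two
  applications of the mean value theorem in either order.
\<close>

lemma partial_deriv_commute:
  assumes "\<phi> \<in> test_functions \<Omega>"
  shows "partial_deriv 1 (partial_deriv 2 \<phi>) = partial_deriv 2 (partial_deriv 1 \<phi>)"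
proof
  fix p
  obtain a b where p: "p = plane_point a b" by (rule plane_point_cases)
  note D = partial_deriv_on_lines[OF test_functions_differentiable[OF assms]]
  note DD = partial_deriv_on_lines[OF test_functions_differentiable[OF test_functions_partial_deriv[OF assms]]]
  have square: "\<exists>x y x' y'. a < x \<and> x < a + h \<and> b < y \<and> y < b + h \<and> a < x' \<and> x' < a + h \<and> b < y' \<and> y' < b + h \<and>
      partial_deriv 2 (partial_deriv 1 \<phi>) (plane_point x y)
    = partial_deriv 1 (partial_deriv 2 \<phi>) (plane_point x' y')" if h: "0 < h" for h
  proof -
    let ?\<Delta> = "\<phi> (plane_point (a + h) (b + h)) - \<phi> (plane_point (a + h) b)
      - \<phi> (plane_point a (b + h)) + \<phi> (plane_point a b)"
    define F F' where "F s = \<phi> (plane_point s (b + h)) - \<phi> (plane_point s b)"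
      and "F' s = partial_deriv 1 \<phi> (plane_point s (b + h)) - partial_deriv 1 \<phi> (plane_point s b)" for s
    have "(F has_real_derivative F' s) (at s)" for s
      unfolding F_def[abs_def] F'_def by (intro DERIV_diff D)
    then obtain x where x: "a < x" "x < a + h" "F (a + h) - F a = h * F' x"
      using MVT2[of a "a + h" F F'] h by auto
    obtain y where y: "b < y" "y < b + h"
      "partial_deriv 1 \<phi> (plane_point x (b + h)) - partial_deriv 1 \<phi> (plane_point x b)
       = h * partial_deriv 2 (partial_deriv 1 \<phi>) (plane_point x y)"
      using MVT2[of b "b + h" "\<lambda>t. partial_deriv 1 \<phi> (plane_point x t)"
          "\<lambda>t. partial_deriv 2 (partial_deriv 1 \<phi>) (plane_point x t)"] h DD(2) by auto
    have one: "?\<Delta> = h * h * partial_deriv 2 (partial_deriv 1 \<phi>) (plane_point x y)"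
      using x(3) y(3) by (simp add: F_def F'_def)
    define G G' where "G t = \<phi> (plane_point (a + h) t) - \<phi> (plane_point a t)"
      and "G' t = partial_deriv 2 \<phi> (plane_point (a + h) t) - partial_deriv 2 \<phi> (plane_point a t)" for t
    have "(G has_real_derivative G' t) (at t)" for t
      unfolding G_def[abs_def] G'_def by (intro DERIV_diff D)
    then obtain y' where y': "b < y'" "y' < b + h" "G (b + h) - G b = h * G' y'"
      using MVT2[of b "b + h" G G'] h by auto
    obtain x' where x': "a < x'" "x' < a + h"
      "partial_deriv 2 \<phi> (plane_point (a + h) y') - partial_deriv 2 \<phi> (plane_point a y')
       = h * partial_deriv 1 (partial_deriv 2 \<phi>) (plane_point x' y')"
      using MVT2[of a "a + h" "\<lambda>s. partial_deriv 2 \<phi> (plane_point s y')"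
          "\<lambda>s. partial_deriv 1 (partial_deriv 2 \<phi>) (plane_point s y')"] h DD(1) by auto
    have "?\<Delta> = h * h * partial_deriv 1 (partial_deriv 2 \<phi>) (plane_point x' y')"
      using x'(3) y'(3) by (simp add: G_def G'_def)
    with one h have "partial_deriv 2 (partial_deriv 1 \<phi>) (plane_point x y)
        = partial_deriv 1 (partial_deriv 2 \<phi>) (plane_point x' y')" by simp
    with x y x' y' show ?thesis by blast
  qed
  define near where "near n z c \<longleftrightarrow> c < z \<and> z < c + 1 / real (Suc n)" for n :: nat and z c :: real
  have "\<exists>x y x' y'. near n x a \<and> near n y b \<and> near n x' a \<and> near n y' b \<and>
      partial_deriv 2 (partial_deriv 1 \<phi>) (plane_point x y)
    = partial_deriv 1 (partial_deriv 2 \<phi>) (plane_point x' y')" for n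
    using square[of "1 / real (Suc n)"] unfolding near_def by simp
  then obtain x y x' y' where near: "\<And>n. near n (x n) a" "\<And>n. near n (y n) b"
      "\<And>n. near n (x' n) a" "\<And>n. near n (y' n) b"
    and eq: "\<And>n. partial_deriv 2 (partial_deriv 1 \<phi>) (plane_point (x n) (y n))
    = partial_deriv 1 (partial_deriv 2 \<phi>) (plane_point (x' n) (y' n))" by metis
  have squeeze: "z \<longlonglongrightarrow> c" if "\<And>n. near n (z n) c" for z c
  proof (rule tendsto_sandwich[OF _ _ tendsto_const])
    show "(\<lambda>n. c + 1 / real (Suc n)) \<longlonglongrightarrow> c"
      using tendsto_add[OF tendsto_const LIMSEQ_Suc[OF lim_1_over_n], of c] by simp
  qed (use that in \<open>auto simp: near_def intro!: always_eventually less_imp_le\<close>)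
  have lim: "(\<lambda>n. partial_deriv i (partial_deriv j \<phi>) (plane_point (s n) (t n)))
      \<longlonglongrightarrow> partial_deriv i (partial_deriv j \<phi>) p" if "s \<longlonglongrightarrow> a" "t \<longlonglongrightarrow> b" for s t i j
  proof -
    have "(\<lambda>n. plane_point (s n) (t n)) \<longlonglongrightarrow> p"
      unfolding p plane_point_eq by (intro tendsto_intros that)
    moreover have "isCont (partial_deriv i (partial_deriv j \<phi>)) p"
      using test_functions_continuous[OF test_functions_partial_deriv[OF test_functions_partial_deriv[OF assms]]]
      by (simp add: continuous_on_eq_continuous_at)
    ultimately show ?thesis by (rule isCont_tendsto_compose[rotated])
  qed
  have "x \<longlonglongrightarrow> a" "y \<longlonglongrightarrow> b" "x' \<longlonglongrightarrow> a" "y' \<longlonglongrightarrow> b" using near by (auto intro!: squeeze)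
  then show "partial_deriv 1 (partial_deriv 2 \<phi>) p = partial_deriv 2 (partial_deriv 1 \<phi>) p"
    using LIMSEQ_unique[OF lim[of x y 2 1, unfolded eq] lim[of x' y' 1 2]] by simp
qed

lemma lebesgue_on_eq_lborel:
  fixes f :: "point \<Rightarrow> real"
  assumes "open \<Omega>" and [measurable]: "f \<in> borel_measurable borel" and zero: "\<And>x. x \<notin> \<Omega> \<Longrightarrow> f x = 0"
  shows "(LINT x|lebesgue_on \<Omega>. f x) = (\<integral>x. f x \<partial>lborel)"
    and "integrable (lebesgue_on \<Omega>) f \<longleftrightarrow> integrable lborel f"
proof -
  have ind: "(\<lambda>x. indicator \<Omega> x *\<^sub>R f x) = f" using zero by (intro ext) (auto simp: indicator_def)
  have \<Omega>: "\<Omega> \<inter> space lebesgue \<in> sets lebesgue" using \<open>open \<Omega>\<close> by auto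
  have f: "f \<in> borel_measurable lborel" by simp
  show "(LINT x|lebesgue_on \<Omega>. f x) = (\<integral>x. f x \<partial>lborel)"
    "integrable (lebesgue_on \<Omega>) f \<longleftrightarrow> integrable lborel f"
    unfolding integral_restrict_space[OF \<Omega>] integrable_restrict_space[OF \<Omega>] ind
    by (rule integral_completion[OF f] integrable_completion[OF f])+
qed

lemma test_functions_eq_0_outside: "\<phi> \<in> test_functions \<Omega> \<Longrightarrow> x \<notin> \<Omega> \<Longrightarrow> \<phi> x = 0"
  unfolding test_functions_iff by blast

lemma test_functions_lebesgue_on:
  assumes "open \<Omega>" "\<phi> \<in> test_functions \<Omega>"
  shows "(LINT x|lebesgue_on \<Omega>. \<phi> x) = (\<integral>x. \<phi> x \<partial>lborel)" "integrable (lebesgue_on \<Omega>) \<phi>"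
  using lebesgue_on_eq_lborel[OF assms(1) borel_measurable_continuous_onI[OF test_functions_continuous[OF assms(2)]]]
    test_functions_eq_0_outside[OF assms(2)] test_functions_integrable[OF assms(2)] by auto

lemma test_functions_L2:
  assumes "open \<Omega>" "\<phi> \<in> test_functions \<Omega>"
  shows "\<phi> \<in> L2 \<Omega>"
  using test_functions_lebesgue_on(2)[OF assms]
    test_functions_lebesgue_on(2)[OF assms(1) test_functions_mult[OF assms(2,2)]]
  by (simp add: L2_def power2_eq_square borel_measurable_integrable)

text \<open>The product is again a test function, and the integral of its partial derivative vanishes.\<close>

lemma integration_by_parts:
  assumes "open \<Omega>" "\<phi> \<in> test_functions \<Omega>" "\<psi> \<in> test_functions \<Omega>"
  shows "l2_inner \<Omega> \<phi> (partial_deriv i \<psi>) = - l2_inner \<Omega> (partial_deriv i \<phi>) \<psi>"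
proof -
  have "partial_deriv i (\<lambda>x. \<phi> x * \<psi> x) = (\<lambda>x. \<phi> x * partial_deriv i \<psi> x + partial_deriv i \<phi> x * \<psi> x)"
    using assms by (intro ext partial_deriv_mult) (auto intro: test_functions_differentiable)
  moreover have "(LINT x|lebesgue_on \<Omega>. partial_deriv i (\<lambda>x. \<phi> x * \<psi> x) x) = 0"
    using assms test_functions_mult[OF assms(2,3)] test_functions_partial_deriv
    by (simp add: test_functions_lebesgue_on integral_partial_deriv_eq_0)
  moreover have "integrable (lebesgue_on \<Omega>) (\<lambda>x. \<phi> x * partial_deriv i \<psi> x)"
    "integrable (lebesgue_on \<Omega>) (\<lambda>x. partial_deriv i \<phi> x * \<psi> x)"
    using assms by (auto intro!: test_functions_lebesgue_on test_functions_mult test_functions_partial_deriv)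
  ultimately show ?thesis
    by (simp add: l2_inner_def)
qed

text \<open>Both sides equal minus the pairing of \<open>\<phi>\<close> with the mixed derivative of \<open>\<psi>\<close>.\<close>

lemma l2_inner_partial_deriv_swap:
  assumes "open \<Omega>" "\<phi> \<in> test_functions \<Omega>" "\<psi> \<in> test_functions \<Omega>"
  shows "l2_inner \<Omega> (partial_deriv 1 \<phi>) (partial_deriv 2 \<psi>) = l2_inner \<Omega> (partial_deriv 2 \<phi>) (partial_deriv 1 \<psi>)"
  using integration_by_parts[OF assms(1,2) test_functions_partial_deriv[OF assms(3)], of 1 2]
    integration_by_parts[OF assms(1,2) test_functions_partial_deriv[OF assms(3)], of 2 1]
    partial_deriv_commute[OF assms(3)] by simp

text \<open>Ladyzhenskaya's inequality is the Gagliardo-Nirenberg inequality for \<open>\<phi>\<^sup>2\<close>.\<close>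

lemma ladyzhenskaya_test_functions:
  assumes "open \<Omega>" and \<phi>: "\<phi> \<in> test_functions \<Omega>"
  shows "(l2_norm \<Omega> (\<lambda>x. (\<phi> x)\<^sup>2))\<^sup>2
    \<le> 4 * (l2_norm \<Omega> \<phi>)\<^sup>2 * (l2_norm \<Omega> (partial_deriv 1 \<phi>) * l2_norm \<Omega> (partial_deriv 2 \<phi>))"
proof -
  let ?\<psi> = "\<lambda>x. \<phi> x * \<phi> x"
  have \<psi>: "?\<psi> \<in> test_functions \<Omega>" using \<phi> by (intro test_functions_mult)
  have bound: "(\<integral>\<^sup>+p. ennreal \<bar>partial_deriv i ?\<psi> p\<bar> \<partial>lborel)
      \<le> ennreal (2 * (l2_norm \<Omega> \<phi> * l2_norm \<Omega> (partial_deriv i \<phi>)))" for i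
  proof -
    have d: "partial_deriv i ?\<psi> x = 2 * (\<phi> x * partial_deriv i \<phi> x)" for x
      using partial_deriv_mult[OF test_functions_differentiable[OF \<phi>] test_functions_differentiable[OF \<phi>]]
      by simp
    have prod: "(\<lambda>x. \<phi> x * partial_deriv i \<phi> x) \<in> test_functions \<Omega>"
      using \<phi> by (intro test_functions_mult test_functions_partial_deriv)
    have abs: "(\<lambda>x. \<bar>\<phi> x * partial_deriv i \<phi> x\<bar>) \<in> borel_measurable borel"
      using borel_measurable_continuous_onI[OF test_functions_continuous[OF prod]] by measurable
    have "(\<integral>\<^sup>+p. ennreal \<bar>partial_deriv i ?\<psi> p\<bar> \<partial>lborel) = ennreal (\<integral>p. \<bar>partial_deriv i ?\<psi> p\<bar> \<partial>lborel)"
      using test_functions_integrable[OF test_functions_partial_deriv[OF \<psi>]]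
      by (intro nn_integral_eq_integral) auto
    also have "(\<integral>p. \<bar>partial_deriv i ?\<psi> p\<bar> \<partial>lborel) = 2 * (\<integral>p. \<bar>\<phi> p * partial_deriv i \<phi> p\<bar> \<partial>lborel)"
      by (simp add: d abs_mult)
    also have "(\<integral>p. \<bar>\<phi> p * partial_deriv i \<phi> p\<bar> \<partial>lborel) = (LINT p|lebesgue_on \<Omega>. \<bar>\<phi> p * partial_deriv i \<phi> p\<bar>)"
      using test_functions_eq_0_outside[OF \<phi>]
      by (intro lebesgue_on_eq_lborel(1)[symmetric] assms(1) abs) auto
    also have "\<dots> = l2_inner \<Omega> (\<lambda>x. norm (\<phi> x)) (\<lambda>x. norm (partial_deriv i \<phi> x))"
      by (simp add: l2_inner_def abs_mult)
    also have "\<dots> \<le> l2_norm \<Omega> \<phi> * l2_norm \<Omega> (partial_deriv i \<phi>)"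
      by (rule order_trans[OF abs_ge_self l2_cauchy_schwarz[of "\<lambda>x. norm (\<phi> x)" \<Omega> "\<lambda>x. norm (partial_deriv i \<phi> x)", unfolded l2_norm_norm]])
         (intro L2_norm test_functions_L2[OF assms(1)] \<phi> test_functions_partial_deriv[OF \<phi>])+
    finally show ?thesis by (simp add: ennreal_leI)
  qed
  have "ennreal ((l2_norm \<Omega> (\<lambda>x. (\<phi> x)\<^sup>2))\<^sup>2) = ennreal (LINT x|lebesgue_on \<Omega>. (?\<psi> x)\<^sup>2)"
    unfolding l2_norm_sq l2_inner_def by (simp add: power2_eq_square)
  also have "\<dots> = ennreal (\<integral>x. (?\<psi> x)\<^sup>2 \<partial>lborel)"
    using test_functions_lebesgue_on(1)[OF assms(1) test_functions_mult[OF \<psi> \<psi>]]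
    by (simp add: power2_eq_square)
  also have "\<dots> = (\<integral>\<^sup>+x. ennreal ((?\<psi> x)\<^sup>2) \<partial>lborel)"
    using test_functions_integrable[OF test_functions_mult[OF \<psi> \<psi>]]
    by (intro nn_integral_eq_integral[symmetric]) (auto simp: power2_eq_square)
  also have "\<dots> \<le> (\<integral>\<^sup>+p. ennreal \<bar>partial_deriv 1 ?\<psi> p\<bar> \<partial>lborel) * (\<integral>\<^sup>+p. ennreal \<bar>partial_deriv 2 ?\<psi> p\<bar> \<partial>lborel)"
    by (rule gagliardo_nirenberg_plane[OF \<psi>])
  also have "\<dots> \<le> ennreal (2 * (l2_norm \<Omega> \<phi> * l2_norm \<Omega> (partial_deriv 1 \<phi>)))
      * ennreal (2 * (l2_norm \<Omega> \<phi> * l2_norm \<Omega> (partial_deriv 2 \<phi>)))"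
    by (intro mult_mono bound) auto
  also have "\<dots> = ennreal (4 * (l2_norm \<Omega> \<phi>)\<^sup>2 * (l2_norm \<Omega> (partial_deriv 1 \<phi>) * l2_norm \<Omega> (partial_deriv 2 \<phi>)))"
    by (simp add: ennreal_mult[symmetric] power2_eq_square mult_ac)
  finally show ?thesis
    by (subst (asm) ennreal_le_iff) (auto intro!: mult_nonneg_nonneg)
qed

section \<open>Weak derivatives on a bounded open set\<close>

locale bounded_open_set =
  fixes \<Omega> :: "point set"
  assumes open_\<Omega>: "open \<Omega>" and bounded_\<Omega>: "bounded \<Omega>"
begin

lemma L2_const: "(\<lambda>x. c) \<in> L2 \<Omega>"
proof -
  interpret finite_measure "lebesgue_on \<Omega>"
    using open_\<Omega> bounded_\<Omega> by (intro finite_measure_lebesgue_on bounded_set_imp_lmeasurable) auto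
  show ?thesis by (simp add: L2_def)
qed

lemma L2_integrable: "u \<in> L2 \<Omega> \<Longrightarrow> integrable (lebesgue_on \<Omega>) u" for u :: scalar_field
  using L2_integrable_inner[OF _ L2_const[of 1], of u] by simp

lemmas test_L2 = test_functions_L2[OF open_\<Omega>]

lemma is_weak_partial_deriv_iff:
  "is_weak_partial_deriv \<Omega> i u g \<longleftrightarrow>
     (\<forall>\<phi>\<in>test_functions \<Omega>. l2_inner \<Omega> u (partial_deriv i \<phi>) = - l2_inner \<Omega> g \<phi>)"
  by (simp add: is_weak_partial_deriv_def l2_inner_def)

lemma weak_partial_deriv_unique:
  assumes "g \<in> L2 \<Omega>" "h \<in> L2 \<Omega>" "is_weak_partial_deriv \<Omega> i u g" "is_weak_partial_deriv \<Omega> i u h"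
  shows "AE x in lebesgue_on \<Omega>. g x = h x"
proof -
  have "AE x in lebesgue_on \<Omega>. g x - h x = 0"
  proof (rule fundamental_lemma_calculus_of_variations[OF open_\<Omega> bounded_\<Omega>])
    show "integrable (lebesgue_on \<Omega>) (\<lambda>x. g x - h x)"
      using assms by (intro L2_integrable L2_diff)
    fix \<phi> assume \<phi>: "\<phi> \<in> test_functions \<Omega>"
    have "l2_inner \<Omega> (\<lambda>x. g x - h x) \<phi> = l2_inner \<Omega> g \<phi> - l2_inner \<Omega> h \<phi>"
      using assms test_L2[OF \<phi>] by (intro l2_inner_diff_left)
    also have "\<dots> = 0" using assms(3,4) \<phi> by (simp add: is_weak_partial_deriv_iff)
    finally show "(LINT x|lebesgue_on \<Omega>. (g x - h x) * \<phi> x) = 0" by (simp add: l2_inner_def)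
  qed
  then show ?thesis by (auto elim: eventually_mono)
qed

lemma is_weak_partial_deriv_linear:
  assumes "u \<in> L2 \<Omega>" "v \<in> L2 \<Omega>" "g \<in> L2 \<Omega>" "h \<in> L2 \<Omega>"
    and "is_weak_partial_deriv \<Omega> i u g" "is_weak_partial_deriv \<Omega> i v h"
  shows "is_weak_partial_deriv \<Omega> i (\<lambda>x. a *\<^sub>R u x + b *\<^sub>R v x) (\<lambda>x. a *\<^sub>R g x + b *\<^sub>R h x)"
  unfolding is_weak_partial_deriv_iff
proof
  fix \<phi> assume \<phi>: "\<phi> \<in> test_functions \<Omega>"
  note L2s = L2_scale[OF assms(1)] L2_scale[OF assms(2)] L2_scale[OF assms(3)] L2_scale[OF assms(4)]
    test_L2[OF \<phi>] test_L2[OF test_functions_partial_deriv[OF \<phi>]]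
  show "l2_inner \<Omega> (\<lambda>x. a *\<^sub>R u x + b *\<^sub>R v x) (partial_deriv i \<phi>)
      = - l2_inner \<Omega> (\<lambda>x. a *\<^sub>R g x + b *\<^sub>R h x) \<phi>"
    unfolding l2_inner_add_left[OF L2s(1,2,6)] l2_inner_add_left[OF L2s(3,4,5)] l2_inner_scale_left
    using assms(5,6) \<phi> by (simp add: is_weak_partial_deriv_iff)
qed

section \<open>The spaces of weakly differentiable vector fields\<close>

lemma H1_L2: "u \<in> H1 \<Omega> \<Longrightarrow> u \<in> L2 \<Omega>"
  by (simp add: H1_def)

lemma H1_weak_partial_deriv:
  assumes "u \<in> H1 \<Omega>"
  shows "weak_partial_deriv \<Omega> i (\<lambda>x. vec_nth (u x) k) \<in> L2 \<Omega>"
    "is_weak_partial_deriv \<Omega> i (\<lambda>x. vec_nth (u x) k) (weak_partial_deriv \<Omega> i (\<lambda>x. vec_nth (u x) k))"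
proof -
  have "\<exists>g. g \<in> L2 \<Omega> \<and> is_weak_partial_deriv \<Omega> i (\<lambda>x. vec_nth (u x) k) g"
    using assms by (auto simp: H1_def)
  from someI_ex[OF this] show "weak_partial_deriv \<Omega> i (\<lambda>x. vec_nth (u x) k) \<in> L2 \<Omega>"
    "is_weak_partial_deriv \<Omega> i (\<lambda>x. vec_nth (u x) k) (weak_partial_deriv \<Omega> i (\<lambda>x. vec_nth (u x) k))"
    by (simp_all add: weak_partial_deriv_def)
qed

lemma weak_grad_L2: "u \<in> H1 \<Omega> \<Longrightarrow> weak_grad \<Omega> u \<in> L2 \<Omega>"
  by (intro L2_vec) (simp add: weak_grad_def H1_weak_partial_deriv)

text \<open>
  The weak gradient is an arbitrary choice of representatives. Any matrix field whose entries are
  weak derivatives agrees with it almost everywhere, which is how it is computed below.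
\<close>

lemma H1_weak_grad_AE_I:
  assumes u: "u \<in> L2 \<Omega>"
    and G: "\<And>k i. (\<lambda>x. vec_nth (vec_nth (G x) k) i) \<in> L2 \<Omega>"
      "\<And>k i. is_weak_partial_deriv \<Omega> i (\<lambda>x. vec_nth (u x) k) (\<lambda>x. vec_nth (vec_nth (G x) k) i)"
  shows "u \<in> H1 \<Omega>" "AE x in lebesgue_on \<Omega>. weak_grad \<Omega> u x = G x"
proof -
  show H: "u \<in> H1 \<Omega>" unfolding H1_def using assms by blast
  have "AE x in lebesgue_on \<Omega>. weak_partial_deriv \<Omega> i (\<lambda>x. vec_nth (u x) k) x = vec_nth (vec_nth (G x) k) i" for k i
    using H1_weak_partial_deriv[OF H] G by (intro weak_partial_deriv_unique)
  then have "AE x in lebesgue_on \<Omega>. \<forall>k i. weak_partial_deriv \<Omega> i (\<lambda>x. vec_nth (u x) k) x = vec_nth (vec_nth (G x) k) i"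
    by (intro eventually_all_finite) auto
  then show "AE x in lebesgue_on \<Omega>. weak_grad \<Omega> u x = G x"
    by eventually_elim (simp add: weak_grad_def Finite_Cartesian_Product.vec_eq_iff)
qed

lemma
  assumes u: "u \<in> H1 \<Omega>" and v: "v \<in> H1 \<Omega>"
  shows H1_linear: "(\<lambda>x. a *\<^sub>R u x + b *\<^sub>R v x) \<in> H1 \<Omega>"
    and weak_grad_linear:
      "AE x in lebesgue_on \<Omega>. weak_grad \<Omega> (\<lambda>x. a *\<^sub>R u x + b *\<^sub>R v x) x = a *\<^sub>R weak_grad \<Omega> u x + b *\<^sub>R weak_grad \<Omega> v x"
proof -
  have *: "(\<lambda>x. vec_nth (vec_nth (a *\<^sub>R weak_grad \<Omega> u x + b *\<^sub>R weak_grad \<Omega> v x) k) i) \<in> L2 \<Omega>"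
    "is_weak_partial_deriv \<Omega> i (\<lambda>x. vec_nth (a *\<^sub>R u x + b *\<^sub>R v x) k)
      (\<lambda>x. vec_nth (vec_nth (a *\<^sub>R weak_grad \<Omega> u x + b *\<^sub>R weak_grad \<Omega> v x) k) i)" for k i
  proof -
    have "(\<lambda>x. vec_nth (vec_nth (a *\<^sub>R weak_grad \<Omega> u x + b *\<^sub>R weak_grad \<Omega> v x) k) i)
      = (\<lambda>x. a *\<^sub>R weak_partial_deriv \<Omega> i (\<lambda>x. vec_nth (u x) k) x + b *\<^sub>R weak_partial_deriv \<Omega> i (\<lambda>x. vec_nth (v x) k) x)"
      by (simp add: weak_grad_def)
    moreover have "(\<lambda>x. vec_nth (a *\<^sub>R u x + b *\<^sub>R v x) k) = (\<lambda>x. a *\<^sub>R vec_nth (u x) k + b *\<^sub>R vec_nth (v x) k)"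
      by simp
    ultimately show "(\<lambda>x. vec_nth (vec_nth (a *\<^sub>R weak_grad \<Omega> u x + b *\<^sub>R weak_grad \<Omega> v x) k) i) \<in> L2 \<Omega>"
      "is_weak_partial_deriv \<Omega> i (\<lambda>x. vec_nth (a *\<^sub>R u x + b *\<^sub>R v x) k)
        (\<lambda>x. vec_nth (vec_nth (a *\<^sub>R weak_grad \<Omega> u x + b *\<^sub>R weak_grad \<Omega> v x) k) i)"
      using H1_weak_partial_deriv[OF u] H1_weak_partial_deriv[OF v] L2_comp[OF H1_L2[OF u]] L2_comp[OF H1_L2[OF v]]
      by (simp_all only:) (intro L2_add L2_scale is_weak_partial_deriv_linear | assumption)+
  qed
  have "(\<lambda>x. a *\<^sub>R u x + b *\<^sub>R v x) \<in> L2 \<Omega>" using u v by (intro L2_add L2_scale H1_L2)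
  from H1_weak_grad_AE_I[OF this *]
  show "(\<lambda>x. a *\<^sub>R u x + b *\<^sub>R v x) \<in> H1 \<Omega>"
    "AE x in lebesgue_on \<Omega>. weak_grad \<Omega> (\<lambda>x. a *\<^sub>R u x + b *\<^sub>R v x) x = a *\<^sub>R weak_grad \<Omega> u x + b *\<^sub>R weak_grad \<Omega> v x" .
qed

lemma H1_diff: "u \<in> H1 \<Omega> \<Longrightarrow> v \<in> H1 \<Omega> \<Longrightarrow> (\<lambda>x. u x - v x) \<in> H1 \<Omega>"
  using H1_linear[of u v 1 "-1"] by simp

lemma weak_grad_diff:
  assumes "u \<in> H1 \<Omega>" "v \<in> H1 \<Omega>"
  shows "AE x in lebesgue_on \<Omega>. weak_grad \<Omega> (\<lambda>x. u x - v x) x = weak_grad \<Omega> u x - weak_grad \<Omega> v x"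
  using weak_grad_linear[OF assms, of 1 "-1"] by simp

lemma h1_norm_sq: "(h1_norm \<Omega> u)\<^sup>2 = (l2_norm \<Omega> u)\<^sup>2 + (l2_norm \<Omega> (weak_grad \<Omega> u))\<^sup>2"
  unfolding h1_norm_def h1_inner_def l2_norm_sq
  by (subst real_sqrt_pow2) (simp_all add: l2_inner_self_nonneg l2_inner_def[of _ "weak_grad \<Omega> u"])

lemma h1_norm_eq: "h1_norm \<Omega> u = sqrt ((l2_norm \<Omega> u)\<^sup>2 + (l2_norm \<Omega> (weak_grad \<Omega> u))\<^sup>2)"
  unfolding h1_norm_def h1_inner_def l2_norm_sq by (simp add: l2_inner_def[of _ "weak_grad \<Omega> u"])

lemma h1_norm_nonneg [simp]: "0 \<le> h1_norm \<Omega> u"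
  by (simp add: h1_norm_eq)

lemma l2_norm_le_h1_norm: "l2_norm \<Omega> u \<le> h1_norm \<Omega> u" "l2_norm \<Omega> (weak_grad \<Omega> u) \<le> h1_norm \<Omega> u"
  unfolding h1_norm_eq by (intro real_le_rsqrt; simp)+

lemma h1_norm_linear_le:
  assumes u: "u \<in> H1 \<Omega>" and v: "v \<in> H1 \<Omega>"
  shows "h1_norm \<Omega> (\<lambda>x. a *\<^sub>R u x + b *\<^sub>R v x) \<le> \<bar>a\<bar> * h1_norm \<Omega> u + \<bar>b\<bar> * h1_norm \<Omega> v"
proof -
  let ?w = "\<lambda>x. a *\<^sub>R u x + b *\<^sub>R v x"
  have 1: "l2_norm \<Omega> ?w \<le> \<bar>a\<bar> * l2_norm \<Omega> u + \<bar>b\<bar> * l2_norm \<Omega> v"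
    using l2_norm_triangle[OF L2_scale[OF H1_L2[OF u]] L2_scale[OF H1_L2[OF v]], of a b]
    by (simp add: l2_norm_scale)
  note U = L2_scale[OF weak_grad_L2[OF u], of a] and V = L2_scale[OF weak_grad_L2[OF v], of b]
  have "l2_norm \<Omega> (weak_grad \<Omega> ?w) = l2_norm \<Omega> (\<lambda>x. a *\<^sub>R weak_grad \<Omega> u x + b *\<^sub>R weak_grad \<Omega> v x)"
    by (rule l2_norm_cong_AE[OF weak_grad_L2[OF H1_linear[OF u v]] L2_add[OF U V] weak_grad_linear[OF u v]])
  then have 2: "l2_norm \<Omega> (weak_grad \<Omega> ?w) \<le> \<bar>a\<bar> * l2_norm \<Omega> (weak_grad \<Omega> u) + \<bar>b\<bar> * l2_norm \<Omega> (weak_grad \<Omega> v)"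
    using l2_norm_triangle[OF U V] by (simp add: l2_norm_scale)
  have "h1_norm \<Omega> ?w \<le> sqrt ((\<bar>a\<bar> * l2_norm \<Omega> u + \<bar>b\<bar> * l2_norm \<Omega> v)\<^sup>2
      + (\<bar>a\<bar> * l2_norm \<Omega> (weak_grad \<Omega> u) + \<bar>b\<bar> * l2_norm \<Omega> (weak_grad \<Omega> v))\<^sup>2)"
    unfolding h1_norm_eq by (intro real_sqrt_le_mono add_mono power_mono 1 2) auto
  also have "\<dots> \<le> sqrt ((\<bar>a\<bar> * l2_norm \<Omega> u)\<^sup>2 + (\<bar>a\<bar> * l2_norm \<Omega> (weak_grad \<Omega> u))\<^sup>2)
      + sqrt ((\<bar>b\<bar> * l2_norm \<Omega> v)\<^sup>2 + (\<bar>b\<bar> * l2_norm \<Omega> (weak_grad \<Omega> v))\<^sup>2)"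
    by (rule real_sqrt_sum_squares_triangle_ineq)
  also have "\<dots> = \<bar>a\<bar> * h1_norm \<Omega> u + \<bar>b\<bar> * h1_norm \<Omega> v"
    by (simp add: h1_norm_eq power_mult_distrib distrib_left[symmetric] real_sqrt_mult)
  finally show ?thesis .
qed

definition test_field :: "vector_field \<Rightarrow> bool" where
  "test_field \<phi> \<longleftrightarrow> (\<forall>k. (\<lambda>x. vec_nth (\<phi> x) k) \<in> test_functions \<Omega>)"

lemma
  assumes "test_field \<phi>"
  shows test_field_H1: "\<phi> \<in> H1 \<Omega>"
    and test_field_weak_grad: "AE x in lebesgue_on \<Omega>. weak_grad \<Omega> \<phi> x = (\<chi> k i. partial_deriv i (\<lambda>x. vec_nth (\<phi> x) k) x)"
    and test_field_grad_L2: "(\<lambda>x. \<chi> k i. partial_deriv i (\<lambda>x. vec_nth (\<phi> x) k) x) \<in> L2 \<Omega>"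
proof -
  have t: "(\<lambda>x. vec_nth (\<phi> x) k) \<in> test_functions \<Omega>" for k using assms by (simp add: test_field_def)
  have \<phi>: "\<phi> \<in> L2 \<Omega>" by (intro L2_vec test_L2 t)
  have d: "(\<lambda>x. vec_nth (vec_nth (\<chi> k i. partial_deriv i (\<lambda>x. vec_nth (\<phi> x) k) x) k) i) \<in> L2 \<Omega>" for k i
    using test_L2[OF test_functions_partial_deriv[OF t]] by simp
  have w: "is_weak_partial_deriv \<Omega> i (\<lambda>x. vec_nth (\<phi> x) k)
      (\<lambda>x. vec_nth (vec_nth (\<chi> k i. partial_deriv i (\<lambda>x. vec_nth (\<phi> x) k) x) k) i)" for k i
    using integration_by_parts[OF open_\<Omega> t] by (simp add: is_weak_partial_deriv_iff)
  show "\<phi> \<in> H1 \<Omega>" "AE x in lebesgue_on \<Omega>. weak_grad \<Omega> \<phi> x = (\<chi> k i. partial_deriv i (\<lambda>x. vec_nth (\<phi> x) k) x)"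
    by (rule H1_weak_grad_AE_I[OF \<phi> d w])+
  show "(\<lambda>x. \<chi> k i. partial_deriv i (\<lambda>x. vec_nth (\<phi> x) k) x) \<in> L2 \<Omega>"
    using d by (intro L2_vec) auto
qed

lemma test_field_linear:
  "test_field \<phi> \<Longrightarrow> test_field \<psi> \<Longrightarrow> test_field (\<lambda>x. a *\<^sub>R \<phi> x + b *\<^sub>R \<psi> x)"
  by (auto simp: test_field_def intro!: test_functions_linear)

lemma H10_approx:
  assumes "u \<in> H10 \<Omega>" "0 < e"
  obtains \<phi> where "test_field \<phi>" "h1_norm \<Omega> (\<lambda>x. u x - \<phi> x) < e"
  using assms unfolding H10_def test_field_def by blast

lemma H10_H1: "u \<in> H10 \<Omega> \<Longrightarrow> u \<in> H1 \<Omega>"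
  by (simp add: H10_def)

lemma H10_linear:
  assumes u: "u \<in> H10 \<Omega>" and v: "v \<in> H10 \<Omega>"
  shows "(\<lambda>x. a *\<^sub>R u x + b *\<^sub>R v x) \<in> H10 \<Omega>"
proof -
  have "\<exists>\<phi>. test_field \<phi> \<and> h1_norm \<Omega> (\<lambda>x. a *\<^sub>R u x + b *\<^sub>R v x - \<phi> x) < e" if "0 < e" for e
  proof -
    define d where "d = e / (\<bar>a\<bar> + \<bar>b\<bar> + 1)"
    have d: "0 < d" using that by (simp add: d_def)
    obtain \<phi> where \<phi>: "test_field \<phi>" "h1_norm \<Omega> (\<lambda>x. u x - \<phi> x) < d" by (rule H10_approx[OF u d])
    obtain \<psi> where \<psi>: "test_field \<psi>" "h1_norm \<Omega> (\<lambda>x. v x - \<psi> x) < d" by (rule H10_approx[OF v d])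
    have "h1_norm \<Omega> (\<lambda>x. a *\<^sub>R (u x - \<phi> x) + b *\<^sub>R (v x - \<psi> x))
        \<le> \<bar>a\<bar> * h1_norm \<Omega> (\<lambda>x. u x - \<phi> x) + \<bar>b\<bar> * h1_norm \<Omega> (\<lambda>x. v x - \<psi> x)"
      by (intro h1_norm_linear_le H1_diff H10_H1 u v test_field_H1 \<phi>(1) \<psi>(1))
    also have "\<dots> \<le> \<bar>a\<bar> * d + \<bar>b\<bar> * d"
      using \<phi>(2) \<psi>(2) by (intro add_mono mult_left_mono) auto
    also have "\<dots> < (\<bar>a\<bar> + \<bar>b\<bar> + 1) * d" using d by (simp add: algebra_simps)
    also have "\<dots> = e" by (simp add: d_def add_nonneg_eq_0_iff)
    finally have "h1_norm \<Omega> (\<lambda>x. a *\<^sub>R u x + b *\<^sub>R v x - (a *\<^sub>R \<phi> x + b *\<^sub>R \<psi> x)) < e"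
      by (simp add: algebra_simps)
    then show ?thesis using test_field_linear[OF \<phi>(1) \<psi>(1)] by blast
  qed
  then show ?thesis
    using H1_linear[OF H10_H1[OF u] H10_H1[OF v]] by (simp add: H10_def test_field_def)
qed

lemma H10_zero [simp]: "(\<lambda>x. 0) \<in> H10 \<Omega>"
proof -
  have 0: "(\<lambda>x. 0) \<in> test_functions \<Omega>"
    unfolding test_functions_iff by (auto intro: k_times_cont_diff_const exI[of _ "{}"])
  then have "test_field (\<lambda>x. 0)" by (simp add: test_field_def)
  moreover have "h1_norm \<Omega> (\<lambda>x. 0) = 0"
    using h1_norm_linear_le[OF test_field_H1[OF calculation] test_field_H1[OF calculation], of 0 0]
      h1_norm_nonneg[of "\<lambda>x. 0"] by simp
  ultimately show ?thesis
    unfolding H10_def using test_field_H1 0 by (auto simp: zero_vec_def intro!: exI[of _ "\<lambda>x. 0"])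
qed

lemma H10_diff: "u \<in> H10 \<Omega> \<Longrightarrow> v \<in> H10 \<Omega> \<Longrightarrow> (\<lambda>x. u x - v x) \<in> H10 \<Omega>"
  using H10_linear[of u v 1 "-1"] by simp

section \<open>The inequalities of Ladyzhenskaya and Korn\<close>

text \<open>
  The scalar inequality is applied to both components, and the products of component norms are added
  up by the Cauchy-Schwarz inequality in the plane.
\<close>

lemma ladyzhenskaya_test_field:
  assumes "test_field \<phi>"
  shows "(\<lambda>x. (norm (\<phi> x))\<^sup>2) \<in> L2 \<Omega>"
    and "l2_norm \<Omega> (\<lambda>x. (norm (\<phi> x))\<^sup>2) \<le> 2 * l2_norm \<Omega> \<phi> * l2_norm \<Omega> (weak_grad \<Omega> \<phi>)"
proof -
  let ?c = "\<lambda>k x. vec_nth (\<phi> x) k"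
  let ?G = "\<lambda>x. \<chi> k i. partial_deriv i (?c k) x"
  have t: "?c k \<in> test_functions \<Omega>" for k using assms by (simp add: test_field_def)
  define a where "a k = l2_norm \<Omega> (?c k)" for k
  define g where "g k = l2_norm \<Omega> (\<lambda>x. vec_nth (?G x) k)" for k
  have row: "(\<lambda>x. vec_nth (?G x) k) \<in> L2 \<Omega>" for k
    by (rule L2_comp[OF test_field_grad_L2[OF assms]])
  have g: "(g k)\<^sup>2 = (l2_norm \<Omega> (partial_deriv 1 (?c k)))\<^sup>2 + (l2_norm \<Omega> (partial_deriv 2 (?c k)))\<^sup>2" for k
    using l2_inner_vec[OF row row, of k k] by (simp add: g_def l2_norm_sq sum_2)
  have L2c: "(\<lambda>x. (?c k x)\<^sup>2) \<in> L2 \<Omega>" for k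
    using test_L2[OF test_functions_mult[OF t t], of k k] by (simp add: power2_eq_square)
  have comp: "l2_norm \<Omega> (\<lambda>x. (?c k x)\<^sup>2) \<le> 2 * (a k * g k)" for k
  proof (rule power2_le_imp_le)
    let ?p = "l2_norm \<Omega> (partial_deriv 1 (?c k))" and ?q = "l2_norm \<Omega> (partial_deriv 2 (?c k))"
    have "(l2_norm \<Omega> (\<lambda>x. (?c k x)\<^sup>2))\<^sup>2 \<le> 4 * (a k)\<^sup>2 * (?p * ?q)"
      unfolding a_def by (rule ladyzhenskaya_test_functions[OF open_\<Omega> t])
    also have "?p * ?q \<le> (g k)\<^sup>2"
      using sum_squares_bound[of ?p ?q] l2_norm_nonneg[of \<Omega> "partial_deriv 1 (?c k)"]
        l2_norm_nonneg[of \<Omega> "partial_deriv 2 (?c k)"] mult_nonneg_nonneg[of ?p ?q]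
      unfolding g by linarith
    finally show "(l2_norm \<Omega> (\<lambda>x. (?c k x)\<^sup>2))\<^sup>2 \<le> (2 * (a k * g k))\<^sup>2"
      by (simp add: power_mult_distrib mult_left_mono)
  qed (simp add: a_def g_def)
  have split: "(\<lambda>x. (norm (\<phi> x))\<^sup>2) = (\<lambda>x. (?c 1 x)\<^sup>2 + (?c 2 x)\<^sup>2)"
    unfolding power2_norm_eq_inner inner_vec_def sum_2 by (simp add: power2_eq_square)
  show "(\<lambda>x. (norm (\<phi> x))\<^sup>2) \<in> L2 \<Omega>" unfolding split by (intro L2_add L2c)
  have "l2_norm \<Omega> (\<lambda>x. (norm (\<phi> x))\<^sup>2) \<le> 2 * (a 1 * g 1) + 2 * (a 2 * g 2)"
    unfolding split using l2_norm_triangle[OF L2c L2c, of 1 2] comp[of 1] comp[of 2] by linarith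
  also have "\<dots> \<le> 2 * (l2_norm \<Omega> \<phi> * l2_norm \<Omega> (weak_grad \<Omega> \<phi>))"
  proof -
    have "(a 1 * g 1 + a 2 * g 2)\<^sup>2 \<le> ((a 1)\<^sup>2 + (a 2)\<^sup>2) * ((g 1)\<^sup>2 + (g 2)\<^sup>2)"
      using zero_le_power2[of "a 1 * g 2 - a 2 * g 1"] by (simp add: power2_eq_square algebra_simps)
    also have "(a 1)\<^sup>2 + (a 2)\<^sup>2 = (l2_norm \<Omega> \<phi>)\<^sup>2"
      using l2_inner_vec[OF H1_L2 H1_L2, OF test_field_H1 test_field_H1, OF assms assms]
      by (simp add: a_def l2_norm_sq sum_2)
    also have "(g 1)\<^sup>2 + (g 2)\<^sup>2 = (l2_norm \<Omega> (weak_grad \<Omega> \<phi>))\<^sup>2"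
      using l2_inner_vec[OF test_field_grad_L2 test_field_grad_L2, OF assms assms]
        l2_norm_cong_AE[OF weak_grad_L2[OF test_field_H1] test_field_grad_L2 test_field_weak_grad, OF assms assms assms]
      by (simp add: g_def l2_norm_sq sum_2)
    finally have "(a 1 * g 1 + a 2 * g 2)\<^sup>2 \<le> (l2_norm \<Omega> \<phi> * l2_norm \<Omega> (weak_grad \<Omega> \<phi>))\<^sup>2"
      by (simp add: power_mult_distrib)
    then have "a 1 * g 1 + a 2 * g 2 \<le> l2_norm \<Omega> \<phi> * l2_norm \<Omega> (weak_grad \<Omega> \<phi>)"
      by (rule power2_le_imp_le) simp
    then show ?thesis by simp
  qed
  finally show "l2_norm \<Omega> (\<lambda>x. (norm (\<phi> x))\<^sup>2) \<le> 2 * l2_norm \<Omega> \<phi> * l2_norm \<Omega> (weak_grad \<Omega> \<phi>)"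
    by simp
qed

text \<open>
  The inequality passes to the closure by Fatou's lemma along a subsequence that converges almost
  everywhere.
\<close>

theorem ladyzhenskaya:
  assumes u: "u \<in> H10 \<Omega>"
  shows "(\<lambda>x. (norm (u x))\<^sup>2) \<in> L2 \<Omega>"
    and "l2_norm \<Omega> (\<lambda>x. (norm (u x))\<^sup>2) \<le> 2 * l2_norm \<Omega> u * l2_norm \<Omega> (weak_grad \<Omega> u)"
proof -
  have uH: "u \<in> H1 \<Omega>" and uL: "u \<in> L2 \<Omega>" using u by (simp_all add: H10_H1 H1_L2)
  have "\<exists>\<phi>. test_field \<phi> \<and> h1_norm \<Omega> (\<lambda>x. u x - \<phi> x) < 1 / real (Suc n)" for n
    by (rule H10_approx[OF u, of "1 / real (Suc n)"]) auto
  then obtain \<phi> where \<phi>: "\<And>n. test_field (\<phi> n)" "\<And>n. h1_norm \<Omega> (\<lambda>x. u x - \<phi> n x) < 1 / real (Suc n)"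
    by metis
  have \<phi>H: "\<phi> n \<in> H1 \<Omega>" and \<phi>L: "\<phi> n \<in> L2 \<Omega>" for n using test_field_H1[OF \<phi>(1)] by (simp_all add: H1_L2)
  have null: "(\<lambda>n. 1 / real (Suc n)) \<longlonglongrightarrow> 0" by (rule LIMSEQ_Suc[OF lim_1_over_n])
  have "l2_norm \<Omega> (\<lambda>x. u x - \<phi> n x) \<le> 1 / real (Suc n)" for n
    using l2_norm_le_h1_norm(1)[of "\<lambda>x. u x - \<phi> n x"] \<phi>(2)[of n] by linarith
  then have d0: "(\<lambda>n. l2_norm \<Omega> (\<lambda>x. u x - \<phi> n x)) \<longlonglongrightarrow> 0"
    by (intro tendsto_sandwich[OF _ _ tendsto_const null] always_eventually allI) simp_all
  have grad_diff: "l2_norm \<Omega> (\<lambda>x. weak_grad \<Omega> u x - weak_grad \<Omega> (\<phi> n) x) \<le> 1 / real (Suc n)" for n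
  proof -
    have "l2_norm \<Omega> (\<lambda>x. weak_grad \<Omega> u x - weak_grad \<Omega> (\<phi> n) x) = l2_norm \<Omega> (weak_grad \<Omega> (\<lambda>x. u x - \<phi> n x))"
      by (rule l2_norm_cong_AE[symmetric, OF weak_grad_L2[OF H1_diff[OF uH \<phi>H]]
            L2_diff[OF weak_grad_L2[OF uH] weak_grad_L2[OF \<phi>H]] weak_grad_diff[OF uH \<phi>H]])
    then show ?thesis using l2_norm_le_h1_norm(2)[of "\<lambda>x. u x - \<phi> n x"] \<phi>(2)[of n] by simp
  qed
  have Elim: "(\<lambda>n. l2_norm \<Omega> (\<phi> n)) \<longlonglongrightarrow> l2_norm \<Omega> u"
  proof (rule Lim_null[THEN iffD2], rule Lim_null_comparison[OF _ d0], rule always_eventually, rule allI)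
    fix n
    show "norm (l2_norm \<Omega> (\<phi> n) - l2_norm \<Omega> u) \<le> l2_norm \<Omega> (\<lambda>x. u x - \<phi> n x)"
      using l2_norm_triangle_diff[OF uL \<phi>L[of n]] l2_norm_triangle_diff[OF \<phi>L[of n] uL]
        l2_norm_minus_commute[of \<Omega> u "\<phi> n"] by (simp add: abs_le_iff)
  qed
  have Glim: "(\<lambda>n. l2_norm \<Omega> (weak_grad \<Omega> (\<phi> n))) \<longlonglongrightarrow> l2_norm \<Omega> (weak_grad \<Omega> u)"
  proof (rule Lim_null[THEN iffD2], rule Lim_null_comparison[OF _ null], rule always_eventually, rule allI)
    fix n
    show "norm (l2_norm \<Omega> (weak_grad \<Omega> (\<phi> n)) - l2_norm \<Omega> (weak_grad \<Omega> u)) \<le> 1 / real (Suc n)"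
      using l2_norm_triangle_diff[OF weak_grad_L2[OF uH] weak_grad_L2[OF \<phi>H[of n]]]
        l2_norm_triangle_diff[OF weak_grad_L2[OF \<phi>H[of n]] weak_grad_L2[OF uH]]
        l2_norm_minus_commute[of \<Omega> "weak_grad \<Omega> u" "weak_grad \<Omega> (\<phi> n)"] grad_diff[of n]
      by (simp add: abs_le_iff)
  qed
  have "(\<lambda>n. (l2_norm \<Omega> (\<lambda>x. u x - \<phi> n x))\<^sup>2) \<longlonglongrightarrow> 0\<^sup>2" by (intro tendsto_power d0)
  then have "(\<lambda>n. LINT x|lebesgue_on \<Omega>. norm ((norm (u x - \<phi> n x))\<^sup>2)) \<longlonglongrightarrow> 0"
    by (simp add: l2_norm_sq l2_inner_def power2_norm_eq_inner)
  moreover have "integrable (lebesgue_on \<Omega>) (\<lambda>x. (norm (u x - \<phi> n x))\<^sup>2)" for n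
    using L2_diff[OF uL \<phi>L[of n]] by (simp add: L2_def)
  ultimately obtain r where r: "strict_mono r"
    and ae: "AE x in lebesgue_on \<Omega>. (\<lambda>n. (norm (u x - \<phi> (r n) x))\<^sup>2) \<longlonglongrightarrow> 0"
    using tendsto_L1_AE_subseq[of "lebesgue_on \<Omega>" "\<lambda>n x. (norm (u x - \<phi> n x))\<^sup>2"] by blast
  define q where "q v x = ennreal (((norm (v x))\<^sup>2)\<^sup>2)" for v :: vector_field and x
  define bnd where "bnd n = 2 * l2_norm \<Omega> (\<phi> n) * l2_norm \<Omega> (weak_grad \<Omega> (\<phi> n))" for n
  have "AE x in lebesgue_on \<Omega>. (\<lambda>n. q (\<phi> (r n)) x) \<longlonglongrightarrow> q u x"
    using ae
  proof eventually_elim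
    case (elim x)
    have "(\<lambda>n. sqrt ((norm (u x - \<phi> (r n) x))\<^sup>2)) \<longlonglongrightarrow> sqrt 0"
      by (intro tendsto_real_sqrt elim)
    then have "(\<lambda>n. norm (\<phi> (r n) x - u x)) \<longlonglongrightarrow> 0" by (simp add: norm_minus_commute)
    then have "(\<lambda>n. \<phi> (r n) x) \<longlonglongrightarrow> u x" by (simp add: Lim_null[of _ "u x"] tendsto_norm_zero_iff)
    then show ?case unfolding q_def by (intro tendsto_ennrealI tendsto_power tendsto_norm)
  qed
  then have "(\<integral>\<^sup>+x. q u x \<partial>lebesgue_on \<Omega>) = (\<integral>\<^sup>+x. liminf (\<lambda>n. q (\<phi> (r n)) x) \<partial>lebesgue_on \<Omega>)"
    by (intro nn_integral_cong_AE) (auto elim!: eventually_mono simp: lim_imp_Liminf)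
  also have "\<dots> \<le> liminf (\<lambda>n. \<integral>\<^sup>+x. q (\<phi> (r n)) x \<partial>lebesgue_on \<Omega>)"
  proof (rule nn_integral_liminf)
    show "q (\<phi> (r n)) \<in> borel_measurable (lebesgue_on \<Omega>)" for n
      unfolding q_def[abs_def] using L2_measurable[OF \<phi>L] by measurable
  qed
  also have "\<dots> \<le> liminf (\<lambda>n. ennreal ((bnd (r n))\<^sup>2))"
  proof (intro Liminf_mono always_eventually allI)
    fix n
    have "(\<integral>\<^sup>+x. q (\<phi> (r n)) x \<partial>lebesgue_on \<Omega>) = ennreal ((l2_norm \<Omega> (\<lambda>x. (norm (\<phi> (r n) x))\<^sup>2))\<^sup>2)"
      using ladyzhenskaya_test_field(1)[OF \<phi>(1), of "r n"]
      unfolding q_def l2_norm_sq l2_inner_def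
      by (subst nn_integral_eq_integral) (auto simp: L2_def power2_eq_square)
    also have "\<dots> \<le> ennreal ((bnd (r n))\<^sup>2)"
      unfolding bnd_def by (intro ennreal_leI power_mono ladyzhenskaya_test_field \<phi>(1)) auto
    finally show "(\<integral>\<^sup>+x. q (\<phi> (r n)) x \<partial>lebesgue_on \<Omega>) \<le> ennreal ((bnd (r n))\<^sup>2)" .
  qed
  also have "\<dots> = ennreal ((2 * l2_norm \<Omega> u * l2_norm \<Omega> (weak_grad \<Omega> u))\<^sup>2)"
  proof (rule lim_imp_Liminf)
    have "(\<lambda>n. bnd (r n)) \<longlonglongrightarrow> 2 * l2_norm \<Omega> u * l2_norm \<Omega> (weak_grad \<Omega> u)"
      unfolding bnd_def using LIMSEQ_subseq_LIMSEQ[OF Elim r] LIMSEQ_subseq_LIMSEQ[OF Glim r]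
      by (intro tendsto_mult tendsto_const) (auto simp: o_def)
    then show "(\<lambda>n. ennreal ((bnd (r n))\<^sup>2)) \<longlonglongrightarrow> ennreal ((2 * l2_norm \<Omega> u * l2_norm \<Omega> (weak_grad \<Omega> u))\<^sup>2)"
      by (intro tendsto_ennrealI tendsto_power)
  qed simp
  finally have bound: "(\<integral>\<^sup>+x. q u x \<partial>lebesgue_on \<Omega>) \<le> ennreal ((2 * l2_norm \<Omega> u * l2_norm \<Omega> (weak_grad \<Omega> u))\<^sup>2)" .
  have meas: "(\<lambda>x. (norm (u x))\<^sup>2) \<in> borel_measurable (lebesgue_on \<Omega>)"
    using L2_measurable[OF uL] by measurable
  have int: "integrable (lebesgue_on \<Omega>) (\<lambda>x. ((norm (u x))\<^sup>2)\<^sup>2)"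
  proof (rule integrableI_bounded[OF borel_measurable_power[OF meas]])
    have "(\<integral>\<^sup>+x. ennreal (norm (((norm (u x))\<^sup>2)\<^sup>2)) \<partial>lebesgue_on \<Omega>) = (\<integral>\<^sup>+x. q u x \<partial>lebesgue_on \<Omega>)"
      by (simp add: q_def)
    also note bound
    also have "ennreal ((2 * l2_norm \<Omega> u * l2_norm \<Omega> (weak_grad \<Omega> u))\<^sup>2) < \<infinity>" by simp
    finally show "(\<integral>\<^sup>+x. ennreal (norm (((norm (u x))\<^sup>2)\<^sup>2)) \<partial>lebesgue_on \<Omega>) < \<infinity>" .
  qed
  then show L4: "(\<lambda>x. (norm (u x))\<^sup>2) \<in> L2 \<Omega>"
    using meas by (simp add: L2_def)
  have "ennreal ((l2_norm \<Omega> (\<lambda>x. (norm (u x))\<^sup>2))\<^sup>2) = (\<integral>\<^sup>+x. q u x \<partial>lebesgue_on \<Omega>)"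
    unfolding q_def l2_norm_sq l2_inner_def
    using int by (subst nn_integral_eq_integral) (auto simp: power2_eq_square)
  with bound have "ennreal ((l2_norm \<Omega> (\<lambda>x. (norm (u x))\<^sup>2))\<^sup>2)
      \<le> ennreal ((2 * l2_norm \<Omega> u * l2_norm \<Omega> (weak_grad \<Omega> u))\<^sup>2)"
    by (simp only:)
  then have "(l2_norm \<Omega> (\<lambda>x. (norm (u x))\<^sup>2))\<^sup>2 \<le> (2 * l2_norm \<Omega> u * l2_norm \<Omega> (weak_grad \<Omega> u))\<^sup>2"
    by (subst (asm) ennreal_le_iff) (rule zero_le_power2)
  then show "l2_norm \<Omega> (\<lambda>x. (norm (u x))\<^sup>2) \<le> 2 * l2_norm \<Omega> u * l2_norm \<Omega> (weak_grad \<Omega> u)"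
    by (rule power2_le_imp_le) simp
qed

definition sym_part :: "real ^ 2 ^ 2 \<Rightarrow> real ^ 2 ^ 2" where
  "sym_part A = (1 / 2) *\<^sub>R (A + Finite_Cartesian_Product.transpose A)"

lemma sym_grad_eq: "sym_grad \<Omega> u x = sym_part (weak_grad \<Omega> u x)"
  by (simp add: sym_grad_def sym_part_def)

lemma linear_sym_part: "linear sym_part"
  by (rule linearI) (simp_all add: sym_part_def Finite_Cartesian_Product.transpose_def
      Finite_Cartesian_Product.vec_eq_iff algebra_simps)

lemma norm_sym_part_le: "norm (sym_part A) \<le> norm A"
proof -
  have "norm (Finite_Cartesian_Product.transpose A) = norm A"
    by (simp add: norm_eq_sqrt_inner inner_vec_def Finite_Cartesian_Product.transpose_def sum_2)
  then show ?thesis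
    using norm_triangle_ineq[of A "Finite_Cartesian_Product.transpose A"] by (simp add: sym_part_def)
qed

lemma sym_part_L2:
  assumes "A \<in> L2 \<Omega>"
  shows "(\<lambda>x. sym_part (A x)) \<in> L2 \<Omega>" "l2_norm \<Omega> (\<lambda>x. sym_part (A x)) \<le> l2_norm \<Omega> A"
proof -
  show L: "(\<lambda>x. sym_part (A x)) \<in> L2 \<Omega>" by (rule L2_linear_image[OF linear_sym_part assms])
  show "l2_norm \<Omega> (\<lambda>x. sym_part (A x)) \<le> l2_norm \<Omega> A"
    by (rule L2_dominated(2)[OF L2_measurable[OF L] _ assms]) (simp add: norm_sym_part_le)
qed

text \<open>
  For smooth fields \<open>2 \<bar>\<D>\<phi>\<bar>\<^sup>2 - \<bar>\<nabla>\<phi>\<bar>\<^sup>2\<close> integrates to \<open>\<integral> (div \<phi>)\<^sup>2\<close>, since the derivatives in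
  \<open>\<integral> \<partial>\<^sub>1\<phi>\<^sub>2 \<partial>\<^sub>2\<phi>\<^sub>1\<close> may be swapped.
\<close>

lemma korn_test_field:
  assumes "test_field \<phi>"
  shows "(l2_norm \<Omega> (weak_grad \<Omega> \<phi>))\<^sup>2 \<le> 2 * (l2_norm \<Omega> (\<lambda>x. sym_part (weak_grad \<Omega> \<phi> x)))\<^sup>2"
proof -
  let ?c = "\<lambda>k x. vec_nth (\<phi> x) k"
  let ?G = "\<lambda>x. \<chi> k i. partial_deriv i (?c k) x"
  have t: "?c k \<in> test_functions \<Omega>" for k using assms by (simp add: test_field_def)
  note GL = test_field_grad_L2[OF assms] and wL = weak_grad_L2[OF test_field_H1[OF assms]]
  have dL: "partial_deriv i (?c k) \<in> L2 \<Omega>" for i k by (rule test_L2[OF test_functions_partial_deriv[OF t]])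
  define m where "m i k j l = l2_inner \<Omega> (partial_deriv i (?c k)) (partial_deriv j (?c l))" for i k j l
  have m_sym: "m i k j l = m j l i k" for i k j l by (simp add: m_def l2_inner_commute)
  have "(l2_norm \<Omega> (weak_grad \<Omega> \<phi>))\<^sup>2 = (l2_norm \<Omega> ?G)\<^sup>2"
    using l2_norm_cong_AE[OF wL GL test_field_weak_grad[OF assms]] by simp
  also have "\<dots> = m 1 1 1 1 + m 2 1 2 1 + m 1 2 1 2 + m 2 2 2 2"
    using l2_inner_vec[OF GL GL] l2_inner_vec[OF L2_comp[OF GL] L2_comp[OF GL], of 1 1]
      l2_inner_vec[OF L2_comp[OF GL] L2_comp[OF GL], of 2 2]
    by (simp add: l2_norm_sq sum_2 m_def)
  finally have grad: "(l2_norm \<Omega> (weak_grad \<Omega> \<phi>))\<^sup>2 = m 1 1 1 1 + m 2 1 2 1 + m 1 2 1 2 + m 2 2 2 2" .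
  have pointwise: "2 * inner (sym_part (?G x)) (sym_part (?G x))
      = inner (?G x) (?G x) + (partial_deriv 1 (?c 1) x)\<^sup>2 + (partial_deriv 2 (?c 2) x)\<^sup>2
        + 2 * (partial_deriv 1 (?c 2) x * partial_deriv 2 (?c 1) x)" for x
    by (simp add: sym_part_def Finite_Cartesian_Product.transpose_def inner_vec_def sum_2 power2_eq_square field_simps)
  have "2 * (l2_norm \<Omega> (\<lambda>x. sym_part (weak_grad \<Omega> \<phi> x)))\<^sup>2 = 2 * (l2_norm \<Omega> (\<lambda>x. sym_part (?G x)))\<^sup>2"
    by (subst l2_norm_cong_AE[OF sym_part_L2(1)[OF wL] sym_part_L2(1)[OF GL]])
       (use test_field_weak_grad[OF assms] in \<open>auto elim: eventually_mono\<close>)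
  also have "\<dots> = (LINT x|lebesgue_on \<Omega>. 2 * inner (sym_part (?G x)) (sym_part (?G x)))"
    by (simp add: l2_norm_sq l2_inner_def)
  also have "\<dots> = l2_inner \<Omega> ?G ?G + m 1 1 1 1 + m 2 2 2 2 + 2 * m 1 2 2 1"
    unfolding pointwise l2_inner_def m_def inner_real_def power2_eq_square
    using L2_integrable_inner[OF GL GL] L2_integrable_inner[OF dL dL]
    by (subst Bochner_Integration.integral_add, simp, simp)+ simp
  also have "m 1 2 2 1 = m 2 2 1 1"
    unfolding m_def by (rule l2_inner_partial_deriv_swap[OF open_\<Omega> t t])
  also have "l2_inner \<Omega> ?G ?G + m 1 1 1 1 + m 2 2 2 2 + 2 * m 2 2 1 1
      = (l2_norm \<Omega> (weak_grad \<Omega> \<phi>))\<^sup>2 + (l2_norm \<Omega> (\<lambda>x. partial_deriv 1 (?c 1) x + partial_deriv 2 (?c 2) x))\<^sup>2"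
    using l2_norm_cong_AE[OF wL GL test_field_weak_grad[OF assms]] m_sym[of 2 2 1 1]
    unfolding l2_norm_sq[symmetric]
    by (simp add: l2_norm_sq m_def l2_inner_add_left l2_inner_add_right L2_add dL)
  finally show ?thesis by simp
qed

text \<open>
  Both sides are continuous in the \<open>H\<^sup>1\<close> norm because taking the symmetric part does not increase the
  norm.
\<close>

theorem korn:
  assumes u: "u \<in> H10 \<Omega>"
  shows "(l2_norm \<Omega> (weak_grad \<Omega> u))\<^sup>2 \<le> 2 * (l2_norm \<Omega> (sym_grad \<Omega> u))\<^sup>2"
proof -
  have uH: "u \<in> H1 \<Omega>" using u by (rule H10_H1)
  let ?A = "weak_grad \<Omega> u"
  note AL = weak_grad_L2[OF uH]
  have "l2_norm \<Omega> ?A \<le> sqrt 2 * l2_norm \<Omega> (\<lambda>x. sym_part (?A x)) + e" if "0 < e" for e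
  proof -
    \<comment> \<open>The approximation error enters once on the left and, multiplied by \<open>sqrt 2\<close>, once on the right.\<close>
    define d where "d = e / (sqrt 2 + 1)"
    have "0 < sqrt 2 + (1 :: real)" by (simp add: add_pos_pos)
    then have d: "0 < d" "sqrt 2 * d + d = e" using that by (simp_all add: d_def field_simps)
    obtain \<phi> where \<phi>: "test_field \<phi>" "h1_norm \<Omega> (\<lambda>x. u x - \<phi> x) < d" by (rule H10_approx[OF u d(1)])
    let ?B = "weak_grad \<Omega> \<phi>"
    have \<phi>H: "\<phi> \<in> H1 \<Omega>" by (rule test_field_H1[OF \<phi>(1)])
    note BL = weak_grad_L2[OF \<phi>H]
    have "l2_norm \<Omega> (\<lambda>x. ?A x - ?B x) = l2_norm \<Omega> (weak_grad \<Omega> (\<lambda>x. u x - \<phi> x))"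
      by (rule l2_norm_cong_AE[symmetric, OF weak_grad_L2[OF H1_diff[OF uH \<phi>H]] L2_diff[OF AL BL] weak_grad_diff[OF uH \<phi>H]])
    then have AB: "l2_norm \<Omega> (\<lambda>x. ?A x - ?B x) \<le> d"
      using l2_norm_le_h1_norm(2)[of "\<lambda>x. u x - \<phi> x"] \<phi>(2) by simp
    have "l2_norm \<Omega> ?B \<le> sqrt 2 * l2_norm \<Omega> (\<lambda>x. sym_part (?B x))"
      using real_sqrt_le_mono[OF korn_test_field[OF \<phi>(1)]] by (simp add: real_sqrt_mult)
    also have "\<dots> \<le> sqrt 2 * (l2_norm \<Omega> (\<lambda>x. sym_part (?A x)) + d)"
    proof (intro mult_left_mono)
      have "l2_norm \<Omega> (\<lambda>x. sym_part (?B x))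
          \<le> l2_norm \<Omega> (\<lambda>x. sym_part (?A x)) + l2_norm \<Omega> (\<lambda>x. sym_part (?B x) - sym_part (?A x))"
        by (rule l2_norm_triangle_diff[OF sym_part_L2(1)[OF BL] sym_part_L2(1)[OF AL]])
      also have "l2_norm \<Omega> (\<lambda>x. sym_part (?B x) - sym_part (?A x)) = l2_norm \<Omega> (\<lambda>x. sym_part (?B x - ?A x))"
        by (simp add: linear_diff[OF linear_sym_part])
      also have "\<dots> \<le> d"
        using sym_part_L2(2)[OF L2_diff[OF BL AL]] AB l2_norm_minus_commute[of \<Omega> ?A ?B] by simp
      finally show "l2_norm \<Omega> (\<lambda>x. sym_part (?B x)) \<le> l2_norm \<Omega> (\<lambda>x. sym_part (?A x)) + d" by simp
    qed simp
    finally show ?thesis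
      using l2_norm_triangle_diff[OF AL BL] AB d(2) by (simp add: distrib_left)
  qed
  then have "l2_norm \<Omega> ?A \<le> sqrt 2 * l2_norm \<Omega> (\<lambda>x. sym_part (?A x))"
    by (rule field_le_epsilon)
  then have "(l2_norm \<Omega> ?A)\<^sup>2 \<le> (sqrt 2 * l2_norm \<Omega> (\<lambda>x. sym_part (?A x)))\<^sup>2"
    by (rule power_mono) simp
  then show ?thesis by (simp add: power_mult_distrib sym_grad_eq[abs_def])
qed

end

section \<open>The trilinear and the bilinear form\<close>

lemma norm_matrix_vector_mult_le: "norm (A *v x) \<le> norm A * norm x" for A :: "real ^ 'n ^ 'm"
proof (rule power2_le_imp_le)
  have "(norm (A *v x))\<^sup>2 = (\<Sum>k\<in>UNIV. (inner (vec_nth A k) x)\<^sup>2)"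
    unfolding power2_norm_eq_inner inner_vec_def matrix_vector_mult_def by (simp add: power2_eq_square)
  also have "\<dots> \<le> (\<Sum>k\<in>UNIV. (norm (vec_nth A k))\<^sup>2 * (norm x)\<^sup>2)"
    by (intro sum_mono) (simp add: Cauchy_Schwarz_ineq power2_norm_eq_inner)
  also have "\<dots> = (norm A * norm x)\<^sup>2"
    by (simp add: sum_distrib_right[symmetric] power_mult_distrib power2_norm_eq_inner[of A] inner_vec_def[of A])
       (simp add: power2_norm_eq_inner)
  finally show "(norm (A *v x))\<^sup>2 \<le> (norm A * norm x)\<^sup>2" .
qed simp

context bounded_open_set
begin

text \<open>The usual \<open>L\<^sup>4\<close> norm, written through the \<open>L\<^sup>2\<close> norm of the squared modulus.\<close>

definition l4_norm :: "vector_field \<Rightarrow> real" where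
  "l4_norm u = sqrt (l2_norm \<Omega> (\<lambda>x. (norm (u x))\<^sup>2))"

lemma l4_norm_nonneg [simp]: "0 \<le> l4_norm u"
  by (simp add: l4_norm_def)

lemma l4_norm_sq_le: "u \<in> H10 \<Omega> \<Longrightarrow> (l4_norm u)\<^sup>2 \<le> 2 * (l2_norm \<Omega> u * l2_norm \<Omega> (weak_grad \<Omega> u))"
  using ladyzhenskaya(2)[of u] by (simp add: l4_norm_def)

lemma l4_norm_le_h1_norm:
  assumes "u \<in> H10 \<Omega>"
  shows "l4_norm u \<le> h1_norm \<Omega> u"
proof (rule power2_le_imp_le)
  show "(l4_norm u)\<^sup>2 \<le> (h1_norm \<Omega> u)\<^sup>2"
    unfolding h1_norm_sq
    using l4_norm_sq_le[OF assms] sum_squares_bound[of "l2_norm \<Omega> u" "l2_norm \<Omega> (weak_grad \<Omega> u)"]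
    by (simp only: mult.assoc)
qed simp

lemma
  assumes "u \<in> H10 \<Omega>" "v \<in> H10 \<Omega>"
  shows L2_norm_mult: "(\<lambda>x. norm (u x) * norm (v x)) \<in> L2 \<Omega>"
    and l2_norm_norm_mult_le: "l2_norm \<Omega> (\<lambda>x. norm (u x) * norm (v x)) \<le> l4_norm u * l4_norm v"
proof -
  note L4 = ladyzhenskaya(1)[OF assms(1)] ladyzhenskaya(1)[OF assms(2)]
  have [measurable]: "u \<in> borel_measurable (lebesgue_on \<Omega>)" "v \<in> borel_measurable (lebesgue_on \<Omega>)"
    using assms by (auto intro!: L2_measurable H1_L2 H10_H1)
  have sq: "(norm (u x) * norm (v x)) * (norm (u x) * norm (v x)) = inner ((norm (u x))\<^sup>2) ((norm (v x))\<^sup>2)" for x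
    by (simp add: power2_eq_square)
  have "integrable (lebesgue_on \<Omega>) (\<lambda>x. (norm (u x) * norm (v x)) * (norm (u x) * norm (v x)))"
    unfolding sq by (rule L2_integrable_inner[OF L4])
  then show "(\<lambda>x. norm (u x) * norm (v x)) \<in> L2 \<Omega>"
    by (simp add: L2_def power2_eq_square)
  have "l2_inner \<Omega> (\<lambda>x. norm (u x) * norm (v x)) (\<lambda>x. norm (u x) * norm (v x))
      = l2_inner \<Omega> (\<lambda>x. (norm (u x))\<^sup>2) (\<lambda>x. (norm (v x))\<^sup>2)"
    unfolding l2_inner_def inner_real_def by (simp add: power2_eq_square mult_ac)
  also have "\<dots> \<le> l2_norm \<Omega> (\<lambda>x. (norm (u x))\<^sup>2) * l2_norm \<Omega> (\<lambda>x. (norm (v x))\<^sup>2)"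
    using l2_cauchy_schwarz[OF L4] by linarith
  finally show "l2_norm \<Omega> (\<lambda>x. norm (u x) * norm (v x)) \<le> l4_norm u * l4_norm v"
    unfolding l2_norm_def[of _ "\<lambda>x. norm (u x) * norm (v x)"] l4_norm_def real_sqrt_mult[symmetric]
    by (rule real_sqrt_le_mono)
qed

text \<open>
  Hoelder's inequality with exponents \<open>4\<close>, \<open>2\<close>, \<open>4\<close>. An arbitrary matrix field in place of a weak
  gradient allows differences of weak gradients, which are weak gradients only almost everywhere.
\<close>

lemma
  assumes "u \<in> H10 \<Omega>" "A \<in> L2 \<Omega>" "v \<in> H10 \<Omega>"
  shows trilinear_integrable: "integrable (lebesgue_on \<Omega>) (\<lambda>x. inner (A x *v u x) (v x))"
    and trilinear_bound: "\<bar>LINT x|lebesgue_on \<Omega>. inner (A x *v u x) (v x)\<bar> \<le> l2_norm \<Omega> A * (l4_norm u * l4_norm v)"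
proof -
  have L: "u \<in> L2 \<Omega>" "v \<in> L2 \<Omega>" using assms by (auto intro!: H1_L2 H10_H1)
  have "inner (A x *v u x) (v x) = (\<Sum>k\<in>UNIV. (\<Sum>i\<in>UNIV. vec_nth (vec_nth (A x) k) i * vec_nth (u x) i) * vec_nth (v x) k)" for x
    by (simp add: inner_vec_def matrix_vector_mult_def)
  then have meas: "(\<lambda>x. inner (A x *v u x) (v x)) \<in> borel_measurable (lebesgue_on \<Omega>)"
    using L2_measurable[OF L2_comp[OF L(1)]] L2_measurable[OF L2_comp[OF L(2)]]
      L2_measurable[OF L2_comp[OF L2_comp[OF assms(2)]]] by simp
  let ?s = "\<lambda>x. norm (u x) * norm (v x)"
  have int: "integrable (lebesgue_on \<Omega>) (\<lambda>x. inner (norm (A x)) (?s x))"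
    by (rule L2_integrable_inner[OF L2_norm[OF assms(2)] L2_norm_mult[OF assms(1,3)]])
  have le: "norm (inner (A x *v u x) (v x)) \<le> inner (norm (A x)) (?s x)" for x
  proof -
    have "norm (inner (A x *v u x) (v x)) \<le> norm (A x *v u x) * norm (v x)"
      using Cauchy_Schwarz_ineq2 by simp
    also have "\<dots> \<le> (norm (A x) * norm (u x)) * norm (v x)"
      by (intro mult_right_mono norm_matrix_vector_mult_le) simp
    finally show ?thesis by (simp add: mult.assoc)
  qed
  show "integrable (lebesgue_on \<Omega>) (\<lambda>x. inner (A x *v u x) (v x))"
    by (rule Bochner_Integration.integrable_bound[OF int meas])
       (intro AE_I2 order_trans[OF le], simp)
  have "\<bar>LINT x|lebesgue_on \<Omega>. inner (A x *v u x) (v x)\<bar> \<le> (LINT x|lebesgue_on \<Omega>. inner (norm (A x)) (?s x))"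
    using order_trans[OF integral_norm_bound
        integral_mono[OF integrable_norm[OF \<open>integrable _ (\<lambda>x. inner (A x *v u x) (v x))\<close>] int le]]
    by simp
  also have "\<dots> \<le> l2_norm \<Omega> (\<lambda>x. norm (A x)) * l2_norm \<Omega> ?s"
    using l2_cauchy_schwarz[OF L2_norm[OF assms(2)] L2_norm_mult[OF assms(1,3)]] by (simp add: l2_inner_def)
  also have "\<dots> \<le> l2_norm \<Omega> A * (l4_norm u * l4_norm v)"
    unfolding l2_norm_norm by (intro mult_left_mono l2_norm_norm_mult_le assms) simp
  finally show "\<bar>LINT x|lebesgue_on \<Omega>. inner (A x *v u x) (v x)\<bar> \<le> l2_norm \<Omega> A * (l4_norm u * l4_norm v)" .
qed

lemma b_form_bound:
  assumes "u \<in> H10 \<Omega>" "w \<in> H10 \<Omega>" "v \<in> H10 \<Omega>"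
  shows "\<bar>b_form \<Omega> u w v\<bar> \<le> l2_norm \<Omega> (weak_grad \<Omega> w) * (l4_norm u * l4_norm v)"
  unfolding b_form_def by (rule trilinear_bound[OF assms(1) weak_grad_L2[OF H10_H1[OF assms(2)]] assms(3)])

lemma b_form_diff:
  assumes "u \<in> H10 \<Omega>" "w \<in> H10 \<Omega>" "v \<in> H10 \<Omega>" "z \<in> H10 \<Omega>"
  shows "b_form \<Omega> (\<lambda>x. u x - z x) w v = b_form \<Omega> u w v - b_form \<Omega> z w v"
    and "b_form \<Omega> u (\<lambda>x. w x - z x) v = b_form \<Omega> u w v - b_form \<Omega> u z v"
    and "b_form \<Omega> u w (\<lambda>x. v x - z x) = b_form \<Omega> u w v - b_form \<Omega> u w z"
proof -
  note G = weak_grad_L2[OF H10_H1]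
  note int = trilinear_integrable[OF _ G]
  show "b_form \<Omega> (\<lambda>x. u x - z x) w v = b_form \<Omega> u w v - b_form \<Omega> z w v"
    unfolding b_form_def matrix_vector_mult_diff_distrib inner_diff_left
    by (rule Bochner_Integration.integral_diff) (intro int assms)+
  show "b_form \<Omega> u w (\<lambda>x. v x - z x) = b_form \<Omega> u w v - b_form \<Omega> u w z"
    unfolding b_form_def inner_diff_right
    by (rule Bochner_Integration.integral_diff) (intro int assms)+
  have "b_form \<Omega> u (\<lambda>x. w x - z x) v
      = (LINT x|lebesgue_on \<Omega>. inner ((weak_grad \<Omega> w x - weak_grad \<Omega> z x) *v u x) (v x))"
    unfolding b_form_def
  proof (rule integral_cong_AE)
    show "(\<lambda>x. inner (weak_grad \<Omega> (\<lambda>x. w x - z x) x *v u x) (v x)) \<in> borel_measurable (lebesgue_on \<Omega>)"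
      by (intro borel_measurable_integrable int H10_diff assms)
    show "(\<lambda>x. inner ((weak_grad \<Omega> w x - weak_grad \<Omega> z x) *v u x) (v x)) \<in> borel_measurable (lebesgue_on \<Omega>)"
      by (intro borel_measurable_integrable trilinear_integrable L2_diff G assms)
    show "AE x in lebesgue_on \<Omega>. inner (weak_grad \<Omega> (\<lambda>x. w x - z x) x *v u x) (v x)
        = inner ((weak_grad \<Omega> w x - weak_grad \<Omega> z x) *v u x) (v x)"
      using weak_grad_diff[OF H10_H1[OF assms(2)] H10_H1[OF assms(4)]] by (auto elim: eventually_mono)
  qed
  also have "\<dots> = b_form \<Omega> u w v - b_form \<Omega> u z v"
    unfolding b_form_def matrix_vector_mult_diff_rdistrib inner_diff_left
    by (rule Bochner_Integration.integral_diff) (intro int assms)+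
  finally show "b_form \<Omega> u (\<lambda>x. w x - z x) v = b_form \<Omega> u w v - b_form \<Omega> u z v" .
qed

lemma sym_grad_L2: "u \<in> H10 \<Omega> \<Longrightarrow> sym_grad \<Omega> u \<in> L2 \<Omega>"
  unfolding sym_grad_eq[abs_def] by (intro sym_part_L2 weak_grad_L2 H10_H1)

lemma a_form_eq: "a_form \<Omega> \<nu> u v = \<nu> * l2_inner \<Omega> (sym_grad \<Omega> u) (sym_grad \<Omega> v)"
  by (simp add: a_form_def l2_inner_def)

lemma a_form_diff_left:
  assumes "u \<in> H10 \<Omega>" "z \<in> H10 \<Omega>" "v \<in> H10 \<Omega>"
  shows "a_form \<Omega> \<nu> (\<lambda>x. u x - z x) v = a_form \<Omega> \<nu> u v - a_form \<Omega> \<nu> z v"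
proof -
  have "AE x in lebesgue_on \<Omega>. sym_grad \<Omega> (\<lambda>x. u x - z x) x = sym_grad \<Omega> u x - sym_grad \<Omega> z x"
    using weak_grad_diff[OF H10_H1[OF assms(1)] H10_H1[OF assms(2)]]
    by (auto elim!: eventually_mono simp: sym_grad_eq linear_diff[OF linear_sym_part])
  then have "l2_inner \<Omega> (sym_grad \<Omega> (\<lambda>x. u x - z x)) (sym_grad \<Omega> v)
      = l2_inner \<Omega> (\<lambda>x. sym_grad \<Omega> u x - sym_grad \<Omega> z x) (sym_grad \<Omega> v)"
    by (intro l2_inner_cong_AE sym_grad_L2 L2_diff H10_diff assms) auto
  then show ?thesis
    using assms by (simp add: a_form_eq l2_inner_diff_left sym_grad_L2 right_diff_distrib)
qed

lemma weak_div_L2: "u \<in> H10 \<Omega> \<Longrightarrow> weak_div \<Omega> u \<in> L2 \<Omega>"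
  unfolding weak_div_def[abs_def] sum_2 by (intro L2_add L2_comp weak_grad_L2 H10_H1)

lemma l2_inner_weak_div_diff:
  assumes "u \<in> H10 \<Omega>" "z \<in> H10 \<Omega>" "q \<in> L2 \<Omega>"
  shows "l2_inner \<Omega> q (weak_div \<Omega> (\<lambda>x. u x - z x)) = l2_inner \<Omega> q (weak_div \<Omega> u) - l2_inner \<Omega> q (weak_div \<Omega> z)"
proof -
  have "AE x in lebesgue_on \<Omega>. weak_div \<Omega> (\<lambda>x. u x - z x) x = weak_div \<Omega> u x - weak_div \<Omega> z x"
    using weak_grad_diff[OF H10_H1[OF assms(1)] H10_H1[OF assms(2)]]
    by (auto elim!: eventually_mono simp: weak_div_def sum_subtractf)
  then have "l2_inner \<Omega> q (weak_div \<Omega> (\<lambda>x. u x - z x)) = l2_inner \<Omega> q (\<lambda>x. weak_div \<Omega> u x - weak_div \<Omega> z x)"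
    by (intro l2_inner_cong_AE weak_div_L2 L2_diff H10_diff assms) auto
  then show ?thesis using assms by (simp add: l2_inner_diff_right weak_div_L2)
qed

section \<open>The error of the adjoint variable in one time step\<close>

text \<open>
  The difference of the two adjoint equations is tested with the error \<open>e\<close> itself. The pressures
  drop out because \<open>e\<close> is discretely divergence free, and the trilinear terms are split so that the
  error is paired with the exact velocity and the data error \<open>\<eta>\<close> with the perturbed adjoint.
\<close>

lemma adjoint_error_identity:
  fixes us usr u ur :: "nat \<Rightarrow> vector_field" and j :: nat
  defines "e \<equiv> \<lambda>x. us j x - usr j x" and "d \<equiv> \<lambda>x. us (Suc j) x - usr (Suc j) x"
    and "\<eta> \<equiv> \<lambda>x. u (Suc j) x - ur (Suc j) x"
  assumes V: "V \<subseteq> H10 \<Omega>" and V_diff: "\<And>v w. v \<in> V \<Longrightarrow> w \<in> V \<Longrightarrow> (\<lambda>x. v x - w x) \<in> V"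
    and Q: "Q \<subseteq> L2 \<Omega>" and j: "j < n"
    and scheme: "adjoint_scheme \<Omega> \<nu> \<tau> n V Q uhat u us ps"
    and scheme_r: "adjoint_scheme \<Omega> \<nu> \<tau> n V Q uhat ur usr psr"
    and H: "us (Suc j) \<in> H10 \<Omega>" "usr (Suc j) \<in> H10 \<Omega>" "u (Suc j) \<in> H10 \<Omega>" "ur (Suc j) \<in> H10 \<Omega>"
    and uhat: "uhat (Suc j) \<in> L2 \<Omega>"
  shows "(l2_inner \<Omega> e e - l2_inner \<Omega> d e) / \<tau> + \<nu> * (l2_norm \<Omega> (sym_grad \<Omega> e))\<^sup>2
      + b_form \<Omega> e (u (Suc j)) e + b_form \<Omega> (u (Suc j)) e e
      + b_form \<Omega> e \<eta> (usr j) + b_form \<Omega> \<eta> e (usr j) = - l2_inner \<Omega> \<eta> e"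
proof -
  have V': "us j \<in> V" "usr j \<in> V" "ps j \<in> Q" "psr j \<in> Q"
    using scheme scheme_r j by (auto simp: adjoint_scheme_def)
  have eV: "e \<in> V" unfolding e_def by (intro V_diff V')
  have H': "us j \<in> H10 \<Omega>" "usr j \<in> H10 \<Omega>" "e \<in> H10 \<Omega>" using V V' eV by auto
  have \<eta>H: "\<eta> \<in> H10 \<Omega>" unfolding \<eta>_def by (intro H10_diff H)
  note L = H10_H1[THEN H1_L2]
  have step: "l2_inner \<Omega> (\<lambda>x. - ((w' x - w x) /\<^sub>R \<tau>)) e = (l2_inner \<Omega> w e - l2_inner \<Omega> w' e) / \<tau>"
    if "w \<in> H10 \<Omega>" "w' \<in> H10 \<Omega>" for w w'
  proof -
    have "(\<lambda>x. - ((w' x - w x) /\<^sub>R \<tau>)) = (\<lambda>x. inverse \<tau> *\<^sub>R (w x - w' x))"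
      by (simp add: algebra_simps)
    then show ?thesis
      using that H'(3) by (simp only: l2_inner_scale_left)
        (simp add: l2_inner_diff_left L divide_inverse mult.commute)
  qed
  have pressure: "l2_inner \<Omega> q (weak_div \<Omega> e) = 0" if "q \<in> Q" for q
  proof -
    have "l2_inner \<Omega> (weak_div \<Omega> (us j)) q = 0" "l2_inner \<Omega> (weak_div \<Omega> (usr j)) q = 0"
      using scheme scheme_r j that by (auto simp: adjoint_scheme_def)
    then show ?thesis
      using l2_inner_weak_div_diff[OF H'(1,2), of q] Q that
      by (auto simp: e_def l2_inner_commute[of \<Omega> q])
  qed
  have eq: "(l2_inner \<Omega> (us j) e - l2_inner \<Omega> (us (Suc j)) e) / \<tau> + a_form \<Omega> \<nu> (us j) e
      + b_form \<Omega> e (u (Suc j)) (us j) + b_form \<Omega> (u (Suc j)) e (us j)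
      = l2_inner \<Omega> (uhat (Suc j)) e - l2_inner \<Omega> (u (Suc j)) e"
  proof -
    have "l2_inner \<Omega> (\<lambda>x. - ((us (Suc j) x - us j x) /\<^sub>R \<tau>)) e + a_form \<Omega> \<nu> (us j) e
      + b_form \<Omega> e (u (Suc j)) (us j) + b_form \<Omega> (u (Suc j)) e (us j) + l2_inner \<Omega> (ps j) (weak_div \<Omega> e)
      = l2_inner \<Omega> (\<lambda>x. uhat (Suc j) x - u (Suc j) x) e"
      using scheme j eV by (auto simp: adjoint_scheme_def)
    then show ?thesis
      unfolding step[OF H'(1) H(1)] pressure[OF V'(3)] l2_inner_diff_left[OF uhat L[OF H(3)] L[OF H'(3)]] by simp
  qed
  have eq_r: "(l2_inner \<Omega> (usr j) e - l2_inner \<Omega> (usr (Suc j)) e) / \<tau> + a_form \<Omega> \<nu> (usr j) e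
      + b_form \<Omega> e (ur (Suc j)) (usr j) + b_form \<Omega> (ur (Suc j)) e (usr j)
      = l2_inner \<Omega> (uhat (Suc j)) e - l2_inner \<Omega> (ur (Suc j)) e"
  proof -
    have "l2_inner \<Omega> (\<lambda>x. - ((usr (Suc j) x - usr j x) /\<^sub>R \<tau>)) e + a_form \<Omega> \<nu> (usr j) e
      + b_form \<Omega> e (ur (Suc j)) (usr j) + b_form \<Omega> (ur (Suc j)) e (usr j) + l2_inner \<Omega> (psr j) (weak_div \<Omega> e)
      = l2_inner \<Omega> (\<lambda>x. uhat (Suc j) x - ur (Suc j) x) e"
      using scheme_r j eV by (auto simp: adjoint_scheme_def)
    then show ?thesis
      unfolding step[OF H'(2) H(2)] pressure[OF V'(4)] l2_inner_diff_left[OF uhat L[OF H(4)] L[OF H'(3)]] by simp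
  qed
  have ee: "l2_inner \<Omega> e w = l2_inner \<Omega> (us j) w - l2_inner \<Omega> (usr j) w"
    "l2_inner \<Omega> d w = l2_inner \<Omega> (us (Suc j)) w - l2_inner \<Omega> (usr (Suc j)) w"
    "l2_inner \<Omega> \<eta> w = l2_inner \<Omega> (u (Suc j)) w - l2_inner \<Omega> (ur (Suc j)) w" if "w \<in> L2 \<Omega>" for w
    unfolding e_def d_def \<eta>_def by (intro l2_inner_diff_left L H H' that)+
  have aa: "\<nu> * (l2_norm \<Omega> (sym_grad \<Omega> e))\<^sup>2 = a_form \<Omega> \<nu> (us j) e - a_form \<Omega> \<nu> (usr j) e"
    using a_form_diff_left[OF H'(1,2,3), of \<nu>] a_form_eq[of \<nu> e e] unfolding e_def by (simp add: l2_norm_sq)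
  have "b_form \<Omega> e (u (Suc j)) e = b_form \<Omega> e (u (Suc j)) (us j) - b_form \<Omega> e (u (Suc j)) (usr j)"
    "b_form \<Omega> (u (Suc j)) e e = b_form \<Omega> (u (Suc j)) e (us j) - b_form \<Omega> (u (Suc j)) e (usr j)"
    using b_form_diff(3)[OF H'(3) H(3) H'(1,2)] b_form_diff(3)[OF H(3) H'(3) H'(1,2)]
    by (simp_all add: e_def[symmetric])
  moreover have "b_form \<Omega> e \<eta> (usr j) = b_form \<Omega> e (u (Suc j)) (usr j) - b_form \<Omega> e (ur (Suc j)) (usr j)"
    unfolding \<eta>_def by (rule b_form_diff(2)[OF H'(3) H(3) H'(2) H(4)])
  moreover have "b_form \<Omega> \<eta> e (usr j) = b_form \<Omega> (u (Suc j)) e (usr j) - b_form \<Omega> (ur (Suc j)) e (usr j)"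
    unfolding \<eta>_def by (rule b_form_diff(1)[OF H(3) H'(3) H'(2) H(4)])
  moreover have "(l2_inner \<Omega> e e - l2_inner \<Omega> d e) / \<tau>
    = (l2_inner \<Omega> (us j) e - l2_inner \<Omega> (us (Suc j)) e) / \<tau> - (l2_inner \<Omega> (usr j) e - l2_inner \<Omega> (usr (Suc j)) e) / \<tau>"
    using ee(1,2)[OF L[OF H'(3)]] by (simp add: diff_divide_distrib[symmetric] algebra_simps)
  ultimately show ?thesis
    using eq eq_r aa ee(3)[OF L[OF H'(3)]] by linarith
qed

end

text \<open>
  The growth rate of the error depends on the velocity bound \<open>K\<close>, and the amplification of the data
  error on the adjoint bound \<open>R\<close>. Korn's inequality leaves \<open>\<nu> / 2\<close> times the squared norm of the
  gradient of the error; \<open>\<nu> / 10\<close> is one of the five equal portions of it that are spent below.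
\<close>

definition growth_rate :: "real \<Rightarrow> real \<Rightarrow> real" where
  "growth_rate \<nu> K = K\<^sup>2 / (\<nu> / 10) + K ^ 4 / (16 * (\<nu> / 10) ^ 3) + \<nu> / 10 + 1"

definition amplification :: "real \<Rightarrow> real \<Rightarrow> real" where
  "amplification \<nu> R = R\<^sup>2 / (2 * (\<nu> / 10)) + 1"

lemma growth_rate_pos: "0 < \<nu> \<Longrightarrow> 0 < growth_rate \<nu> K"
  unfolding growth_rate_def by (intro add_nonneg_pos add_nonneg_nonneg) auto

lemma amplification_pos: "0 < \<nu> \<Longrightarrow> 0 < amplification \<nu> R"
  unfolding amplification_def by (intro add_nonneg_pos) auto

lemma young_inequality: "0 < \<delta> \<Longrightarrow> x * y \<le> \<delta> * x\<^sup>2 + y\<^sup>2 / (4 * \<delta>)" for x y \<delta> :: real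
proof -
  assume \<delta>: "0 < \<delta>"
  have "0 \<le> (2 * \<delta> * x - y)\<^sup>2 / (4 * \<delta>)" using \<delta> by simp
  also have "\<dots> = \<delta> * x\<^sup>2 + y\<^sup>2 / (4 * \<delta>) - x * y"
    using \<delta> by (simp add: power2_eq_square field_simps)
  finally show ?thesis by simp
qed

text \<open>
  Here \<open>E\<close>, \<open>G\<close> and \<open>q\<close> stand for the \<open>L\<^sup>2\<close> norm of the error, the \<open>L\<^sup>2\<close> norm of its gradient and its \<open>L\<^sup>4\<close>
  norm, and \<open>N\<close> for the \<open>H\<^sup>1\<close> norm of the data error. The term \<open>G * (K * q)\<close> is of order \<open>3 / 2\<close> in \<open>G\<close>, so
  it takes two applications of Young's inequality and two of the five portions.
\<close>

lemma absorb_into_dissipation: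
  fixes E G K q R N \<nu> :: real
  assumes "0 < \<nu>" "0 \<le> E" "0 \<le> G" and q: "q\<^sup>2 \<le> 2 * (E * G)"
  shows "2 * K * (E * G) + G * (K * q) + N * (q * R) + G * (N * R) + N * E
    \<le> \<nu> / 2 * G\<^sup>2 + growth_rate \<nu> K * E\<^sup>2 + amplification \<nu> R * N\<^sup>2"
proof -
  define \<delta> where "\<delta> = \<nu> / 10"
  have \<delta>: "0 < \<delta>" "\<nu> / 2 = 5 * \<delta>" using assms by (simp_all add: \<delta>_def)
  have 1: "2 * K * (E * G) \<le> \<delta> * G\<^sup>2 + K\<^sup>2 / \<delta> * E\<^sup>2"
    using young_inequality[OF \<delta>(1), of G "2 * K * E"] by (simp add: power_mult_distrib mult_ac)
  have 2: "G * (K * q) \<le> 2 * (\<delta> * G\<^sup>2) + K ^ 4 / (16 * \<delta> ^ 3) * E\<^sup>2"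
  proof -
    have "G * (K * q) \<le> \<delta> * G\<^sup>2 + (K\<^sup>2 / (4 * \<delta>)) * q\<^sup>2"
      using young_inequality[OF \<delta>(1), of G "K * q"] by (simp add: power_mult_distrib)
    also have "(K\<^sup>2 / (4 * \<delta>)) * q\<^sup>2 \<le> (K\<^sup>2 / (4 * \<delta>)) * (2 * (E * G))"
      using q \<delta> by (intro mult_left_mono) auto
    also have "\<dots> = G * (K\<^sup>2 / (2 * \<delta>) * E)" by simp
    also have "\<dots> \<le> \<delta> * G\<^sup>2 + (K\<^sup>2 / (2 * \<delta>) * E)\<^sup>2 / (4 * \<delta>)"
      by (rule young_inequality[OF \<delta>(1)])
    also have "(K\<^sup>2 / (2 * \<delta>) * E)\<^sup>2 / (4 * \<delta>) = K ^ 4 / (16 * \<delta> ^ 3) * E\<^sup>2"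
      by (simp add: power_mult_distrib power_divide power2_eq_square power3_eq_cube power4_eq_xxxx mult_ac)
    finally show ?thesis by simp
  qed
  have "2 * (E * G) \<le> E\<^sup>2 + G\<^sup>2" using sum_squares_bound[of E G] by simp
  then have "\<delta> * q\<^sup>2 \<le> \<delta> * (E\<^sup>2 + G\<^sup>2)" using q \<delta> by (intro mult_left_mono) auto
  then have 3: "N * (q * R) \<le> \<delta> * E\<^sup>2 + \<delta> * G\<^sup>2 + R\<^sup>2 / (4 * \<delta>) * N\<^sup>2"
    using young_inequality[OF \<delta>(1), of q "N * R"] by (simp add: power_mult_distrib distrib_left mult_ac)
  have 4: "G * (N * R) \<le> \<delta> * G\<^sup>2 + R\<^sup>2 / (4 * \<delta>) * N\<^sup>2"
    using young_inequality[OF \<delta>(1), of G "N * R"] by (simp add: power_mult_distrib mult_ac)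
  have 5: "N * E \<le> E\<^sup>2 + N\<^sup>2"
    using sum_squares_bound[of N E] zero_le_power2[of N] zero_le_power2[of E] by linarith
  have "amplification \<nu> R * N\<^sup>2 = R\<^sup>2 / (4 * \<delta>) * N\<^sup>2 + R\<^sup>2 / (4 * \<delta>) * N\<^sup>2 + N\<^sup>2"
    using \<delta> by (simp add: amplification_def \<delta>_def[symmetric] field_simps)
  moreover have "growth_rate \<nu> K * E\<^sup>2 = K\<^sup>2 / \<delta> * E\<^sup>2 + K ^ 4 / (16 * \<delta> ^ 3) * E\<^sup>2 + \<delta> * E\<^sup>2 + E\<^sup>2"
    unfolding growth_rate_def \<delta>_def[symmetric] by (simp add: algebra_simps)
  ultimately show ?thesis using 1 2 3 4 5 unfolding \<delta>(2) by linarith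
qed

context bounded_open_set
begin

text \<open>
  In \<open>2 * (e - d, e) = \<parallel>e\<parallel>\<^sup>2 - \<parallel>d\<parallel>\<^sup>2 + \<parallel>e - d\<parallel>\<^sup>2\<close> the last square is dropped, and the trilinear terms
  are estimated in the norms that the previous lemma expects.
\<close>

lemma adjoint_error_step:
  fixes us usr u ur :: "nat \<Rightarrow> vector_field" and j :: nat
  defines "e \<equiv> \<lambda>x. us j x - usr j x" and "d \<equiv> \<lambda>x. us (Suc j) x - usr (Suc j) x"
    and "\<eta> \<equiv> \<lambda>x. u (Suc j) x - ur (Suc j) x"
  assumes "0 < \<nu>" "0 < \<tau>"
    and V: "V \<subseteq> H10 \<Omega>" and V_diff: "\<And>v w. v \<in> V \<Longrightarrow> w \<in> V \<Longrightarrow> (\<lambda>x. v x - w x) \<in> V"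
    and Q: "Q \<subseteq> L2 \<Omega>" and j: "j < n"
    and scheme: "adjoint_scheme \<Omega> \<nu> \<tau> n V Q uhat u us ps"
    and scheme_r: "adjoint_scheme \<Omega> \<nu> \<tau> n V Q uhat ur usr psr"
    and H: "us (Suc j) \<in> H10 \<Omega>" "usr (Suc j) \<in> H10 \<Omega>" "u (Suc j) \<in> H10 \<Omega>" "ur (Suc j) \<in> H10 \<Omega>"
    and uhat: "uhat (Suc j) \<in> L2 \<Omega>"
    and K: "h1_norm \<Omega> (u (Suc j)) \<le> K" and R: "h1_norm \<Omega> (usr j) \<le> R"
  shows "(1 - 2 * \<tau> * growth_rate \<nu> K) * (l2_norm \<Omega> e)\<^sup>2
    \<le> (l2_norm \<Omega> d)\<^sup>2 + 2 * amplification \<nu> R * (\<tau> * (h1_norm \<Omega> \<eta>)\<^sup>2)"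
proof -
  define E F G N q where "E = l2_norm \<Omega> e" and "F = l2_norm \<Omega> d" and "G = l2_norm \<Omega> (weak_grad \<Omega> e)"
    and "N = h1_norm \<Omega> \<eta>" and "q = l4_norm e"
  note defs = E_def F_def G_def N_def q_def
  have "us j \<in> V" "usr j \<in> V" using scheme scheme_r j by (auto simp: adjoint_scheme_def)
  then have H': "e \<in> H10 \<Omega>" "usr j \<in> H10 \<Omega>" unfolding e_def using V V_diff by blast+
  have \<eta>: "\<eta> \<in> H10 \<Omega>" and d: "d \<in> H10 \<Omega>" unfolding \<eta>_def d_def by (intro H10_diff H)+
  note L = H10_H1[THEN H1_L2]
  have nonneg: "0 \<le> E" "0 \<le> G" "0 \<le> N" "0 \<le> q" "0 \<le> K" "0 \<le> R"
    using order_trans[OF h1_norm_nonneg K] order_trans[OF h1_norm_nonneg R] by (simp_all add: defs)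
  have q: "q\<^sup>2 \<le> 2 * (E * G)" unfolding defs by (rule l4_norm_sq_le[OF H'(1)])
  have gradu: "l2_norm \<Omega> (weak_grad \<Omega> (u (Suc j))) \<le> K" and l4u: "l4_norm (u (Suc j)) \<le> K"
    using K l2_norm_le_h1_norm(2)[of "u (Suc j)"] l4_norm_le_h1_norm[OF H(3)] by linarith+
  have l4us: "l4_norm (usr j) \<le> R" using R l4_norm_le_h1_norm[OF H'(2)] by linarith
  have grad\<eta>: "l2_norm \<Omega> (weak_grad \<Omega> \<eta>) \<le> N" and l4\<eta>: "l4_norm \<eta> \<le> N" and l2\<eta>: "l2_norm \<Omega> \<eta> \<le> N"
    using l2_norm_le_h1_norm[of \<eta>] l4_norm_le_h1_norm[OF \<eta>] by (simp_all add: N_def)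
  have "\<bar>b_form \<Omega> e (u (Suc j)) e\<bar> \<le> K * (q * q)"
    by (rule order_trans[OF b_form_bound[OF H'(1) H(3) H'(1)]])
       (use gradu nonneg in \<open>auto simp: q_def intro!: mult_right_mono\<close>)
  also have "\<dots> \<le> K * (2 * (E * G))" using q nonneg by (intro mult_left_mono) (auto simp: power2_eq_square)
  finally have b1: "\<bar>b_form \<Omega> e (u (Suc j)) e\<bar> \<le> 2 * K * (E * G)" by simp
  have b2: "\<bar>b_form \<Omega> (u (Suc j)) e e\<bar> \<le> G * (K * q)"
    by (rule order_trans[OF b_form_bound[OF H(3) H'(1) H'(1)]])
       (use l4u nonneg in \<open>auto simp: q_def G_def intro!: mult_left_mono mult_right_mono\<close>)
  have b3: "\<bar>b_form \<Omega> e \<eta> (usr j)\<bar> \<le> N * (q * R)"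
    by (rule order_trans[OF b_form_bound[OF H'(1) \<eta> H'(2)]])
       (use grad\<eta> l4us nonneg in \<open>auto simp: q_def intro!: mult_mono\<close>)
  have b4: "\<bar>b_form \<Omega> \<eta> e (usr j)\<bar> \<le> G * (N * R)"
    by (rule order_trans[OF b_form_bound[OF \<eta> H'(1) H'(2)]])
       (use l4\<eta> l4us nonneg in \<open>auto simp: G_def intro!: mult_left_mono mult_mono\<close>)
  have b5: "\<bar>l2_inner \<Omega> \<eta> e\<bar> \<le> N * E"
    by (rule order_trans[OF l2_cauchy_schwarz[OF L[OF \<eta>] L[OF H'(1)]]])
       (use l2\<eta> in \<open>auto simp: E_def intro!: mult_right_mono\<close>)
  have "\<bar>l2_inner \<Omega> d e\<bar> \<le> F * E" unfolding defs by (rule l2_cauchy_schwarz[OF L[OF d] L[OF H'(1)]])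
  then have "E\<^sup>2 - F\<^sup>2 \<le> 2 * (l2_inner \<Omega> e e - l2_inner \<Omega> d e)"
    using sum_squares_bound[of F E] by (simp add: E_def[symmetric] l2_norm_sq[symmetric])
  then have "(E\<^sup>2 - F\<^sup>2) / (2 * \<tau>) \<le> 2 * (l2_inner \<Omega> e e - l2_inner \<Omega> d e) / (2 * \<tau>)"
    using \<open>0 < \<tau>\<close> by (intro divide_right_mono) auto
  then have time: "(E\<^sup>2 - F\<^sup>2) / (2 * \<tau>) \<le> (l2_inner \<Omega> e e - l2_inner \<Omega> d e) / \<tau>"
    by (subst (asm) mult_divide_mult_cancel_left) auto
  have "G\<^sup>2 \<le> 2 * (l2_norm \<Omega> (sym_grad \<Omega> e))\<^sup>2" unfolding G_def by (rule korn[OF H'(1)])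
  then have "\<nu> / 2 * G\<^sup>2 \<le> \<nu> / 2 * (2 * (l2_norm \<Omega> (sym_grad \<Omega> e))\<^sup>2)"
    using \<open>0 < \<nu>\<close> by (intro mult_left_mono) auto
  then have dissipation: "\<nu> / 2 * G\<^sup>2 \<le> \<nu> * (l2_norm \<Omega> (sym_grad \<Omega> e))\<^sup>2" by simp
  have "(E\<^sup>2 - F\<^sup>2) / (2 * \<tau>) \<le> growth_rate \<nu> K * E\<^sup>2 + amplification \<nu> R * N\<^sup>2"
    using adjoint_error_identity[OF V V_diff Q j scheme scheme_r H uhat, folded e_def d_def \<eta>_def]
      time dissipation b1 b2 b3 b4 b5 absorb_into_dissipation[OF \<open>0 < \<nu>\<close> nonneg(1,2) q, of K N R]
    by linarith
  then have "E\<^sup>2 - F\<^sup>2 \<le> 2 * \<tau> * (growth_rate \<nu> K * E\<^sup>2 + amplification \<nu> R * N\<^sup>2)"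
    using \<open>0 < \<tau>\<close> by (simp add: field_simps)
  then show ?thesis unfolding defs by (simp add: algebra_simps)
qed

end

section \<open>Coefficient vectors and the Hilbert-Schmidt norm\<close>

context bounded_open_set
begin

lemma h1_inner_commute: "h1_inner \<Omega> u v = h1_inner \<Omega> v u"
  by (simp add: h1_inner_def l2_inner_commute inner_commute)

lemma h1_inner_linear_right:
  assumes "w \<in> H1 \<Omega>" "u \<in> H1 \<Omega>" "v \<in> H1 \<Omega>"
  shows "h1_inner \<Omega> w (\<lambda>x. a *\<^sub>R u x + b *\<^sub>R v x) = a * h1_inner \<Omega> w u + b * h1_inner \<Omega> w v"
proof -
  have split: "h1_inner \<Omega> w z = l2_inner \<Omega> w z + l2_inner \<Omega> (weak_grad \<Omega> w) (weak_grad \<Omega> z)" for z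
    by (simp add: h1_inner_def l2_inner_def[of _ "weak_grad \<Omega> w"])
  have "l2_inner \<Omega> (weak_grad \<Omega> w) (weak_grad \<Omega> (\<lambda>x. a *\<^sub>R u x + b *\<^sub>R v x))
      = l2_inner \<Omega> (weak_grad \<Omega> w) (\<lambda>x. a *\<^sub>R weak_grad \<Omega> u x + b *\<^sub>R weak_grad \<Omega> v x)"
    using assms
    by (intro l2_inner_cong_AE weak_grad_L2 H1_linear L2_add L2_scale weak_grad_linear) auto
  then show ?thesis
    using assms unfolding split
    by (simp add: l2_inner_add_right l2_inner_scale_right L2_scale H1_L2 weak_grad_L2 distrib_left)
qed

lemma H10_sum:
  fixes m :: nat
  assumes "\<And>k. k < m \<Longrightarrow> \<phi> k \<in> H10 \<Omega>"
  shows "(\<lambda>x. \<Sum>k<m. c k *\<^sub>R \<phi> k x) \<in> H10 \<Omega>"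
  using assms
proof (induction m)
  case (Suc m)
  then show ?case
    using H10_linear[of "\<lambda>x. \<Sum>k<m. c k *\<^sub>R \<phi> k x" "\<phi> m" 1 "c m"] by simp
qed simp

lemma h1_inner_sum_right:
  fixes m :: nat
  assumes "\<And>k. k < m \<Longrightarrow> \<phi> k \<in> H10 \<Omega>" and w: "w \<in> H1 \<Omega>"
  shows "h1_inner \<Omega> w (\<lambda>x. \<Sum>k<m. c k *\<^sub>R \<phi> k x) = (\<Sum>k<m. c k * h1_inner \<Omega> w (\<phi> k))"
  using assms(1)
proof (induction m)
  case 0
  show ?case using h1_inner_linear_right[OF w w w, of 0 0] by simp
next
  case (Suc m)
  then show ?case
    using h1_inner_linear_right[OF w H10_H1[OF H10_sum] H10_H1, of m \<phi> "\<phi> m" 1 c "c m"] by simp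
qed

lemma fe_function_H10:
  assumes "\<And>k. k < m \<Longrightarrow> \<phi> k \<in> H10 \<Omega>" "c \<in> carrier_vec m"
  shows "fe_function \<phi> c \<in> H10 \<Omega>"
  using H10_sum[where c = "vec_index c", OF assms(1)] assms(2) by (simp add: fe_function_def[abs_def])

lemma weighted_norm_h1_gram:
  assumes \<phi>: "\<And>k. k < m \<Longrightarrow> \<phi> k \<in> H10 \<Omega>" and c: "c \<in> carrier_vec m"
  shows "weighted_norm (h1_gram \<Omega> m \<phi>) c = h1_norm \<Omega> (fe_function \<phi> c)"
proof -
  have fe: "fe_function \<phi> c = (\<lambda>x. \<Sum>k<m. vec_index c k *\<^sub>R \<phi> k x)"
    using c by (simp add: fe_function_def[abs_def])
  have fe_H: "fe_function \<phi> c \<in> H1 \<Omega>" by (rule H10_H1[OF fe_function_H10[OF \<phi> c]])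
  have "h1_inner \<Omega> (fe_function \<phi> c) (fe_function \<phi> c) = (\<Sum>k<m. vec_index c k * h1_inner \<Omega> (fe_function \<phi> c) (\<phi> k))"
    using h1_inner_sum_right[OF \<phi> fe_H, where c = "vec_index c"] by (simp add: fe)
  also have "\<dots> = (\<Sum>k<m. vec_index c k * (\<Sum>l<m. vec_index c l * h1_inner \<Omega> (\<phi> k) (\<phi> l)))"
  proof (rule sum.cong[OF refl])
    fix k assume "k \<in> {..<m}"
    then have "h1_inner \<Omega> (\<phi> k) (fe_function \<phi> c) = (\<Sum>l<m. vec_index c l * h1_inner \<Omega> (\<phi> k) (\<phi> l))"
      unfolding fe using \<phi> by (intro h1_inner_sum_right H10_H1) auto
    then show "vec_index c k * h1_inner \<Omega> (fe_function \<phi> c) (\<phi> k)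
        = vec_index c k * (\<Sum>l<m. vec_index c l * h1_inner \<Omega> (\<phi> k) (\<phi> l))"
      by (simp add: h1_inner_commute)
  qed
  also have "\<dots> = scalar_prod c (h1_gram \<Omega> m \<phi> *\<^sub>v c)"
    using c by (simp add: scalar_prod_def h1_gram_def lessThan_atLeast0 mult.commute)
  finally show ?thesis by (simp add: weighted_norm_def h1_norm_def)
qed

lemma fe_function_minus:
  assumes "c \<in> carrier_vec m" "d \<in> carrier_vec m"
  shows "fe_function \<phi> (c - d) = (\<lambda>x. fe_function \<phi> c x - fe_function \<phi> d x)"
  using assms by (auto simp: fe_function_def[abs_def] scaleR_left_diff_distrib sum_subtractf)

lemma fe_function_smult:
  "fe_function \<phi> (a \<cdot>\<^sub>v c) = (\<lambda>x. a *\<^sub>R fe_function \<phi> c x)"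
  by (auto simp: fe_function_def[abs_def] scaleR_sum_right)

lemma h1_norm_scale_sq: "u \<in> H1 \<Omega> \<Longrightarrow> (h1_norm \<Omega> (\<lambda>x. a *\<^sub>R u x))\<^sup>2 = a\<^sup>2 * (h1_norm \<Omega> u)\<^sup>2"
proof -
  assume u: "u \<in> H1 \<Omega>"
  have nonneg: "0 \<le> h1_inner \<Omega> v v" for v
    by (simp add: h1_inner_def l2_inner_self_nonneg)
  have "h1_inner \<Omega> w (\<lambda>x. a *\<^sub>R u x) = a * h1_inner \<Omega> w u" if "w \<in> H1 \<Omega>" for w
    using h1_inner_linear_right[OF that u u, of a 0] by simp
  moreover have "(\<lambda>x. a *\<^sub>R u x) \<in> H1 \<Omega>" using H1_linear[OF u u, of a 0] by simp
  ultimately have "h1_inner \<Omega> (\<lambda>x. a *\<^sub>R u x) (\<lambda>x. a *\<^sub>R u x) = a\<^sup>2 * h1_inner \<Omega> u u"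
    using u h1_inner_commute[of "\<lambda>x. a *\<^sub>R u x" u] by (simp add: power2_eq_square)
  then show ?thesis by (simp add: h1_norm_def nonneg)
qed

text \<open>
  The unit vectors are mapped to the columns, and with the Gram matrix as weight the norm of a
  coefficient vector is the \<open>H\<^sup>1\<close> norm of its function. The column with index \<open>j\<close>, counted from \<open>0\<close>,
  belongs to the time \<open>j + 1\<close>.
\<close>

lemma hs_norm_data_matrix_diff:
  assumes \<phi>: "\<And>k. k < m \<Longrightarrow> \<phi> k \<in> H10 \<Omega>" and "0 \<le> \<tau>"
    and c: "\<And>j. j \<in> {1..n} \<Longrightarrow> c j \<in> carrier_vec m" and d: "\<And>j. j \<in> {1..n} \<Longrightarrow> d j \<in> carrier_vec m"
  shows "(hs_norm (h1_gram \<Omega> m \<phi>) (data_matrix m \<tau> n c - data_matrix m \<tau> n d))\<^sup>2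
    = (\<Sum>j<n. \<tau> * (h1_norm \<Omega> (\<lambda>x. fe_function \<phi> (c (Suc j)) x - fe_function \<phi> (d (Suc j)) x))\<^sup>2)"
proof -
  let ?A = "data_matrix m \<tau> n c - data_matrix m \<tau> n d"
  have carr: "data_matrix m \<tau> n b \<in> carrier_mat m n" for b
    using mat_of_cols_carrier(1)[of m "map (\<lambda>j. sqrt \<tau> \<cdot>\<^sub>v b j) [1..<Suc n]"]
    by (simp add: data_matrix_def del: upt_Suc)
  have A: "?A \<in> carrier_mat m n" by (rule minus_carrier_mat[OF carr])
  have "(weighted_norm (h1_gram \<Omega> m \<phi>) (?A *\<^sub>v unit_vec n j))\<^sup>2
      = \<tau> * (h1_norm \<Omega> (\<lambda>x. fe_function \<phi> (c (Suc j)) x - fe_function \<phi> (d (Suc j)) x))\<^sup>2" if j: "j < n" for j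
  proof -
    let ?b = "c (Suc j) - d (Suc j)"
    have cd: "c (Suc j) \<in> carrier_vec m" "d (Suc j) \<in> carrier_vec m" using c d j by auto
    have "Matrix.col (data_matrix m \<tau> n b) j = sqrt \<tau> \<cdot>\<^sub>v b (Suc j)" if "b (Suc j) \<in> carrier_vec m" for b
      using that j unfolding data_matrix_def by (subst col_mat_of_cols) (auto simp del: upt_Suc)
    moreover have "?A *\<^sub>v unit_vec n j = Matrix.col ?A j"
      using A j by (intro eq_vecI) auto
    moreover have "Matrix.col ?A j = Matrix.col (data_matrix m \<tau> n c) j - Matrix.col (data_matrix m \<tau> n d) j"
      using j carr[of c] carr[of d] by (intro eq_vecI) auto
    ultimately have "?A *\<^sub>v unit_vec n j = sqrt \<tau> \<cdot>\<^sub>v c (Suc j) - sqrt \<tau> \<cdot>\<^sub>v d (Suc j)"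
      using cd by simp
    also have "\<dots> = sqrt \<tau> \<cdot>\<^sub>v ?b"
      using cd by (auto simp: right_diff_distrib)
    finally have "weighted_norm (h1_gram \<Omega> m \<phi>) (?A *\<^sub>v unit_vec n j) = h1_norm \<Omega> (fe_function \<phi> (sqrt \<tau> \<cdot>\<^sub>v ?b))"
      using cd weighted_norm_h1_gram[where c = "sqrt \<tau> \<cdot>\<^sub>v ?b" and m = m and \<phi> = \<phi>, OF \<phi>] by simp
    moreover have "fe_function \<phi> ?b \<in> H1 \<Omega>" using cd by (intro H10_H1 fe_function_H10[OF \<phi>]) auto
    ultimately show ?thesis
      using h1_norm_scale_sq[of "fe_function \<phi> ?b" "sqrt \<tau>"] \<open>0 \<le> \<tau>\<close> fe_function_minus[OF cd, of \<phi>]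
      by (simp add: fe_function_smult)
  qed
  moreover have "dim_col ?A = n" by (rule carrier_matD(2)[OF A])
  ultimately show ?thesis
    unfolding hs_norm_def by (subst real_sqrt_pow2[OF sum_nonneg]) (simp_all add: \<open>0 \<le> \<tau>\<close>)
qed

end

section \<open>Accumulation of the error and the gradient\<close>

text \<open>For \<open>0 \<le> x \<le> 1 / 2\<close> one has \<open>1 \<le> (1 - x) * (1 + 2 * x) \<le> (1 - x) * exp (2 * x)\<close>.\<close>

lemma inverse_one_minus_le_exp:
  fixes x :: real
  assumes "0 \<le> x" "x \<le> 1 / 2" "(1 - x) * a \<le> b" "0 \<le> a"
  shows "a \<le> exp (2 * x) * b"
proof -
  have "x * x \<le> x * (1 / 2)" using assms by (intro mult_left_mono) auto
  then have "1 \<le> (1 - x) * (1 + 2 * x)" by (simp add: algebra_simps)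
  also have "\<dots> \<le> (1 - x) * exp (2 * x)"
    using assms by (intro mult_left_mono exp_ge_add_one_self) auto
  finally have "1 * a \<le> ((1 - x) * exp (2 * x)) * a" using \<open>0 \<le> a\<close> by (rule mult_right_mono)
  also have "\<dots> = exp (2 * x) * ((1 - x) * a)" by simp
  also have "\<dots> \<le> exp (2 * x) * b" using assms by (intro mult_left_mono) auto
  finally show ?thesis by simp
qed

text \<open>
  The index \<open>0\<close> stays fixed while \<open>k\<close> moves forward, since the recursion bounds earlier terms by later
  ones.
\<close>

lemma backward_gronwall:
  fixes a g :: "nat \<Rightarrow> real" and x :: real
  assumes x: "0 \<le> x" "x \<le> 1 / 2" and a: "\<And>j. 0 \<le> a j" and g: "\<And>j. 0 \<le> g j"
    and step: "\<And>j. j < n \<Longrightarrow> (1 - x) * a j \<le> a (Suc j) + g j"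
  shows "k \<le> n \<Longrightarrow> a 0 \<le> exp (2 * x * real k) * (a k + (\<Sum>j<k. g j))"
proof (induction k)
  case (Suc k)
  have "a k \<le> exp (2 * x) * (a (Suc k) + g k)"
    using Suc.prems by (intro inverse_one_minus_le_exp x step a) auto
  moreover have "(\<Sum>j<k. g j) \<le> exp (2 * x) * (\<Sum>j<k. g j)"
    using mult_right_mono[of 1 "exp (2 * x)" "\<Sum>j<k. g j"] x g by (simp add: sum_nonneg)
  ultimately have "a k + (\<Sum>j<k. g j) \<le> exp (2 * x) * (a (Suc k) + (\<Sum>j<Suc k. g j))"
    by (simp add: distrib_left)
  then have "exp (2 * x * real k) * (a k + (\<Sum>j<k. g j))
      \<le> exp (2 * x * real k) * (exp (2 * x) * (a (Suc k) + (\<Sum>j<Suc k. g j)))"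
    by (intro mult_left_mono) auto
  also have "\<dots> = exp (2 * x * real (Suc k)) * (a (Suc k) + (\<Sum>j<Suc k. g j))"
  proof -
    have "exp (2 * x * real (Suc k)) = exp (2 * x * real k) * exp (2 * x)"
      by (simp add: exp_add[symmetric] algebra_simps)
    then show ?thesis by (simp only: mult.assoc)
  qed
  finally show ?case using Suc by simp
qed simp

text \<open>
  The least index after which the two adjoint sequences agree. If they differ at \<open>0\<close>, then they
  differ at all indices up to this one and agree at the next one, all in the sense of \<open>L\<^sup>2\<close>.
\<close>

definition separation_index :: "point set \<Rightarrow> (nat \<Rightarrow> vector_field) \<Rightarrow> (nat \<Rightarrow> vector_field) \<Rightarrow> nat" where
  "separation_index \<Omega> us usr = (LEAST j. l2_norm \<Omega> (\<lambda>x. us (Suc j) x - usr (Suc j) x) = 0)"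

text \<open>
  The step from the vanishing error just after the separation index bounds the error there, up to a
  factor, by \<open>\<epsilon>\<close>; the quotient of the errors at \<open>0\<close> and at that index transfers this bound to \<open>0\<close>. If
  the sequences agree at \<open>0\<close>, the quotient is \<open>0\<close> or \<open>0 / 0 = 0\<close>, and the summand \<open>1\<close> keeps the constant
  positive.
\<close>

definition adjoint_constant :: "point set \<Rightarrow> real \<Rightarrow> (nat \<Rightarrow> vector_field) \<Rightarrow> (nat \<Rightarrow> vector_field) \<Rightarrow> real" where
  "adjoint_constant \<Omega> \<nu> us usr = (let j = separation_index \<Omega> us usr in
     4 * amplification \<nu> (h1_norm \<Omega> (usr j))
     * ((l2_norm \<Omega> (\<lambda>x. us 0 x - usr 0 x))\<^sup>2 / (l2_norm \<Omega> (\<lambda>x. us j x - usr j x))\<^sup>2) + 1)"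

theorem theorem8:
  fixes \<Omega> :: "point set" and \<nu> :: real
  assumes "bounded_domain \<Omega>" and "0 < \<nu>"
  shows
    "\<exists>(C3 :: (nat \<Rightarrow> vector_field) \<Rightarrow> (nat \<Rightarrow> vector_field) \<Rightarrow> real)
      (C4 :: (nat \<Rightarrow> vector_field) \<Rightarrow> (nat \<Rightarrow> vector_field) \<Rightarrow> real)
      (c3 :: real \<Rightarrow> real) (c4 :: real \<Rightarrow> real) (\<tau>0 :: real \<Rightarrow> real).
      (\<forall>us usr. 0 < C3 us usr \<and> 0 < C4 us usr) \<and>
      (\<forall>K. 0 < c3 K \<and> 0 < c4 K \<and> 0 < \<tau>0 K) \<and>
      (\<forall>(K :: real) (\<tau> :: real) (n :: nat)
         (m :: nat) (\<phi> :: nat \<Rightarrow> vector_field) (l :: nat) (\<psi> :: nat \<Rightarrow> scalar_field) V Q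
         (f :: nat \<Rightarrow> vector_field \<Rightarrow> real) (u0 :: vector_field) (u :: nat \<Rightarrow> vector_field)
         (uc :: nat \<Rightarrow> real vec) (M :: real mat) (U :: real mat)
         (tol_p :: real) (tol_sv :: real) (Ut :: real mat)
         (ucr :: nat \<Rightarrow> real vec) (ur :: nat \<Rightarrow> vector_field) (\<epsilon> :: real)
         (\<gamma> :: real) (uhat :: nat \<Rightarrow> vector_field)
         (us :: nat \<Rightarrow> vector_field) (ps :: nat \<Rightarrow> scalar_field)
         (usr :: nat \<Rightarrow> vector_field) (psr :: nat \<Rightarrow> scalar_field).
         (\<forall>k<m. \<phi> k \<in> H10 \<Omega>) \<and> fe_basis \<Omega> m \<phi> \<and> V = fe_space m \<phi> \<and>
         (\<forall>k<l. \<psi> k \<in> L2_0 \<Omega>) \<and> fe_basis \<Omega> l \<psi> \<and> Q = fe_space l \<psi> \<and>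
         inf_sup_stable \<Omega> V Q \<and>
         1 \<le> n \<and> 0 < \<tau> \<and>
         (\<forall>j\<in>{1..n}. f j \<in> Hminus1 \<Omega>) \<and> u0 \<in> L2 \<Omega> \<and>
         nse_scheme \<Omega> \<nu> \<tau> n V Q f u0 u \<and>
         (\<forall>j\<in>{1..n}. uc j \<in> carrier_vec m \<and> u j = fe_function \<phi> (uc j)) \<and>
         M = h1_gram \<Omega> m \<phi> \<and> U = data_matrix m \<tau> n uc \<and>
         0 < tol_p \<and> 0 < tol_sv \<and> ipod M tol_p tol_sv U Ut \<and>
         (\<forall>j\<in>{1..n}. ucr j \<in> carrier_vec m \<and> ur j = fe_function \<phi> (ucr j)) \<and>
         Ut = data_matrix m \<tau> n ucr \<and>
         hs_norm M (U - Ut) \<le> \<epsilon> \<and>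
         (\<forall>j\<in>{1..n}. uhat j \<in> L2 \<Omega>) \<and>
         adjoint_scheme \<Omega> \<nu> \<tau> n V Q uhat u us ps \<and>
         adjoint_scheme \<Omega> \<nu> \<tau> n V Q uhat ur usr psr \<and>
         (\<forall>j\<in>{1..n}. h1_norm \<Omega> (u j) \<le> K) \<and> \<tau> < \<tau>0 K
         \<longrightarrow>
         l2_norm \<Omega> (gradient_error \<gamma> u0 us usr)
           \<le> sqrt (C4 us usr * exp (C3 us usr * (real n * \<tau>))) * \<epsilon> \<and>
         (\<forall>R. (\<forall>j<n. h1_norm \<Omega> (us j) \<le> R \<and> h1_norm \<Omega> (usr j) \<le> R) \<longrightarrow>
           l2_norm \<Omega> (gradient_error \<gamma> u0 us usr)
             \<le> sqrt (c4 R * exp (c3 K * (real n * \<tau>))) * \<epsilon>))"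
proof -
  interpret bounded_open_set \<Omega>
    using assms(1) by unfold_locales (auto simp: bounded_domain_def)
  let ?C3 = "\<lambda>(us :: nat \<Rightarrow> vector_field) (usr :: nat \<Rightarrow> vector_field). 1 :: real"
  let ?C4 = "adjoint_constant \<Omega> \<nu>"
  let ?c3 = "\<lambda>K. 4 * growth_rate \<nu> K"
  let ?c4 = "\<lambda>R. 2 * amplification \<nu> R"
  \<comment> \<open>Below this threshold \<open>2 * \<tau> * growth_rate \<nu> K \<le> 1 / 2\<close>.\<close>
  let ?\<tau>0 = "\<lambda>K. 1 / (4 * growth_rate \<nu> K)"
  note growth = growth_rate_pos[OF assms(2)] and ampl = amplification_pos[OF assms(2)]
  show ?thesis
  proof (rule exI[of _ ?C3], rule exI[of _ ?C4], rule exI[of _ ?c3], rule exI[of _ ?c4], rule exI[of _ ?\<tau>0],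
      intro conjI allI impI)
    show "0 < (1 :: real)" by simp
    show "0 < ?C4 us usr" for us usr
      using ampl by (auto simp: adjoint_constant_def Let_def less_imp_le intro!: add_nonneg_pos mult_nonneg_nonneg)
    show "0 < ?c3 K" for K using growth by simp
    show "0 < ?c4 K" for K using ampl by simp
    show "0 < ?\<tau>0 K" for K using growth by simp
  next
    fix K \<tau> :: real and n m :: nat and \<phi> :: "nat \<Rightarrow> vector_field" and l :: nat
      and \<psi> :: "nat \<Rightarrow> scalar_field" and V Q f u0 u uc M U tol_p tol_sv Ut ucr ur
      and \<epsilon> \<gamma> :: real and uhat us ps usr psr
    assume "(\<forall>k<m. \<phi> k \<in> H10 \<Omega>) \<and> fe_basis \<Omega> m \<phi> \<and> V = fe_space m \<phi> \<and>
         (\<forall>k<l. \<psi> k \<in> L2_0 \<Omega>) \<and> fe_basis \<Omega> l \<psi> \<and> Q = fe_space l \<psi> \<and>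
         inf_sup_stable \<Omega> V Q \<and>
         1 \<le> n \<and> 0 < \<tau> \<and>
         (\<forall>j\<in>{1..n}. f j \<in> Hminus1 \<Omega>) \<and> u0 \<in> L2 \<Omega> \<and>
         nse_scheme \<Omega> \<nu> \<tau> n V Q f u0 u \<and>
         (\<forall>j\<in>{1..n}. uc j \<in> carrier_vec m \<and> u j = fe_function \<phi> (uc j)) \<and>
         M = h1_gram \<Omega> m \<phi> \<and> U = data_matrix m \<tau> n uc \<and>
         0 < tol_p \<and> 0 < tol_sv \<and> ipod M tol_p tol_sv U Ut \<and>
         (\<forall>j\<in>{1..n}. ucr j \<in> carrier_vec m \<and> ur j = fe_function \<phi> (ucr j)) \<and>
         Ut = data_matrix m \<tau> n ucr \<and>
         hs_norm M (U - Ut) \<le> \<epsilon> \<and>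
         (\<forall>j\<in>{1..n}. uhat j \<in> L2 \<Omega>) \<and>
         adjoint_scheme \<Omega> \<nu> \<tau> n V Q uhat u us ps \<and>
         adjoint_scheme \<Omega> \<nu> \<tau> n V Q uhat ur usr psr \<and>
         (\<forall>j\<in>{1..n}. h1_norm \<Omega> (u j) \<le> K) \<and> \<tau> < ?\<tau>0 K"
    then have \<phi>: "\<And>k. k < m \<Longrightarrow> \<phi> k \<in> H10 \<Omega>" and V: "V = fe_space m \<phi>"
      and \<psi>: "\<And>k. k < l \<Longrightarrow> \<psi> k \<in> L2 \<Omega>" and Q: "Q = fe_space l \<psi>" and n: "1 \<le> n" and \<tau>: "0 < \<tau>"
      and uc: "\<And>j. j \<in> {1..n} \<Longrightarrow> uc j \<in> carrier_vec m" "\<And>j. j \<in> {1..n} \<Longrightarrow> u j = fe_function \<phi> (uc j)"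
      and ucr: "\<And>j. j \<in> {1..n} \<Longrightarrow> ucr j \<in> carrier_vec m" "\<And>j. j \<in> {1..n} \<Longrightarrow> ur j = fe_function \<phi> (ucr j)"
      and hs: "hs_norm (h1_gram \<Omega> m \<phi>) (data_matrix m \<tau> n uc - data_matrix m \<tau> n ucr) \<le> \<epsilon>"
      and uhat: "\<And>j. j \<in> {1..n} \<Longrightarrow> uhat j \<in> L2 \<Omega>"
      and scheme: "adjoint_scheme \<Omega> \<nu> \<tau> n V Q uhat u us ps"
      and scheme_r: "adjoint_scheme \<Omega> \<nu> \<tau> n V Q uhat ur usr psr"
      and K: "\<And>j. j \<in> {1..n} \<Longrightarrow> h1_norm \<Omega> (u j) \<le> K" and \<tau>0: "\<tau> < ?\<tau>0 K"
      by (auto simp: L2_0_def)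
    have VH: "V \<subseteq> H10 \<Omega>" unfolding V fe_space_def using fe_function_H10[OF \<phi>] by auto
    have V_diff: "(\<lambda>x. v x - w x) \<in> V" if vw: "v \<in> V" "w \<in> V" for v w
    proof -
      obtain a b where "v = fe_function \<phi> a" "w = fe_function \<phi> b" "a \<in> carrier_vec m" "b \<in> carrier_vec m"
        using vw by (auto simp: V fe_space_def)
      then have "(\<lambda>x. v x - w x) = fe_function \<phi> (a - b)" "a - b \<in> carrier_vec m"
        using fe_function_minus[of a m b \<phi>] by simp_all
      then show ?thesis unfolding V fe_space_def by blast
    qed
    have QL: "Q \<subseteq> L2 \<Omega>"
    proof -
      have "(\<lambda>x. \<Sum>k<i. vec_index c k *\<^sub>R \<psi> k x) \<in> L2 \<Omega>" if "i \<le> l" for c i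
        using that
      proof (induction i)
        case (Suc i)
        then show ?case
          using L2_add[OF _ L2_scale[OF \<psi>], of "\<lambda>x. \<Sum>k<i. vec_index c k *\<^sub>R \<psi> k x" i] by simp
      qed simp
      then show ?thesis unfolding Q fe_space_def by (auto simp: fe_function_def[abs_def])
    qed
    define e \<eta> where "e j x = us j x - usr j x" and "\<eta> j x = u (Suc j) x - ur (Suc j) x" for j x
    define a where "a j = (l2_norm \<Omega> (e j))\<^sup>2" for j
    define x where "x = 2 * \<tau> * growth_rate \<nu> K"
    have x: "0 \<le> x" "x \<le> 1 / 2" using \<tau> \<tau>0 growth[of K] by (auto simp: x_def field_simps)
    have zero: "us n = (\<lambda>x. 0)" "usr n = (\<lambda>x. 0)" using scheme scheme_r by (auto simp: adjoint_scheme_def)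
    have usH: "us j \<in> H10 \<Omega>" "usr j \<in> H10 \<Omega>" if "j \<le> n" for j
    proof -
      have "us j \<in> V" "usr j \<in> V" if "j < n"
        using scheme scheme_r that by (auto simp: adjoint_scheme_def)
      then show "us j \<in> H10 \<Omega>" "usr j \<in> H10 \<Omega>"
        using VH zero \<open>j \<le> n\<close> by (cases "j = n"; auto)+
    qed
    have uH: "u j \<in> H10 \<Omega>" "ur j \<in> H10 \<Omega>" if "j \<in> {1..n}" for j
      using fe_function_H10[OF \<phi>] uc ucr that by auto
    have step: "(1 - x) * a j \<le> a (Suc j) + 2 * amplification \<nu> R * (\<tau> * (h1_norm \<Omega> (\<eta> j))\<^sup>2)"
      if j: "j < n" and R: "h1_norm \<Omega> (usr j) \<le> R" for j R
    proof -
      have j': "Suc j \<le> n" "Suc j \<in> {1..n}" using j by auto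
      show ?thesis
        using adjoint_error_step[where us = us and usr = usr and u = u and ur = ur and j = j,
            OF assms(2) \<tau> VH V_diff QL j scheme scheme_r usH[OF j'(1)] uH[OF j'(2)]
            uhat[OF j'(2)] K[OF j'(2)] R]
        unfolding x_def a_def e_def[abs_def] \<eta>_def[abs_def] .
    qed
    have "0 \<le> hs_norm (h1_gram \<Omega> m \<phi>) (data_matrix m \<tau> n uc - data_matrix m \<tau> n ucr)"
      unfolding hs_norm_def by (intro real_sqrt_ge_zero sum_nonneg) auto
    note hs_nonneg = this
    then have \<epsilon>: "0 \<le> \<epsilon>" using hs by linarith
    have "(hs_norm (h1_gram \<Omega> m \<phi>) (data_matrix m \<tau> n uc - data_matrix m \<tau> n ucr))\<^sup>2 \<le> \<epsilon>\<^sup>2"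
      by (rule power_mono[OF hs hs_nonneg])
    then have \<eta>: "(\<Sum>j<n. \<tau> * (h1_norm \<Omega> (\<eta> j))\<^sup>2) \<le> \<epsilon>\<^sup>2"
      using hs_norm_data_matrix_diff[OF \<phi> less_imp_le[OF \<tau>] uc(1) ucr(1)] uc(2) ucr(2)
      by (simp add: \<eta>_def[abs_def])
    have "gradient_error \<gamma> u0 us usr = (\<lambda>x. us 0 x - usr 0 x)"
      by (simp add: gradient_error_def adjoint_gradient_def)
    then have error: "l2_norm \<Omega> (gradient_error \<gamma> u0 us usr) = l2_norm \<Omega> (e 0)"
      by (simp add: e_def[abs_def])
    have bound_I: "l2_norm \<Omega> (gradient_error \<gamma> u0 us usr) \<le> sqrt (C * exp D) * \<epsilon>"
      if "a 0 \<le> C * exp D * \<epsilon>\<^sup>2" for C D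
      unfolding error using real_sqrt_le_mono[OF that] \<epsilon> by (simp add: a_def real_sqrt_mult)
    show "l2_norm \<Omega> (gradient_error \<gamma> u0 us usr) \<le> sqrt (?c4 R * exp (?c3 K * (real n * \<tau>))) * \<epsilon>"
      if R: "\<forall>j<n. h1_norm \<Omega> (us j) \<le> R \<and> h1_norm \<Omega> (usr j) \<le> R" for R
    proof (rule bound_I)
      let ?g = "\<lambda>j. 2 * amplification \<nu> R * (\<tau> * (h1_norm \<Omega> (\<eta> j))\<^sup>2)"
      have "a 0 \<le> exp (2 * x * real n) * (a n + (\<Sum>j<n. ?g j))"
      proof (rule backward_gronwall[where n = n and g = ?g, OF x])
        show "(1 - x) * a j \<le> a (Suc j) + ?g j" if "j < n" for j
          using step[OF that] R that by blast
      qed (use \<tau> ampl[of R] in \<open>auto simp: a_def\<close>)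
      also have "a n = 0"
        by (simp add: a_def e_def[abs_def] zero l2_norm_def l2_inner_def)
      also have "exp (2 * x * real n) * (0 + (\<Sum>j<n. ?g j))
          = ?c4 R * exp (?c3 K * (real n * \<tau>)) * (\<Sum>j<n. \<tau> * (h1_norm \<Omega> (\<eta> j))\<^sup>2)"
        unfolding sum_distrib_left[symmetric] by (simp add: x_def mult_ac)
      also have "\<dots> \<le> ?c4 R * exp (?c3 K * (real n * \<tau>)) * \<epsilon>\<^sup>2"
        using ampl[of R] by (intro mult_left_mono \<eta>) auto
      finally show "a 0 \<le> ?c4 R * exp (?c3 K * (real n * \<tau>)) * \<epsilon>\<^sup>2" .
    qed
    show "l2_norm \<Omega> (gradient_error \<gamma> u0 us usr) \<le> sqrt (?C4 us usr * exp (?C3 us usr * (real n * \<tau>))) * \<epsilon>"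
    proof (rule bound_I)
      define j where "j = separation_index \<Omega> us usr"
      let ?A = "amplification \<nu> (h1_norm \<Omega> (usr j))"
      have norm0: "l2_norm \<Omega> (e i) = 0 \<longleftrightarrow> a i = 0" for i by (simp add: a_def)
      have j_def': "j = (LEAST i. a (Suc i) = 0)"
        unfolding j_def separation_index_def norm0[symmetric] by (simp add: e_def[abs_def])
      \<comment> \<open>The terminal condition is a witness for the least index, since \<open>1 \<le> n\<close>.\<close>
      have last: "a (Suc (n - 1)) = 0"
        using n by (simp add: a_def e_def[abs_def] zero l2_norm_def l2_inner_def)
      then have j: "a (Suc j) = 0" "j \<le> n - 1"
        unfolding j_def' by (rule LeastI, rule Least_le)
      have C4: "?C4 us usr = 4 * ?A * (a 0 / a j) + 1"
        by (simp add: adjoint_constant_def Let_def j_def a_def e_def[abs_def])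
      have C4_nonneg: "0 \<le> ?C4 us usr"
        unfolding C4 using ampl[of "h1_norm \<Omega> (usr j)"] by (intro add_nonneg_nonneg mult_nonneg_nonneg) (auto simp: a_def)
      have exp: "1 \<le> exp (?C3 us usr * (real n * \<tau>))" using \<tau> by simp
      have "a 0 \<le> ?C4 us usr * \<epsilon>\<^sup>2"
      proof (cases "a 0 = 0")
        case True
        then show ?thesis using C4_nonneg by simp
      next
        case False
        have "a j \<noteq> 0"
        proof (cases j)
          case (Suc i)
          then show ?thesis using not_less_Least[of i "\<lambda>i. a (Suc i) = 0"] by (auto simp: j_def'[symmetric])
        qed (use False in simp)
        then have "0 < a j" by (simp add: a_def)
        \<comment> \<open>The growth rate enters only through \<open>x \<le> 1 / 2\<close>, which removes the dependence on \<open>K\<close>.\<close>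
        have "a j / 2 \<le> (1 - x) * a j"
          using x \<open>0 < a j\<close> by (simp add: field_simps)
        also have "\<dots> \<le> 2 * ?A * (\<tau> * (h1_norm \<Omega> (\<eta> j))\<^sup>2)"
          using step[of j, OF _ order_refl] j n by simp
        also have "\<tau> * (h1_norm \<Omega> (\<eta> j))\<^sup>2 \<le> (\<Sum>i<n. \<tau> * (h1_norm \<Omega> (\<eta> i))\<^sup>2)"
          using j n \<tau> by (intro member_le_sum) auto
        also note \<eta>
        finally have "a j \<le> 4 * ?A * \<epsilon>\<^sup>2" using ampl[of "h1_norm \<Omega> (usr j)"] by simp
        then have "(a 0 / a j) * a j \<le> (a 0 / a j) * (4 * ?A * \<epsilon>\<^sup>2)"
          by (intro mult_left_mono) (auto simp: a_def)
        then have "a 0 \<le> 4 * ?A * (a 0 / a j) * \<epsilon>\<^sup>2"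
          using \<open>0 < a j\<close> by (simp add: mult_ac)
        then show ?thesis unfolding C4 distrib_right by (rule add_increasing2[rotated]) simp
      qed
      also have "\<dots> \<le> ?C4 us usr * exp (?C3 us usr * (real n * \<tau>)) * \<epsilon>\<^sup>2"
        using mult_left_mono[OF exp C4_nonneg] by (intro mult_right_mono) auto
      finally show "a 0 \<le> ?C4 us usr * exp (?C3 us usr * (real n * \<tau>)) * \<epsilon>\<^sup>2" .
    qed
  qed
qed

end
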